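(* Let $M$ be a closed connected smooth Riemannian manifold and let $G:T^*M\to\mathbb{R}$ be continuous, convex in $p$, and superlinear in $p$ ($G(x,p)/\|p\|_x\to+\infty$ as $\|p\|_x\to\infty$). For any viscosity solutions $u_1$ and $u_2$ of $G(x,d_xu)=c(G)$ in $M$, if $$\int_Mu_1(y)\,d\mu(y)\le\int_Mu_2(y)\,d\mu(y)$$ for all projected Mather measures $\mu$ of $L_G$, then $u_1\le u_2$ on $M$.
   Context: The critical value of $G$ is $c(G)=\inf_{f\in C^1(M)}\max_{x\in M}G(x,d_xf)$; it is the only constant $c$ for which $G(x,d_xu)=c$ admits viscosity solutions on $M$. The Lagrangian is $L_G(x,v)=\sup_{p\in T_x^*M}(p(v)-G(x,p))$ on $TM$. A Borel probability measure $\tilde\mu$ on $TM$ is closed if $\int_{TM}\|v\|_x\,d\tilde\mu<\infty$ and $\int_{TM}d_x\varphi(v)\,d\tilde\mu(x,v)=0$ for all $\varphi\in C^1(M)$. A Mather measure of $L_G$ is a closed probability measure $\tilde\mu$ with $\int_{TM}L_G\,d\tilde\mu=-c(G)$. A projected Mather measure is $\mu=\pi_\#\tilde\mu$ with $\tilde\mu$ a Mather measure and $\pi:TM\to M$ the canonical projection. *)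

theory Defs
  imports "HOL-Probability.Probability"
begin

section \<open>Smooth maps between normed spaces\<close>

text \<open>For open \<open>S\<close> in a finite-dimensional space, \<open>Ck_on k S f\<close> says that \<open>f\<close> is of class \<open>C^k\<close>
  on \<open>S\<close>: all iterated directional derivatives up to order \<open>k\<close> exist and are continuous.\<close>

primrec Ck_on ::
  "nat \<Rightarrow> 'a::real_normed_vector set \<Rightarrow> ('a \<Rightarrow> 'b::real_normed_vector) \<Rightarrow> bool" where
  "Ck_on 0 S f \<longleftrightarrow> continuous_on S f"
| "Ck_on (Suc k) S f \<longleftrightarrow> (\<forall>x\<in>S. f differentiable (at x)) \<and>
     (\<forall>h. Ck_on k S (\<lambda>x. frechet_derivative f (at x) h))"

definition smooth_on :: "'a::real_normed_vector set \<Rightarrow> ('a \<Rightarrow> 'b::real_normed_vector) \<Rightarrow> bool" where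
  "smooth_on S f \<longleftrightarrow> (\<forall>k. Ck_on k S f)"

section \<open>Smooth manifolds\<close>

text \<open>The manifold is the whole type \<open>'m\<close>; the model space is \<open>'e\<close>. A chart is a pair of
  its domain and its coordinate map (whose values outside the domain are irrelevant).\<close>

type_synonym ('m, 'e) chart = "'m set \<times> ('m \<Rightarrow> 'e)"

abbreviation chart_dom :: "('m, 'e) chart \<Rightarrow> 'm set" where "chart_dom \<equiv> fst"
abbreviation chart_map :: "('m, 'e) chart \<Rightarrow> 'm \<Rightarrow> 'e" where "chart_map \<equiv> snd"

definition chart_inv :: "('m, 'e) chart \<Rightarrow> 'e \<Rightarrow> 'm" where
  "chart_inv c = inv_into (chart_dom c) (chart_map c)"

definition chart_img :: "('m, 'e) chart \<Rightarrow> 'e set" where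
  "chart_img c = chart_map c ` chart_dom c"

definition transition :: "('m, 'e) chart \<Rightarrow> ('m, 'e) chart \<Rightarrow> 'e \<Rightarrow> 'e" where
  "transition c d = chart_map d \<circ> chart_inv c"

definition smooth_atlas :: "('m::t2_space, 'e::euclidean_space) chart set \<Rightarrow> bool" where
  "smooth_atlas A \<longleftrightarrow>
     (\<Union>c\<in>A. chart_dom c) = UNIV \<and>
     (\<forall>c\<in>A. open (chart_dom c) \<and> open (chart_img c) \<and>
        homeomorphism (chart_dom c) (chart_img c) (chart_map c) (chart_inv c)) \<and>
     (\<forall>c\<in>A. \<forall>d\<in>A. smooth_on (chart_map c ` (chart_dom c \<inter> chart_dom d)) (transition c d))"

definition C1_functions :: "('m::t2_space, 'e::euclidean_space) chart set \<Rightarrow> ('m \<Rightarrow> real) set" where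
  "C1_functions A = {f. \<forall>c\<in>A. Ck_on 1 (chart_img c) (f \<circ> chart_inv c)}"

section \<open>Tangent and cotangent bundle\<close>

text \<open>A tangent vector at \<open>x\<close> is the family of its components in all charts around \<open>x\<close>,
  which transform by the derivatives of the transition maps. Components in irrelevant charts are
  set to \<open>0\<close>, so that a tangent vector has exactly one representation. The vector space operations
  are pointwise.\<close>

type_synonym ('m, 'e) tvec = "('m, 'e) chart \<Rightarrow> 'e"

definition tangent_space ::
  "('m::t2_space, 'e::euclidean_space) chart set \<Rightarrow> 'm \<Rightarrow> ('m, 'e) tvec set" where
  "tangent_space A x = {v.
     (\<forall>c. c \<notin> A \<or> x \<notin> chart_dom c \<longrightarrow> v c = 0) \<and>
     (\<forall>c\<in>A. \<forall>d\<in>A. x \<in> chart_dom c \<inter> chart_dom d \<longrightarrow>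
        v d = frechet_derivative (transition c d) (at (chart_map c x)) (v c))}"

text \<open>The tangent vector at \<open>x\<close> whose component in the chart \<open>c\<close> is \<open>e\<close>.\<close>

definition coord_vector ::
  "('m::t2_space, 'e::euclidean_space) chart set \<Rightarrow> ('m, 'e) chart \<Rightarrow> 'm \<Rightarrow> 'e \<Rightarrow> ('m, 'e) tvec" where
  "coord_vector A c x e = (\<lambda>d. if d \<in> A \<and> x \<in> chart_dom d
     then frechet_derivative (transition c d) (at (chart_map c x)) e else 0)"

text \<open>The cotangent space is the dual of the tangent space; functionals are extended by \<open>0\<close>
  outside the tangent space.\<close>

type_synonym ('m, 'e) covec = "('m, 'e) tvec \<Rightarrow> real"

definition cotangent_space ::
  "('m::t2_space, 'e::euclidean_space) chart set \<Rightarrow> 'm \<Rightarrow> ('m, 'e) covec set" where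
  "cotangent_space A x = {p.
     (\<forall>v\<in>tangent_space A x. \<forall>w\<in>tangent_space A x. \<forall>a b.
        p (\<lambda>c. a *\<^sub>R v c + b *\<^sub>R w c) = a * p v + b * p w) \<and>
     (\<forall>v. v \<notin> tangent_space A x \<longrightarrow> p v = 0)}"

text \<open>The components of a covector at \<open>x\<close> in the chart \<open>c\<close>.\<close>

definition covec_coords ::
  "('m::t2_space, 'e::euclidean_space) chart set \<Rightarrow> ('m, 'e) chart \<Rightarrow> 'm \<Rightarrow> ('m, 'e) covec \<Rightarrow> 'e" where
  "covec_coords A c x p = (\<Sum>b\<in>Basis. p (coord_vector A c x b) *\<^sub>R b)"

definition tangent_bundle ::
  "('m::t2_space, 'e::euclidean_space) chart set \<Rightarrow> ('m \<times> ('m, 'e) tvec) set" where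
  "tangent_bundle A = Sigma UNIV (tangent_space A)"

definition cotangent_bundle ::
  "('m::t2_space, 'e::euclidean_space) chart set \<Rightarrow> ('m \<times> ('m, 'e) covec) set" where
  "cotangent_bundle A = Sigma UNIV (cotangent_space A)"

text \<open>Both bundles carry the topology for which the induced bundle charts
  are homeomorphisms onto \<open>chart_img c \<times> UNIV\<close>.\<close>

definition tangent_topology ::
  "('m::t2_space, 'e::euclidean_space) chart set \<Rightarrow> ('m \<times> ('m, 'e) tvec) topology" where
  "tangent_topology A = topology_generated_by
     {{(x, v) \<in> tangent_bundle A. x \<in> chart_dom c \<and> (chart_map c x, v c) \<in> W} | c W.
        c \<in> A \<and> open W}"

definition cotangent_topology ::
  "('m::t2_space, 'e::euclidean_space) chart set \<Rightarrow> ('m \<times> ('m, 'e) covec) topology" where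
  "cotangent_topology A = topology_generated_by
     {{(x, p) \<in> cotangent_bundle A. x \<in> chart_dom c \<and> (chart_map c x, covec_coords A c x p) \<in> W} | c W.
        c \<in> A \<and> open W}"

definition tangent_borel ::
  "('m::t2_space, 'e::euclidean_space) chart set \<Rightarrow> ('m \<times> ('m, 'e) tvec) measure" where
  "tangent_borel A = sigma (tangent_bundle A) {W. openin (tangent_topology A) W}"

text \<open>For \<open>C^1\<close> functions the value does not depend on the chosen chart around \<open>x\<close>.\<close>

definition differential ::
  "('m::t2_space, 'e::euclidean_space) chart set \<Rightarrow> ('m \<Rightarrow> real) \<Rightarrow> 'm \<Rightarrow> ('m, 'e) covec" where
  "differential A f x = (\<lambda>v. if v \<in> tangent_space A x
     then (let c = (SOME c. c \<in> A \<and> x \<in> chart_dom c)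
           in frechet_derivative (f \<circ> chart_inv c) (at (chart_map c x)) (v c))
     else 0)"

section \<open>Riemannian metrics\<close>

definition riemannian_metric ::
  "('m::t2_space, 'e::euclidean_space) chart set \<Rightarrow>
   ('m \<Rightarrow> ('m, 'e) tvec \<Rightarrow> ('m, 'e) tvec \<Rightarrow> real) \<Rightarrow> bool" where
  "riemannian_metric A g \<longleftrightarrow>
     (\<forall>x. \<forall>u\<in>tangent_space A x. \<forall>v\<in>tangent_space A x. \<forall>w\<in>tangent_space A x. \<forall>a b.
        g x (\<lambda>c. a *\<^sub>R u c + b *\<^sub>R v c) w = a * g x u w + b * g x v w) \<and>
     (\<forall>x. \<forall>v\<in>tangent_space A x. \<forall>w\<in>tangent_space A x. g x v w = g x w v) \<and>
     (\<forall>x. \<forall>v\<in>tangent_space A x. v \<noteq> (\<lambda>c. 0) \<longrightarrow> g x v v > 0) \<and>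
     (\<forall>c\<in>A. \<forall>a b. smooth_on (chart_img c)
        (\<lambda>y. g (chart_inv c y) (coord_vector A c (chart_inv c y) a)
                               (coord_vector A c (chart_inv c y) b)))"

definition closed_connected_riemannian_manifold ::
  "('m::t2_space, 'e::euclidean_space) chart set \<Rightarrow>
   ('m \<Rightarrow> ('m, 'e) tvec \<Rightarrow> ('m, 'e) tvec \<Rightarrow> real) \<Rightarrow> bool" where
  "closed_connected_riemannian_manifold A g \<longleftrightarrow>
     compact (UNIV :: 'm set) \<and> connected (UNIV :: 'm set) \<and> smooth_atlas A \<and> riemannian_metric A g"

definition tnorm ::
  "('m \<Rightarrow> ('m, 'e) tvec \<Rightarrow> ('m, 'e) tvec \<Rightarrow> real) \<Rightarrow> 'm \<Rightarrow> ('m, 'e) tvec \<Rightarrow> real" where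
  "tnorm g x v = sqrt (g x v v)"

definition conorm ::
  "('m::t2_space, 'e::euclidean_space) chart set \<Rightarrow>
   ('m \<Rightarrow> ('m, 'e) tvec \<Rightarrow> ('m, 'e) tvec \<Rightarrow> real) \<Rightarrow> 'm \<Rightarrow> ('m, 'e) covec \<Rightarrow> real" where
  "conorm A g x p = (SUP v\<in>{v \<in> tangent_space A x. tnorm g x v \<le> 1}. p v)"

section \<open>Hamiltonians and viscosity solutions\<close>

definition convex_in_p ::
  "('m::t2_space, 'e::euclidean_space) chart set \<Rightarrow> ('m \<times> ('m, 'e) covec \<Rightarrow> real) \<Rightarrow> bool" where
  "convex_in_p A G \<longleftrightarrow>
     (\<forall>x. \<forall>p\<in>cotangent_space A x. \<forall>q\<in>cotangent_space A x. \<forall>t\<in>{0..1}.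
        G (x, \<lambda>v. (1 - t) * p v + t * q v) \<le> (1 - t) * G (x, p) + t * G (x, q))"

definition superlinear_in_p ::
  "('m::t2_space, 'e::euclidean_space) chart set \<Rightarrow>
   ('m \<Rightarrow> ('m, 'e) tvec \<Rightarrow> ('m, 'e) tvec \<Rightarrow> real) \<Rightarrow> ('m \<times> ('m, 'e) covec \<Rightarrow> real) \<Rightarrow> bool" where
  "superlinear_in_p A g G \<longleftrightarrow>
     (\<forall>x. filterlim (\<lambda>p. G (x, p) / conorm A g x p) at_top
        (inf (filtercomap (conorm A g x) at_top) (principal (cotangent_space A x))))"

definition viscosity_solution ::
  "('m::t2_space, 'e::euclidean_space) chart set \<Rightarrow> ('m \<times> ('m, 'e) covec \<Rightarrow> real) \<Rightarrow>
   real \<Rightarrow> ('m \<Rightarrow> real) \<Rightarrow> bool" where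
  "viscosity_solution A G c u \<longleftrightarrow> continuous_on UNIV u \<and>
     (\<forall>\<phi>\<in>C1_functions A. \<forall>x.
        (\<forall>\<^sub>F y in nhds x. u y - \<phi> y \<le> u x - \<phi> x) \<longrightarrow> G (x, differential A \<phi> x) \<le> c) \<and>
     (\<forall>\<phi>\<in>C1_functions A. \<forall>x.
        (\<forall>\<^sub>F y in nhds x. u y - \<phi> y \<ge> u x - \<phi> x) \<longrightarrow> G (x, differential A \<phi> x) \<ge> c)"

text \<open>For continuous \<open>G\<close> the inner supremum is a maximum, by compactness.\<close>

definition critical_value ::
  "('m::t2_space, 'e::euclidean_space) chart set \<Rightarrow> ('m \<times> ('m, 'e) covec \<Rightarrow> real) \<Rightarrow> real" where
  "critical_value A G = (INF f\<in>C1_functions A. SUP x. G (x, differential A f x))"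

definition Lagrangian ::
  "('m::t2_space, 'e::euclidean_space) chart set \<Rightarrow> ('m \<times> ('m, 'e) covec \<Rightarrow> real) \<Rightarrow>
   'm \<times> ('m, 'e) tvec \<Rightarrow> real" where
  "Lagrangian A G = (\<lambda>(x, v). SUP p\<in>cotangent_space A x. p v - G (x, p))"

section \<open>Mather measures\<close>

definition closed_prob_measure ::
  "('m::t2_space, 'e::euclidean_space) chart set \<Rightarrow>
   ('m \<Rightarrow> ('m, 'e) tvec \<Rightarrow> ('m, 'e) tvec \<Rightarrow> real) \<Rightarrow> ('m \<times> ('m, 'e) tvec) measure \<Rightarrow> bool" where
  "closed_prob_measure A g \<nu> \<longleftrightarrow>
     prob_space \<nu> \<and> sets \<nu> = sets (tangent_borel A) \<and>
     (\<integral>\<^sup>+ (x, v). ennreal (tnorm g x v) \<partial>\<nu>) < \<infinity> \<and>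
     (\<forall>\<phi>\<in>C1_functions A. (\<integral>(x, v). differential A \<phi> x v \<partial>\<nu>) = 0)"

text \<open>Integrability is required explicitly because the Bochner integral of a non-integrable
  function is \<open>0\<close>; the Lagrangian is bounded below, so its integral always makes sense in
  \<open>(-\<infinity>, \<infinity>]\<close>, and it is finite exactly if the Lagrangian is integrable.\<close>

definition mather_measure ::
  "('m::t2_space, 'e::euclidean_space) chart set \<Rightarrow>
   ('m \<Rightarrow> ('m, 'e) tvec \<Rightarrow> ('m, 'e) tvec \<Rightarrow> real) \<Rightarrow> ('m \<times> ('m, 'e) covec \<Rightarrow> real) \<Rightarrow>
   ('m \<times> ('m, 'e) tvec) measure \<Rightarrow> bool" where
  "mather_measure A g G \<nu> \<longleftrightarrow> closed_prob_measure A g \<nu> \<and>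
     integrable \<nu> (Lagrangian A G) \<and> (\<integral>z. Lagrangian A G z \<partial>\<nu>) = - critical_value A G"

definition projected_mather_measure ::
  "('m::t2_space, 'e::euclidean_space) chart set \<Rightarrow>
   ('m \<Rightarrow> ('m, 'e) tvec \<Rightarrow> ('m, 'e) tvec \<Rightarrow> real) \<Rightarrow> ('m \<times> ('m, 'e) covec \<Rightarrow> real) \<Rightarrow>
   'm measure \<Rightarrow> bool" where
  "projected_mather_measure A g G \<mu> \<longleftrightarrow>
     (\<exists>\<nu>. mather_measure A g G \<nu> \<and> \<mu> = distr \<nu> borel fst)"

end

theory Submission
  imports Defs
begin

text \<open>Let \<open>Z\<close> be the set of maximum points of \<open>u1 - u2\<close> and \<open>c\<close> the critical value. It suffices to find a
  Mather measure supported over \<open>Z\<close>, since then \<open>max (u1 - u2) = \<integral> (u1 - u2) \<le> 0\<close>.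

  Doubling variables at a maximum point of \<open>(1 - s) * u1 + s * \<phi> - u2\<close>, for a \<open>C\<^sup>1\<close> function \<open>\<phi>\<close>, produces a
  covector \<open>q\<close> with \<open>G q \<le> c \<le> G ((1 - s) * q + s * d\<phi>)\<close>. By convexity \<open>c \<le> G\<close> on the rest of the segment up
  to \<open>d\<phi>\<close>, so \<open>s \<rightarrow> 0\<close> gives a point of \<open>Z\<close> and a \<open>q\<close> with \<open>G q \<le> c\<close> and \<open>c \<le> G\<close> on the whole segment
  from \<open>q\<close> to \<open>d\<phi>\<close>. Separating the segment from the epigraph of \<open>G\<close> yields a tangent vector \<open>v\<close>, bounded
  independently of \<open>\<phi>\<close>, with \<open>L v - d\<phi> v \<le> - c\<close>.

  Minimax duality turns this solvability for every single \<open>\<phi>\<close> into one probability measure \<open>\<nu>\<close> over \<open>Z\<close> with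
  \<open>\<integral> d\<phi> v = 0\<close> for all \<open>\<phi>\<close> and \<open>\<integral> L \<le> - c\<close>; the reverse inequality is the definition of \<open>c\<close>. Since \<open>L\<close> is only
  known to be lower semicontinuous, the duality is applied on the compact set of triples \<open>(x, v, \<tau>)\<close> with
  \<open>L (x, v) \<le> \<tau>\<close>, on which \<open>\<tau>\<close> is continuous.\<close>

section \<open>Annihilating probability measures on compact sets\<close>

text \<open>Minimax needs a compact set that is fixed before \<open>\<phi>\<close> is chosen. The
  bound on \<open>v\<close> supplies it: \<open>v\<close> is a subgradient of \<open>G\<close> at
  \<open>q\<close>, and \<open>q\<close> lies in a sublevel set of \<open>G\<close>. Superlinearity
  is assumed fibre by fibre only, so convexity and compactness of the manifold must make this
  sublevel set bounded uniformly. The differential of \<open>\<phi>\<close> enters solely through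
  the sign of \<open>v\<close> on \<open>d\<phi> - q\<close>, which is the inequality
  \<open>L v + c \<le> d\<phi> v\<close>. The weight \<open>1 - s\<close> ties the covectors
  together: if \<open>q\<close> belongs to \<open>u1\<close> at the contact point, then
  \<open>u2\<close> has the covector \<open>(1 - s) * q + s * d\<phi>\<close>, so the two viscosity
  inequalities speak about one segment. The measure of the minimax step is a weak limit of uniform
  measures on finite lists of points, and the lists come from a strategy that keeps all accumulated
  sums small. All this happens in a Euclidean space, on a disjoint union of finitely many compact
  pieces, one for each chart; the tangent bundle receives the measure by a pushforward at the
  end.\<close>

lemma binary_expansion:
  fixes t :: real
  assumes "0 \<le> t" "t \<le> 1"
  obtains b :: "nat \<Rightarrow> real" where "\<And>i. b i \<in> {0, 1}" "(\<lambda>i. b i * (1/2) ^ Suc i) sums t"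
proof -
  \<comment> \<open>\<open>r n\<close> is the part of \<open>t\<close> not covered by the first
    \<open>n\<close> digits, scaled by \<open>2 ^ n\<close>. It stays in [0, 1]; the recursion fixes
    the value 1, so \<open>t = 1\<close> gets the expansion with all digits 1.\<close>
  define r where "r = rec_nat t (\<lambda>_ r. 2 * r - (if r \<ge> 1/2 then 1 else 0))"
  define b :: "nat \<Rightarrow> real" where "b n = (if r n \<ge> 1/2 then 1 else 0)" for n
  have r0: "r 0 = t" and rS: "r (Suc n) = 2 * r n - b n" for n
    by (simp_all add: r_def b_def)
  have r01: "0 \<le> r n \<and> r n \<le> 1" for n
    by (induction n) (use assms in \<open>auto simp: r0 rS b_def\<close>)
  have part: "(\<Sum>i<n. b i * (1/2) ^ Suc i) = t - r n * (1/2) ^ n" for n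
    by (induction n) (auto simp: r0 rS field_simps)
  have "(\<lambda>n. r n * (1/2) ^ n) \<longlonglongrightarrow> 0"
  proof (rule Lim_null_comparison)
    show "\<forall>\<^sub>F n in sequentially. norm (r n * (1/2) ^ n) \<le> (1/2) ^ n"
      using r01 by (auto simp: abs_mult mult_le_cancel_right1)
    show "(\<lambda>n. (1/2) ^ n :: real) \<longlonglongrightarrow> 0" by (simp add: LIMSEQ_realpow_zero)
  qed
  then have "(\<lambda>n. t - r n * (1/2) ^ n) \<longlonglongrightarrow> t"
    using tendsto_diff[of "\<lambda>_. t" t sequentially] by fastforce
  then have "(\<lambda>i. b i * (1/2) ^ Suc i) sums t"
    by (simp add: sums_def part del: power_Suc)
  then show ?thesis by (intro that[of b]) (auto simp: b_def)
qed

lemma compact_binary_sequences: "compact {b :: nat \<Rightarrow> real. \<forall>i. b i \<in> {0, 1}}"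
proof -
  have "compactin (product_topology (\<lambda>i::nat. euclidean :: real topology) UNIV) (PiE UNIV (\<lambda>_. {0, 1}))"
    by (subst compactin_PiE) auto
  moreover have "PiE UNIV (\<lambda>_. {0, 1}) = {b :: nat \<Rightarrow> real. \<forall>i. b i \<in> {0, 1}}"
    by (auto simp: PiE_def)
  ultimately show ?thesis by (simp add: euclidean_product_topology)
qed

text \<open>Uniform convergence against a geometric series. The reindexing \<open>k\<close> lets the
  statement serve both for one coordinate among interleaved digits (\<open>q = 1/2\<close>) and for
  the whole sequence (\<open>q = 1/4\<close>).\<close>

lemma continuous_on_digit_series:
  fixes q :: real and k :: "nat \<Rightarrow> nat"
  assumes "0 \<le> q" "q < 1"
  shows "continuous_on {b :: nat \<Rightarrow> real. \<forall>i. b i \<in> {0, 1}} (\<lambda>b. \<Sum>i. b (k i) * q ^ i)"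
proof (rule uniform_limit_theorem)
  let ?S = "{b :: nat \<Rightarrow> real. \<forall>i. b i \<in> {0, 1}}"
  show "uniform_limit ?S (\<lambda>n b. \<Sum>i<n. b (k i) * q ^ i) (\<lambda>b. \<Sum>i. b (k i) * q ^ i) sequentially"
  proof (rule Weierstrass_m_test)
    fix n b assume "b \<in> ?S"
    then have "b (k n) \<in> {0, 1}" by blast
    then show "norm (b (k n) * q ^ n) \<le> q ^ n" using assms by auto
  next
    show "summable (\<lambda>n. q ^ n)" using assms by simp
  qed
  show "\<forall>\<^sub>F n in sequentially. continuous_on ?S (\<lambda>b. \<Sum>i<n. b (k i) * q ^ i)"
    by (intro always_eventually allI continuous_intros
        continuous_on_subset[OF continuous_on_product_coordinates]) auto
qed auto

lemma summable_digits:
  fixes q :: real and b :: "nat \<Rightarrow> real"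
  assumes "\<And>i. b i \<in> {0, 1}" "0 \<le> q" "q < 1"
  shows "summable (\<lambda>i. b i * q ^ i)"
proof (rule summable_comparison_test')
  show "summable (\<lambda>n. q ^ n)" using assms by simp
  fix n :: nat
  have "b n = 0 \<or> b n = 1" using assms(1)[of n] by blast
  then show "norm (b n * q ^ n) \<le> q ^ n" using assms(2) by auto
qed

text \<open>With digits 0 and 1 in base 4, everything after the first digit contributes at most 1/3,
  too little to make up for a different first digit. In base 2 the tail can reach 1 and uniqueness
  fails.\<close>

lemma quaternary_digits_unique:
  fixes b b' :: "nat \<Rightarrow> real"
  assumes "\<And>i. b i \<in> {0, 1}" "\<And>i. b' i \<in> {0, 1}"
    and "(\<Sum>i. b i * (1/4) ^ i) = (\<Sum>i. b' i * (1/4) ^ i)"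
  shows "b n = b' n"
  using assms
proof (induction n arbitrary: b b')
  have bnd: "0 \<le> (\<Sum>i. c (Suc i) * (1/4) ^ i) \<and> (\<Sum>i. c (Suc i) * (1/4) ^ i) \<le> 4/3"
    if "\<And>i. c i \<in> {0, 1}" for c :: "nat \<Rightarrow> real"
  proof
    have s: "summable (\<lambda>i. c (Suc i) * (1/4) ^ i)" using that by (intro summable_digits) auto
    have c: "0 \<le> c i" "c i \<le> 1" for i using that[of i] by auto
    show "0 \<le> (\<Sum>i. c (Suc i) * (1/4) ^ i)" using s c by (intro suminf_nonneg) auto
    have "(\<Sum>i. c (Suc i) * (1/4) ^ i) \<le> (\<Sum>i. (1/4) ^ i)"
      using s c by (intro suminf_le) (auto simp: mult_le_cancel_right1)
    also have "\<dots> = 4/3" by (subst suminf_geometric) auto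
    finally show "(\<Sum>i. c (Suc i) * (1/4) ^ i) \<le> 4/3" .
  qed
  have split: "(\<Sum>i. c i * (1/4) ^ i) = c 0 + (\<Sum>i. c (Suc i) * (1/4) ^ i) / 4"
    if "\<And>i. c i \<in> {0, 1}" for c :: "nat \<Rightarrow> real"
  proof -
    have s: "summable (\<lambda>i. c i * (1/4) ^ i)" using that by (intro summable_digits) auto
    have s': "summable (\<lambda>i. c (Suc i) * (1/4) ^ i)" using that by (intro summable_digits) auto
    have "(\<Sum>i. c (Suc i) * (1/4) ^ Suc i) = (\<Sum>i. (c (Suc i) * (1/4) ^ i) / 4)"
      by (intro suminf_cong) auto
    also have "\<dots> = (\<Sum>i. c (Suc i) * (1/4) ^ i) / 4" using s' by (rule suminf_divide)
    finally show ?thesis using suminf_split_head[OF s] by simp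
  qed
  have head: "b 0 = b' 0 \<and> (\<Sum>i. b (Suc i) * (1/4) ^ i) = (\<Sum>i. b' (Suc i) * (1/4) ^ i)"
    if 1: "\<And>i. b i \<in> {0, 1}" and 2: "\<And>i. b' i \<in> {0, 1}"
      and eq: "(\<Sum>i. b i * (1/4) ^ i) = (\<Sum>i. b' i * (1/4) ^ i)" for b b' :: "nat \<Rightarrow> real"
  proof -
    have "b 0 = 0 \<or> b 0 = 1" "b' 0 = 0 \<or> b' 0 = 1" using 1[of 0] 2[of 0] by blast+
    moreover note split[of b, OF 1] split[of b', OF 2] bnd[of b, OF 1] bnd[of b', OF 2] eq
    ultimately show ?thesis by linarith
  qed
  {
    case 0
    then show ?case using head by blast
  next
    case (Suc n)
    have "(\<lambda>i. b (Suc i)) n = (\<lambda>i. b' (Suc i)) n"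
      by (rule Suc.IH) (use head[OF Suc.prems] Suc.prems(1,2) in blast)+
    then show ?case by simp
  }
qed

text \<open>Interleaving binary digits makes every compact set a continuous image of a closed subset of a
  Cantor set. This transfers Helly's selection theorem from the real line to compact sets in any
  dimension.\<close>

lemma compact_image_of_compact_real:
  fixes K :: "'a::euclidean_space set"
  assumes "compact K"
  obtains C :: "real set" and \<pi> :: "real \<Rightarrow> 'a"
  where "compact C" "continuous_on C \<pi>" "\<pi> ` C = K"
proof -
  let ?S = "{b :: nat \<Rightarrow> real. \<forall>i. b i \<in> {0, 1}}"
  obtain R where R: "R > 0" "\<And>x. x \<in> K \<Longrightarrow> norm x \<le> R"
    using compact_imp_bounded[OF assms] by (auto simp: bounded_pos)
  define idx where "idx = to_nat_on (Basis :: 'a set)"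
  have inj: "inj_on idx Basis" unfolding idx_def by (simp add: inj_on_to_nat_on countable_finite)
  \<comment> \<open>The pairing function gives every coordinate its own infinite subsequence of
    digits.\<close>
  define k where "k \<beta> i = prod_encode (idx \<beta>, i)" for \<beta> i
  \<comment> \<open>The series starts at \<open>i = 0\<close> and so covers [0, 2]; subtracting 1
    and scaling by \<open>R\<close> covers [-R, R] in each coordinate.\<close>
  define \<pi>0 :: "(nat \<Rightarrow> real) \<Rightarrow> 'a"
    where "\<pi>0 b = (\<Sum>\<beta>\<in>Basis. (R * ((\<Sum>i. b (k \<beta> i) * (1/2) ^ i) - 1)) *\<^sub>R \<beta>)" for b
  have cont\<pi>: "continuous_on ?S \<pi>0"
    unfolding \<pi>0_def by (intro continuous_intros continuous_on_digit_series) auto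
  have surj: "\<exists>b\<in>?S. \<pi>0 b = x" if "x \<in> K" for x
  proof -
    have "\<exists>b :: nat \<Rightarrow> real. (\<forall>i. b i \<in> {0, 1}) \<and> (\<lambda>i. b i * (1/2) ^ Suc i) sums ((x \<bullet> \<beta> / R + 1) / 2)"
      if "\<beta> \<in> Basis" for \<beta>
    proof -
      have "\<bar>x \<bullet> \<beta>\<bar> \<le> R" using R(2)[OF \<open>x \<in> K\<close>] Basis_le_norm[OF that, of x] by linarith
      then have "0 \<le> (x \<bullet> \<beta> / R + 1) / 2" "(x \<bullet> \<beta> / R + 1) / 2 \<le> 1"
        using R(1) by (auto simp: abs_le_iff field_simps)
      from binary_expansion[OF this] show ?thesis by metis
    qed
    then obtain d :: "'a \<Rightarrow> nat \<Rightarrow> real" where d: "\<And>\<beta> i. \<beta> \<in> Basis \<Longrightarrow> d \<beta> i \<in> {0, 1}"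
      "\<And>\<beta>. \<beta> \<in> Basis \<Longrightarrow> (\<lambda>i. d \<beta> i * (1/2) ^ Suc i) sums ((x \<bullet> \<beta> / R + 1) / 2)"
      by metis
    define b where "b n = (case prod_decode n of (j, i) \<Rightarrow>
        if j \<in> idx ` Basis then d (inv_into Basis idx j) i else 0)" for n
    have bk: "b (k \<beta> i) = d \<beta> i" if "\<beta> \<in> Basis" for \<beta> i
      using that inj by (auto simp: b_def k_def)
    have "b n \<in> {0, 1}" for n
    proof (cases "prod_decode n")
      case (Pair j i)
      then show ?thesis using d(1)[of "inv_into Basis idx j" i] inv_into_into[of j idx Basis]
        by (auto simp: b_def)
    qed
    moreover have "\<pi>0 b = (\<Sum>\<beta>\<in>Basis. (x \<bullet> \<beta>) *\<^sub>R \<beta>)"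
      unfolding \<pi>0_def
    proof (rule sum.cong[OF refl])
      fix \<beta> :: 'a assume "\<beta> \<in> Basis"
      have "(\<lambda>i. 2 * (d \<beta> i * (1/2) ^ Suc i)) sums (2 * ((x \<bullet> \<beta> / R + 1) / 2))"
        by (intro sums_mult d(2)) fact
      then have "(\<lambda>i. b (k \<beta> i) * (1/2) ^ i) sums (x \<bullet> \<beta> / R + 1)"
        by (simp add: bk \<open>\<beta> \<in> Basis\<close> add_divide_distrib)
      then have "(\<Sum>i. b (k \<beta> i) * (1/2) ^ i) = x \<bullet> \<beta> / R + 1" by (rule sums_unique[symmetric])
      then show "(R * ((\<Sum>i. b (k \<beta> i) * (1/2) ^ i) - 1)) *\<^sub>R \<beta> = (x \<bullet> \<beta>) *\<^sub>R \<beta>"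
        using R(1) by simp
    qed
    ultimately show ?thesis by (auto simp: euclidean_representation)
  qed
  define S' where "S' = ?S \<inter> \<pi>0 -` K"
  have cS': "compact S'"
    unfolding S'_def
    by (rule closedin_compact[OF compact_binary_sequences])
      (intro continuous_closedin_preimage cont\<pi> compact_imp_closed assms)
  \<comment> \<open>Base 4 embeds binary sequences injectively into the line, as in the Cantor set.
    By compactness the embedding is a homeomorphism, and its inverse followed by
    \<open>\<pi>0\<close> is the required map.\<close>
  define e :: "(nat \<Rightarrow> real) \<Rightarrow> real" where "e b = (\<Sum>i. b i * (1/4) ^ i)" for b
  have conte: "continuous_on S' e"
    unfolding e_def S'_def
    by (rule continuous_on_subset[OF continuous_on_digit_series]) auto
  have "inj_on e S'"
    by (rule inj_onI, rule ext, rule quaternary_digits_unique) (auto simp: S'_def e_def)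
  then obtain g where g: "homeomorphism S' (e ` S') e g"
    using homeomorphism_compact[OF cS' conte refl] by blast
  show ?thesis
  proof
    show "compact (e ` S')" by (rule compact_continuous_image[OF conte cS'])
    show "continuous_on (e ` S') (\<pi>0 \<circ> g)"
      using g cont\<pi> by (intro continuous_on_compose)
        (auto simp: homeomorphism_def S'_def intro: continuous_on_subset)
    show "(\<pi>0 \<circ> g) ` (e ` S') = K"
    proof -
      have "g ` (e ` S') = S'" using g by (simp add: homeomorphism_def)
      then have "(\<pi>0 \<circ> g) ` (e ` S') = \<pi>0 ` S'" by (metis image_comp)
      also have "\<dots> = K" using surj by (fastforce simp: S'_def)
      finally show ?thesis .
    qed
  qed
qed

section \<open>Weak limits of finite averages\<close>

text \<open>The points are lifted along \<open>\<pi>\<close> to a bounded set \<open>C\<close> of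
  reals, where the uniform measures on the lifted points are tight and Helly's theorem applies. The
  limit is carried by \<open>C\<close> and returns to \<open>K\<close> by pushforward.\<close>

lemma averages_weak_limit:
  fixes K :: "'a::euclidean_space set" and N :: "nat \<Rightarrow> nat" and k :: "nat \<Rightarrow> nat \<Rightarrow> 'a"
  assumes K: "compact K" and N: "\<And>n. N n > 0" and k: "\<And>n m. m < N n \<Longrightarrow> k n m \<in> K"
  obtains r \<nu> where "strict_mono (r :: nat \<Rightarrow> nat)" "prob_space \<nu>"
    "sets \<nu> = sets (restrict_space borel K)"
    "\<And>f :: 'a \<Rightarrow> real. continuous_on K f \<Longrightarrow>
      (\<lambda>n. (\<Sum>m<N (r n). f (k (r n) m)) / N (r n)) \<longlonglongrightarrow> (\<integral>x. f x \<partial>\<nu>)"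
proof -
  obtain C :: "real set" and \<pi> :: "real \<Rightarrow> 'a"
    where C: "compact C" and \<pi>: "continuous_on C \<pi>" "\<pi> ` C = K"
    using compact_image_of_compact_real[OF K] by blast
  have "\<forall>n m. \<exists>c. m < N n \<longrightarrow> c \<in> C \<and> \<pi> c = k n m"
    using k \<pi>(2) by (metis imageE)
  then obtain c where c: "\<And>n m. m < N n \<Longrightarrow> c n m \<in> C" "\<And>n m. m < N n \<Longrightarrow> \<pi> (c n m) = k n m"
    by metis
  define \<mu> where "\<mu> n = distr (measure_pmf (pmf_of_set {..<N n})) borel (c n)" for n
  have pm: "set_pmf (pmf_of_set {..<N n}) = {..<N n}" for n
    using N[of n] by (intro set_pmf_of_set) auto
  have rd: "real_distribution (\<mu> n)" for n
    unfolding \<mu>_def by (intro prob_space.real_distribution_distr measure_pmf.prob_space_axioms) simp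
  have int\<mu>: "(\<integral>x. f x \<partial>\<mu> n) = (\<Sum>m<N n. f (c n m)) / N n"
    if "f \<in> borel_measurable borel" for f :: "real \<Rightarrow> real" and n
    unfolding \<mu>_def using that N[of n]
    by (simp add: integral_distr integral_pmf_of_set lessThan_empty_iff)
  obtain b where b: "b > 0" "\<And>x. x \<in> C \<Longrightarrow> norm x \<le> b"
    using compact_imp_bounded[OF C] by (auto simp: bounded_pos)
  have "tight \<mu>"
    unfolding tight_def
  proof (intro conjI allI impI rd)
    fix \<epsilon> :: real assume "\<epsilon> > 0"
    \<comment> \<open>The interval is open on the left while \<open>- b\<close> may be attained,
      hence the extra 1.\<close>
    have "measure (\<mu> n) {-(b+1)<..b} = 1" for n
    proof -
      interpret real_distribution "\<mu> n" by (rule rd)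
      have "AE x in \<mu> n. x \<in> {-(b+1)<..b}"
        unfolding \<mu>_def
        using b c(1)[of _ n] pm[of n]
        by (subst AE_distr_iff) (force intro!: AE_pmfI simp: abs_le_iff)+
      then show ?thesis by (simp add: prob_eq_1)
    qed
    then show "\<exists>a b. a < b \<and> (\<forall>n. 1 - \<epsilon> < measure (\<mu> n) {a<..b})"
      using \<open>\<epsilon> > 0\<close> b(1) by (intro exI[of _ "-(b+1)"] exI[of _ b]) auto
  qed
  then obtain r M where r: "strict_mono (r :: nat \<Rightarrow> nat)" and M: "real_distribution M"
    and conv: "weak_conv_m (\<mu> \<circ> id \<circ> r) M"
    using tight_imp_convergent_subsubsequence[of \<mu> id] by (auto simp: strict_mono_def)
  interpret M: real_distribution M by (rule M)
  have lim: "(\<lambda>n. (\<Sum>m<N (r n). f (c (r n) m)) / N (r n)) \<longlonglongrightarrow> (\<integral>x. f x \<partial>M)"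
    if f: "continuous_on UNIV f" "\<And>x. norm (f x) \<le> B" for f :: "real \<Rightarrow> real" and B
  proof -
    have "(\<lambda>n. integral\<^sup>L ((\<mu> \<circ> id \<circ> r) n) f) \<longlonglongrightarrow> integral\<^sup>L M f"
      using f by (intro weak_conv_imp_integral_bdd_continuous_conv[OF _ M conv])
        (auto simp: rd continuous_on_eq_continuous_at)
    moreover have "integral\<^sup>L ((\<mu> \<circ> id \<circ> r) n) f = (\<Sum>m<N (r n). f (c (r n) m)) / N (r n)" for n
      using f(1) by (simp add: int\<mu> borel_measurable_continuous_onI)
    ultimately show ?thesis by simp
  qed
  have C_ne: "C \<noteq> {}" using c(1)[OF N] by blast
  have aeC: "AE x in M. x \<in> C"
  proof -
    \<comment> \<open>A bounded continuous function that vanishes exactly on \<open>C\<close>. Its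
      averages are 0, hence also its integral against the limit, which confines \<open>M\<close> to
      \<open>C\<close>.\<close>
    let ?g = "\<lambda>x. min 1 (infdist x C)"
    have g: "continuous_on UNIV ?g" by (intro continuous_intros)
    have gb: "norm (?g x) \<le> 1" for x using infdist_nonneg[of x C] by auto
    have "(\<Sum>m<N (r n). ?g (c (r n) m)) = 0" for n
      using c(1)[of _ "r n"] by (intro sum.neutral) auto
    then have "(\<integral>x. ?g x \<partial>M) = 0"
      using lim[OF g gb] by (simp add: LIMSEQ_const_iff)
    moreover have "integrable M ?g"
      using gb borel_measurable_continuous_onI[OF g]
      by (intro M.integrable_const_bound[where B=1] AE_I2) auto
    moreover have "AE x in M. 0 \<le> ?g x" by (intro AE_I2) (auto simp: infdist_nonneg)
    ultimately have "AE x in M. ?g x = 0" by (simp only: integral_nonneg_eq_0_iff_AE)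
    then show ?thesis
      by eventually_elim
        (use C C_ne in_closed_iff_infdist_zero[OF compact_imp_closed] in \<open>auto simp: min_def split: if_splits\<close>)
  qed
  have Cb: "C \<in> sets M" using C by (simp add: borel_compact)
  have pr: "prob_space (restrict_space M C)"
    using aeC Cb by (intro prob_space_restrict_space) (simp_all add: M.emeasure_eq_1_AE)
  have m\<pi>: "\<pi> \<in> measurable (restrict_space M C) (restrict_space borel K)"
  proof (rule measurable_restrict_space2)
    show "\<pi> \<in> space (restrict_space M C) \<rightarrow> K" using \<pi>(2) by (auto simp: space_restrict_space)
    have "\<pi> \<in> borel_measurable (restrict_space borel C)"
      using \<pi>(1) by (rule borel_measurable_continuous_on_restrict)
    moreover have "sets (restrict_space M C) = sets (restrict_space borel C)"
      by (intro sets_restrict_space_cong) simp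
    ultimately show "\<pi> \<in> borel_measurable (restrict_space M C)"
      by (simp cong: measurable_cong_sets)
  qed
  define \<nu> where "\<nu> = distr (restrict_space M C) (restrict_space borel K) \<pi>"
  show ?thesis
  proof (rule that[OF r, of \<nu>])
    show "prob_space \<nu>" unfolding \<nu>_def using pr m\<pi> by (rule prob_space.prob_space_distr)
    show "sets \<nu> = sets (restrict_space borel K)" by (simp add: \<nu>_def)
    fix f :: "'a \<Rightarrow> real" assume f: "continuous_on K f"
    have f\<pi>: "continuous_on C (f \<circ> \<pi>)" using f \<pi> by (intro continuous_on_compose) auto
    obtain B where B: "B \<ge> 0" "\<And>x. x \<in> C \<Longrightarrow> norm ((f \<circ> \<pi>) x) \<le> B"
      using compact_imp_bounded[OF compact_continuous_image[OF f\<pi> C]]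
      unfolding bounded_pos by (metis image_eqI less_imp_le)
    \<comment> \<open>Weak convergence is tested by functions on the whole line, but
      \<open>f \<circ> \<pi>\<close> is continuous on \<open>C\<close> only.\<close>
    obtain g where g: "continuous_on UNIV g" "\<And>x. x \<in> C \<Longrightarrow> g x = (f \<circ> \<pi>) x"
      "\<And>x. norm (g x) \<le> B"
      using Tietze[OF f\<pi> _ B, of UNIV] C by (auto simp: compact_imp_closed)
    have "(\<integral>x. f x \<partial>\<nu>) = (\<integral>x. f (\<pi> x) \<partial>restrict_space M C)"
      unfolding \<nu>_def using f by (intro integral_distr m\<pi> borel_measurable_continuous_on_restrict)
    also have "\<dots> = (\<integral>x. g x \<partial>restrict_space M C)"
      using g(2) by (intro Bochner_Integration.integral_cong) (auto simp: space_restrict_space)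
    also have "\<dots> = (\<integral>x. indicator C x *\<^sub>R g x \<partial>M)"
      using Cb by (intro integral_restrict_space) auto
    also have "\<dots> = (\<integral>x. g x \<partial>M)"
    proof (rule integral_cong_AE)
      have [measurable]: "g \<in> borel_measurable M" "C \<in> sets M"
        using borel_measurable_continuous_onI[OF g(1)] Cb by simp_all
      show "(\<lambda>x. indicator C x *\<^sub>R g x) \<in> borel_measurable M" "g \<in> borel_measurable M"
        by measurable
      show "AE x in M. indicator C x *\<^sub>R g x = g x" using aeC by eventually_elim simp
    qed
    finally have eq: "(\<integral>x. f x \<partial>\<nu>) = (\<integral>x. g x \<partial>M)" .
    have "(\<Sum>m<N (r n). g (c (r n) m)) = (\<Sum>m<N (r n). f (k (r n) m))" for n
      using c g(2) by (intro sum.cong) auto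
    then show "(\<lambda>n. (\<Sum>m<N (r n). f (k (r n) m)) / N (r n)) \<longlonglongrightarrow> (\<integral>x. f x \<partial>\<nu>)"
      using lim[OF g(1,3)] eq by simp
  qed
qed

text \<open>Blackwell's approachability strategy: always answer the accumulated sums \<open>s\<close> by a point at which
  \<open>h\<close> is dominated by \<open>- t * (\<Sum>i<n. s i * f i)\<close>. This replaces a separation argument in
  dimension \<open>n\<close>.\<close>

lemma approachability:
  fixes f :: "nat \<Rightarrow> 'a \<Rightarrow> real" and h :: "'a \<Rightarrow> real" and b t :: real
  assumes fb: "\<And>i x. i < n \<Longrightarrow> x \<in> K \<Longrightarrow> \<bar>f i x\<bar> \<le> b"
    and dom: "\<And>\<alpha>. \<exists>x\<in>K. h x \<le> (\<Sum>i<n. \<alpha> i * f i x)" and t: "t > 0"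
  obtains k :: "nat \<Rightarrow> 'a" where "\<And>m. k m \<in> K"
    "\<And>N. (\<Sum>i<n. (\<Sum>m<N. f i (k m))\<^sup>2) + 2 / t * (\<Sum>m<N. h (k m)) \<le> real N * (n * b\<^sup>2)"
proof -
  obtain X where X: "\<And>\<alpha>. X \<alpha> \<in> K" "\<And>\<alpha>. h (X \<alpha>) \<le> (\<Sum>i<n. \<alpha> i * f i (X \<alpha>))"
    using dom by metis
  \<comment> \<open>With the accumulated sums as \<open>s\<close>, the weights
    \<open>- t * s i\<close> let the next point push against the drift of the sums, unless
    \<open>h\<close> gains by it.\<close>
  define x where "x s = X (\<lambda>i. - t * s i)" for s :: "nat \<Rightarrow> real"
  define S where "S = rec_nat (\<lambda>i. 0) (\<lambda>m s i. s i + f i (x s))"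
  define k where "k m = x (S m)" for m
  have S: "S N i = (\<Sum>m<N. f i (k m))" for N i
    by (induction N) (auto simp: S_def k_def)
  have kK: "k m \<in> K" for m by (simp add: k_def x_def X)
  have "(\<Sum>i<n. (S N i)\<^sup>2) + 2 / t * (\<Sum>m<N. h (k m)) \<le> real N * (n * b\<^sup>2)" for N
  proof (induction N)
    case 0
    show ?case by (simp add: S)
  next
    case (Suc N)
    have "h (k N) \<le> (\<Sum>i<n. - t * S N i * f i (k N))"
      using X(2)[of "\<lambda>i. - t * S N i"] by (simp add: k_def x_def)
    also have "\<dots> = - t * (\<Sum>i<n. S N i * f i (k N))" by (simp add: sum_distrib_left mult.assoc)
    finally have "2 / t * h (k N) \<le> 2 / t * (- t * (\<Sum>i<n. S N i * f i (k N)))"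
      using t by (intro mult_left_mono) auto
    \<comment> \<open>This term absorbs the cross term in the square of the new sums, so that a
      round raises the potential by at most \<open>n * b\<^sup>2\<close>.\<close>
    then have *: "2 / t * h (k N) \<le> - 2 * (\<Sum>i<n. S N i * f i (k N))" using t by simp
    have "(\<Sum>i<n. (f i (k N))\<^sup>2) \<le> (\<Sum>i<n. b\<^sup>2)"
      using fb[OF _ kK[of N]] by (intro sum_mono) (metis abs_ge_zero lessThan_iff power2_abs power_mono)
    then have **: "(\<Sum>i<n. (f i (k N))\<^sup>2) \<le> n * b\<^sup>2" by simp
    have "(\<Sum>i<n. (S (Suc N) i)\<^sup>2) = (\<Sum>i<n. (S N i)\<^sup>2 + 2 * (S N i * f i (k N)) + (f i (k N))\<^sup>2)"
      by (intro sum.cong) (auto simp: S power2_eq_square algebra_simps)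
    also have "\<dots> = (\<Sum>i<n. (S N i)\<^sup>2) + 2 * (\<Sum>i<n. S N i * f i (k N)) + (\<Sum>i<n. (f i (k N))\<^sup>2)"
      by (simp add: sum.distrib sum_distrib_left)
    finally show ?case using Suc * ** by (simp add: algebra_simps)
  qed
  then show ?thesis using that[of k] kK by (simp add: S)
qed

text \<open>The potential bound leaves at most \<open>Q * t / 2\<close> for the average of
  \<open>h\<close>, so \<open>t\<close> is fixed small first. The price \<open>2 / t * B\<close>
  then enters the squared averages of the \<open>f i\<close> only after division by
  \<open>N\<close>, so \<open>N\<close> is taken large afterwards.\<close>

lemma approximate_averages:
  fixes f :: "nat \<Rightarrow> 'a \<Rightarrow> real" and h :: "'a \<Rightarrow> real" and b B \<epsilon> :: real
  assumes fb: "\<And>i x. i < n \<Longrightarrow> x \<in> K \<Longrightarrow> \<bar>f i x\<bar> \<le> b" and hB: "\<And>x. x \<in> K \<Longrightarrow> \<bar>h x\<bar> \<le> B"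
    and dom: "\<And>\<alpha>. \<exists>x\<in>K. h x \<le> (\<Sum>i<n. \<alpha> i * f i x)" and \<epsilon>: "\<epsilon> > 0"
  obtains N :: nat and k :: "nat \<Rightarrow> 'a" where "N > 0" "\<And>m. k m \<in> K"
    "(\<Sum>m<N. h (k m)) / N \<le> \<epsilon>" "\<And>i. i < n \<Longrightarrow> \<bar>(\<Sum>m<N. f i (k m)) / N\<bar> \<le> \<epsilon>"
proof -
  define Q where "Q = n * b\<^sup>2"
  have Q: "Q \<ge> 0" by (simp add: Q_def)
  define t where "t = \<epsilon> / (Q + 1)"
  have t: "t > 0" using \<epsilon> Q by (simp add: t_def)
  obtain k where k: "\<And>m. k m \<in> K" and
    main: "\<And>N. (\<Sum>i<n. (\<Sum>m<N. f i (k m))\<^sup>2) + 2 / t * (\<Sum>m<N. h (k m)) \<le> real N * Q"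
    using approachability[of n K f b h t] fb dom t unfolding Q_def by blast
  obtain N :: nat where N: "real N > (Q + 2 / t * B) / \<epsilon>\<^sup>2" "N > 0"
    using reals_Archimedean2[of "max 0 ((Q + 2 / t * B) / \<epsilon>\<^sup>2)"] by auto
  show ?thesis
  proof
    show "N > 0" by fact
    show "k m \<in> K" for m by (rule k)
    have "2 / t * (\<Sum>m<N. h (k m)) \<le> real N * Q"
      using main[of N] sum_nonneg[of "{..<n}" "\<lambda>i. (\<Sum>m<N. f i (k m))\<^sup>2"] by simp
    then have "(\<Sum>m<N. h (k m)) \<le> real N * Q * t / 2" using t by (simp add: field_simps)
    then have "(\<Sum>m<N. h (k m)) / N \<le> Q * t / 2" using N(2) by (simp add: field_simps)
    also have "\<dots> \<le> \<epsilon>" using \<epsilon> Q by (simp add: t_def field_simps)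
    finally show "(\<Sum>m<N. h (k m)) / N \<le> \<epsilon>" .
    fix i assume "i < n"
    have "\<bar>\<Sum>m<N. h (k m)\<bar> \<le> (\<Sum>m<N. B)"
      using hB[OF k] by (intro order.trans[OF sum_abs] sum_mono) auto
    then have "- (\<Sum>m<N. h (k m)) \<le> real N * B" by (simp add: abs_le_iff)
    then have "2 / t * (- (\<Sum>m<N. h (k m))) \<le> 2 / t * (real N * B)"
      using t by (intro mult_left_mono) auto
    then have "- (2 / t * (\<Sum>m<N. h (k m))) \<le> 2 / t * (real N * B)" by simp
    moreover have "(\<Sum>m<N. f i (k m))\<^sup>2 \<le> (\<Sum>i<n. (\<Sum>m<N. f i (k m))\<^sup>2)"
      using \<open>i < n\<close> by (intro member_le_sum[of i "{..<n}" "\<lambda>i. (\<Sum>m<N. f i (k m))\<^sup>2"]) auto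
    ultimately have "(\<Sum>m<N. f i (k m))\<^sup>2 \<le> real N * (Q + 2 / t * B)"
      using main[of N] by (simp add: algebra_simps)
    also have "\<dots> \<le> real N * (real N * \<epsilon>\<^sup>2)"
      using N \<epsilon> by (intro mult_left_mono) (auto simp: field_simps)
    also have "\<dots> = (real N * \<epsilon>)\<^sup>2" by (simp add: power2_eq_square algebra_simps)
    finally have "\<bar>\<Sum>m<N. f i (k m)\<bar> \<le> real N * \<epsilon>"
      using \<epsilon> by (simp add: abs_le_square_iff[symmetric])
    then show "\<bar>(\<Sum>m<N. f i (k m)) / N\<bar> \<le> \<epsilon>" using N(2) by (simp add: field_simps)
  qed
qed

text \<open>Separability, with the dense family taken inside \<open>V\<close> itself. A function is
  coded by an accuracy \<open>n\<close>, a mesh \<open>m\<close> on which it varies by less than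
  \<open>1 / Suc n\<close>, and its values on a finite net rounded down to multiples of
  \<open>1 / Suc n\<close>. There are countably many codes, and functions sharing a code differ by
  less than \<open>3 / Suc n\<close>.\<close>

lemma countable_uniformly_dense_family:
  fixes V :: "('a::metric_space \<Rightarrow> real) set"
  assumes K: "compact K" and V: "V \<noteq> {}" "\<And>f. f \<in> V \<Longrightarrow> continuous_on K f"
  obtains F :: "nat \<Rightarrow> 'a \<Rightarrow> real" where "\<And>i. F i \<in> V"
    "\<And>f \<epsilon>. f \<in> V \<Longrightarrow> \<epsilon> > 0 \<Longrightarrow> \<exists>i. \<forall>x\<in>K. \<bar>f x - F i x\<bar> < \<epsilon>"
proof -
  have "\<exists>l. set l \<subseteq> K \<and> K \<subseteq> (\<Union>x\<in>set l. ball x (1 / Suc m))" for m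
  proof -
    have "K \<subseteq> (\<Union>x\<in>K. ball x (1 / Suc m))" by force
    then obtain T where "T \<subseteq> K" "finite T" "K \<subseteq> (\<Union>x\<in>T. ball x (1 / Suc m))"
      using compactE_image[OF K, of K "\<lambda>x. ball x (1 / Suc m)"] by auto
    then show ?thesis using finite_list[of T] by auto
  qed
  then obtain net where net: "\<And>m. set (net m) \<subseteq> K" "\<And>m. K \<subseteq> (\<Union>x\<in>set (net m). ball x (1 / Suc m))"
    by metis
  define R where "R f z = (case z of (n, m, l) \<Rightarrow>
      (\<forall>x\<in>K. \<forall>y\<in>K. dist x y < 1 / Suc m \<longrightarrow> \<bar>f x - f y\<bar> < 1 / Suc n) \<and>
      l = map (\<lambda>x. \<lfloor>Suc n * f x\<rfloor>) (net m))"
    for f :: "'a \<Rightarrow> real" and z :: "nat \<times> nat \<times> int list"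
  \<comment> \<open>A code realised by no member of \<open>V\<close> is sent to an arbitrary member,
    so that the family stays inside \<open>V\<close>.\<close>
  define pick where "pick z = (SOME f. f \<in> V \<and> ((\<exists>f\<in>V. R f z) \<longrightarrow> R f z))" for z
  have "\<exists>f. f \<in> V \<and> ((\<exists>f\<in>V. R f z) \<longrightarrow> R f z)" for z using V(1) by blast
  then have pick: "pick z \<in> V" "\<And>f. f \<in> V \<Longrightarrow> R f z \<Longrightarrow> R (pick z) z" for z
    using someI_ex[of "\<lambda>f. f \<in> V \<and> ((\<exists>f\<in>V. R f z) \<longrightarrow> R f z)"] unfolding pick_def by blast+
  show ?thesis
  proof (rule that[of "\<lambda>i. pick (from_nat i)"])
    show "pick (from_nat i) \<in> V" for i by (rule pick)
    fix f and \<epsilon> :: real assume f: "f \<in> V" and \<epsilon>: "\<epsilon> > 0"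
    obtain n where n: "inverse (Suc n) < \<epsilon> / 3" using reals_Archimedean[of "\<epsilon> / 3"] \<epsilon> by auto
    have "uniformly_continuous_on K f" using K V(2)[OF f] by (rule compact_uniformly_continuous[rotated])
    then obtain d where d: "d > 0" "\<And>x y. x \<in> K \<Longrightarrow> y \<in> K \<Longrightarrow> dist x y < d \<Longrightarrow> dist (f x) (f y) < 1 / Suc n"
      by (rule uniformly_continuous_onE[of K f "1 / Suc n"]) (auto simp: dist_commute)
    obtain m where m: "inverse (Suc m) < d" using reals_Archimedean[OF d(1)] by auto
    define z where "z = (n, m, map (\<lambda>x. \<lfloor>Suc n * f x\<rfloor>) (net m))"
    have Rf: "R f z" using d m unfolding R_def z_def
      by (auto simp: inverse_eq_divide dist_real_def)
    define f' where "f' = pick z"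
    have Rf': "R f' z" unfolding f'_def by (rule pick(2)[OF f Rf])
    have "\<bar>f x - f' x\<bar> < \<epsilon>" if "x \<in> K" for x
    proof -
      obtain y where y: "y \<in> set (net m)" "dist y x < 1 / Suc m" using net(2)[of m] \<open>x \<in> K\<close> by auto
      have "y \<in> K" using y net by blast
      have 1: "\<bar>f y - f x\<bar> < 1 / Suc n" "\<bar>f' y - f' x\<bar> < 1 / Suc n"
        using Rf Rf' y \<open>x \<in> K\<close> \<open>y \<in> K\<close> unfolding R_def z_def by auto
      have "\<lfloor>Suc n * f y\<rfloor> = \<lfloor>Suc n * f' y\<rfloor>"
        using Rf' y(1) unfolding R_def z_def by auto
      then have "\<bar>Suc n * f y - Suc n * f' y\<bar> < 1" by linarith
      then have "Suc n * \<bar>f y - f' y\<bar> < 1" by (simp add: abs_mult flip: right_diff_distrib)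
      then have "\<bar>f y - f' y\<bar> < 1 / Suc n" by (simp add: field_simps)
      then show ?thesis using 1 n by (simp add: inverse_eq_divide)
    qed
    then show "\<exists>i. \<forall>x\<in>K. \<bar>f x - pick (from_nat i) x\<bar> < \<epsilon>"
      by (intro exI[of _ "to_nat z"]) (simp add: f'_def)
  qed
qed

text \<open>Linear combinations of the first \<open>n\<close> members of a dense sequence stay in
  \<open>V\<close>, so \<open>dom\<close> lets the strategy produce averages with error
  \<open>1 / Suc n\<close>. A weak limit of these averages removes the errors, and uniform density
  extends annihilation to all of \<open>V\<close>.\<close>

lemma annihilating_probability:
  fixes K :: "'a::euclidean_space set" and V :: "('a \<Rightarrow> real) set" and h :: "'a \<Rightarrow> real"
  assumes K: "compact K" and V: "\<And>f. f \<in> V \<Longrightarrow> continuous_on K f" "(\<lambda>x. 0) \<in> V"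
    "\<And>f g. f \<in> V \<Longrightarrow> g \<in> V \<Longrightarrow> (\<lambda>x. f x + g x) \<in> V" "\<And>f a. f \<in> V \<Longrightarrow> (\<lambda>x. a * f x) \<in> V"
    and h: "continuous_on K h" and dom: "\<And>f. f \<in> V \<Longrightarrow> \<exists>x\<in>K. h x \<le> f x"
  obtains \<nu> where "prob_space \<nu>" "sets \<nu> = sets (restrict_space borel K)"
    "\<And>f. f \<in> V \<Longrightarrow> (\<integral>x. f x \<partial>\<nu>) = 0" "(\<integral>x. h x \<partial>\<nu>) \<le> 0"
proof -
  obtain F :: "nat \<Rightarrow> 'a \<Rightarrow> real" where F: "\<And>i. F i \<in> V"
    "\<And>f \<epsilon>. f \<in> V \<Longrightarrow> \<epsilon> > 0 \<Longrightarrow> \<exists>i. \<forall>x\<in>K. \<bar>f x - F i x\<bar> < \<epsilon>"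
    using countable_uniformly_dense_family[OF K _ V(1)] V(2) by blast
  have bdd: "\<exists>B. \<forall>x\<in>K. \<bar>f x\<bar> \<le> B" if "continuous_on K f" for f :: "'a \<Rightarrow> real"
    using compact_imp_bounded[OF compact_continuous_image[OF that K]] by (auto simp: bounded_iff)
  obtain B where B: "\<And>x. x \<in> K \<Longrightarrow> \<bar>h x\<bar> \<le> B" using bdd[OF h] by blast
  obtain b where b: "\<And>i x. x \<in> K \<Longrightarrow> \<bar>F i x\<bar> \<le> b i" using bdd[OF V(1)[OF F(1)]] by metis
  have comb: "(\<lambda>x. \<Sum>i<n. \<alpha> i * F i x) \<in> V" for \<alpha> and n :: nat
  proof (induction n)
    case (Suc n)
    then show ?case using V(3)[OF Suc V(4)[OF F(1)[of n], of "\<alpha> n"]] by simp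
  qed (use V(2) in simp)
  have "\<forall>n. \<exists>(N::nat) k. N > 0 \<and> (\<forall>m. k m \<in> K) \<and> (\<Sum>m<N. h (k m)) / N \<le> inverse (Suc n) \<and>
      (\<forall>i<n. \<bar>(\<Sum>m<N. F i (k m)) / N\<bar> \<le> inverse (Suc n))"
  proof
    fix n
    have 1: "\<bar>F i x\<bar> \<le> (\<Sum>i<n. \<bar>b i\<bar>)" if "i < n" "x \<in> K" for i x
      using b[OF that(2), of i] member_le_sum[of i "{..<n}" "\<lambda>i. \<bar>b i\<bar>"] that by simp
    have 2: "\<exists>x\<in>K. h x \<le> (\<Sum>i<n. \<alpha> i * F i x)" for \<alpha> using dom[OF comb] .
    show "\<exists>(N::nat) k. N > 0 \<and> (\<forall>m. k m \<in> K) \<and> (\<Sum>m<N. h (k m)) / N \<le> inverse (Suc n) \<and>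
      (\<forall>i<n. \<bar>(\<Sum>m<N. F i (k m)) / N\<bar> \<le> inverse (Suc n))"
    proof (rule approximate_averages[OF 1 B 2])
      show "0 < inverse (real (Suc n))" by simp
    qed blast+
  qed
  from this[THEN choice] obtain N :: "nat \<Rightarrow> nat" where
    "\<forall>n. \<exists>k. N n > 0 \<and> (\<forall>m. k m \<in> K) \<and> (\<Sum>m<N n. h (k m)) / N n \<le> inverse (Suc n) \<and>
      (\<forall>i<n. \<bar>(\<Sum>m<N n. F i (k m)) / N n\<bar> \<le> inverse (Suc n))" ..
  from this[THEN choice] obtain k where N: "\<And>n. N n > 0" and k: "\<And>n m. k n m \<in> K"
    and kh: "\<And>n. (\<Sum>m<N n. h (k n m)) / N n \<le> inverse (Suc n)"
    and kF: "\<And>n i. i < n \<Longrightarrow> \<bar>(\<Sum>m<N n. F i (k n m)) / N n\<bar> \<le> inverse (Suc n)"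
    by blast
  obtain r \<nu> where r: "strict_mono (r :: nat \<Rightarrow> nat)" and \<nu>: "prob_space \<nu>"
    "sets \<nu> = sets (restrict_space borel K)"
    and lim: "\<And>f :: 'a \<Rightarrow> real. continuous_on K f \<Longrightarrow>
      (\<lambda>n. (\<Sum>m<N (r n). f (k (r n) m)) / N (r n)) \<longlonglongrightarrow> (\<integral>x. f x \<partial>\<nu>)"
    using averages_weak_limit[OF K, of N k] N k by blast
  interpret prob_space \<nu> by fact
  have sp: "space \<nu> = K" using sets_eq_imp_space_eq[OF \<nu>(2)] by (simp add: space_restrict_space)
  have meas: "f \<in> borel_measurable \<nu>" if "continuous_on K f" for f :: "'a \<Rightarrow> real"
    using borel_measurable_continuous_on_restrict[OF that] \<nu>(2) by (simp cong: measurable_cong_sets)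
  have intg: "integrable \<nu> f" if f: "continuous_on K f" for f :: "'a \<Rightarrow> real"
  proof -
    obtain C where "\<forall>x\<in>K. \<bar>f x\<bar> \<le> C" using bdd[OF f] by blast
    then show ?thesis using meas[OF f] sp by (intro integrable_const_bound[where B=C] AE_I2) auto
  qed
  have null: "(\<lambda>n. inverse (real (Suc (r n)))) \<longlonglongrightarrow> 0"
    using LIMSEQ_subseq_LIMSEQ[OF LIMSEQ_inverse_real_of_nat r] by (simp add: o_def)
  have zeroF: "(\<integral>x. F i x \<partial>\<nu>) = 0" for i
  proof (rule LIMSEQ_unique[OF lim[OF V(1)[OF F(1)]]])
    show "(\<lambda>n. (\<Sum>m<N (r n). F i (k (r n) m)) / N (r n)) \<longlonglongrightarrow> 0"
    proof (rule Lim_null_comparison[OF _ null])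
      show "\<forall>\<^sub>F n in sequentially. norm ((\<Sum>m<N (r n). F i (k (r n) m)) / N (r n)) \<le> inverse (real (Suc (r n)))"
        using eventually_gt_at_top[of i]
        proof eventually_elim
        case (elim n)
        then have "i < r n" using seq_suble[OF r, of n] by simp
        then show ?case using kF by simp
      qed
    qed
  qed
  show ?thesis
  proof (rule that[OF \<nu>])
    show "(\<integral>x. h x \<partial>\<nu>) \<le> 0"
      by (rule LIMSEQ_le[OF lim[OF h] null]) (use kh in blast)
    fix f assume f: "f \<in> V"
    have "\<bar>\<integral>x. f x \<partial>\<nu>\<bar> \<le> \<epsilon>" if \<epsilon>: "\<epsilon> > 0" for \<epsilon>
    proof -
      obtain i where i: "\<forall>x\<in>K. \<bar>f x - F i x\<bar> < \<epsilon>" using F(2)[OF f \<epsilon>] by blast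
      have "(\<integral>x. f x \<partial>\<nu>) = (\<integral>x. f x - F i x \<partial>\<nu>)"
        using intg[OF V(1)[OF f]] intg[OF V(1)[OF F(1)]] zeroF[of i]
        by (subst Bochner_Integration.integral_diff) auto
      moreover have "\<bar>\<integral>x. f x - F i x \<partial>\<nu>\<bar> \<le> (\<integral>x. \<bar>f x - F i x\<bar> \<partial>\<nu>)" by (rule integral_abs_bound)
      moreover have "(\<integral>x. \<bar>f x - F i x\<bar> \<partial>\<nu>) \<le> \<epsilon>"
        using intg[OF V(1)[OF f]] intg[OF V(1)[OF F(1)]] i sp
        by (intro integral_le_const integrable_abs Bochner_Integration.integrable_diff AE_I2) (auto simp: less_imp_le)
      ultimately show ?thesis by linarith
    qed
    from this[of "\<bar>\<integral>x. f x \<partial>\<nu>\<bar> / 2"] show "(\<integral>x. f x \<partial>\<nu>) = 0" by linarith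
  qed
qed

section \<open>Convex superlinear functions\<close>

text \<open>Otherwise points of the sublevel sets escape to infinity and their directions converge
  along a subsequence. Convexity between 0 and these points bounds \<open>H\<close> on the whole
  limiting ray, against \<open>ray\<close>. Growth known only pointwise in \<open>y\<close> thus
  becomes uniform over the compact \<open>Q\<close>.\<close>

lemma sublevel_bounded_uniformly:
  fixes H :: "'d::metric_space \<Rightarrow> 'e::euclidean_space \<Rightarrow> real"
  assumes Q: "compact Q" and cont: "continuous_on (Q \<times> UNIV) (\<lambda>(y, p). H y p)"
    and cvx: "\<And>y. y \<in> Q \<Longrightarrow> convex_on UNIV (H y)"
    and ray: "\<And>y q C. y \<in> Q \<Longrightarrow> q \<noteq> 0 \<Longrightarrow> \<exists>t\<ge>0. H y (t *\<^sub>R q) > C"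
  obtains B where "\<And>y p. y \<in> Q \<Longrightarrow> H y p \<le> a \<Longrightarrow> norm p \<le> B"
proof (rule ccontr)
  assume "\<not> thesis"
  then have "\<exists>y p. y \<in> Q \<and> H y p \<le> a \<and> norm p > real n" for n
    using that[of "real n"] by force
  then obtain y p where y: "\<And>n. y n \<in> Q" and Ha: "\<And>n. H (y n) (p n) \<le> a"
    and p: "\<And>n. norm (p n) > real n" by metis
  have p0: "norm (p n) > 0" for n using p[of n] by (metis of_nat_0_le_iff order.strict_trans1)
  define e where "e n = p n /\<^sub>R norm (p n)" for n
  have e: "norm (e n) = 1" for n using p0[of n] by (simp add: e_def)
  have "seq_compact (Q \<times> sphere (0::'e) 1)"
    using Q by (intro compact_imp_seq_compact compact_Times compact_sphere)
  moreover have "\<forall>n. (y n, e n) \<in> Q \<times> sphere 0 1" using y e by simp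
  ultimately obtain l r where l: "l \<in> Q \<times> sphere 0 1" and r: "strict_mono (r :: nat \<Rightarrow> nat)"
    and lim: "((\<lambda>n. (y n, e n)) \<circ> r) \<longlonglongrightarrow> l"
    by (rule seq_compactE)
  obtain y' e' where l': "l = (y', e')" by (cases l)
  have ly: "(\<lambda>n. y (r n)) \<longlonglongrightarrow> y'" and le: "(\<lambda>n. e (r n)) \<longlonglongrightarrow> e'"
    using tendsto_fst[OF lim] tendsto_snd[OF lim] by (simp_all add: l' o_def)
  have y': "y' \<in> Q" and e': "e' \<noteq> 0" using l l' by auto
  have "continuous_on Q (\<lambda>y. H y 0)"
  proof -
    have "continuous_on Q (\<lambda>y. (y, 0 :: 'e))" by (intro continuous_intros)
    from continuous_on_compose2[OF cont this] show ?thesis by auto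
  qed
  then have "bounded ((\<lambda>y. H y 0) ` Q)" using Q by (intro compact_imp_bounded compact_continuous_image)
  then obtain M where M: "\<And>y. y \<in> Q \<Longrightarrow> \<bar>H y 0\<bar> \<le> M" by (auto simp: bounded_iff)
  have "H y' (t *\<^sub>R e') \<le> max M a" if "t \<ge> 0" for t
  proof (rule LIMSEQ_le_const2)
    have "(\<lambda>n. (y (r n), t *\<^sub>R e (r n))) \<longlonglongrightarrow> (y', t *\<^sub>R e')" by (intro tendsto_intros ly le)
    from continuous_on_tendsto_compose[OF cont this]
    show "(\<lambda>n. H (y (r n)) (t *\<^sub>R e (r n))) \<longlonglongrightarrow> H y' (t *\<^sub>R e')" using y y' by simp
    have "H (y (r n)) (t *\<^sub>R e (r n)) \<le> max M a" if "n \<ge> nat \<lceil>t\<rceil>" for n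
    proof -
      have "t \<le> real n" using that by linarith
      also have "real n \<le> real (r n)" using seq_suble[OF r, of n] by simp
      finally have t: "t < norm (p (r n))" using p[of "r n"] by simp
      \<comment> \<open>\<open>t *\<^sub>R e (r n)\<close> sits at the fraction \<open>s\<close> of
        the segment from 0 to \<open>p (r n)\<close>.\<close>
      define s where "s = t / norm (p (r n))"
      have s: "0 \<le> s" "s \<le> 1" using \<open>t \<ge> 0\<close> t p0[of "r n"] by (auto simp: s_def field_simps)
      have "H (y (r n)) ((1 - s) *\<^sub>R 0 + s *\<^sub>R p (r n)) \<le> (1 - s) * H (y (r n)) 0 + s * H (y (r n)) (p (r n))"
        using cvx[OF y] s by (intro convex_onD) auto
      also have "\<dots> \<le> (1 - s) * max M a + s * max M a"
        using M[OF y[of "r n"]] Ha[of "r n"] s by (intro add_mono mult_left_mono) auto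
      also have "\<dots> = max M a" by (simp add: algebra_simps)
      finally show ?thesis by (simp add: s_def e_def divide_inverse)
    qed
    then show "\<exists>N. \<forall>n\<ge>N. H (y (r n)) (t *\<^sub>R e (r n)) \<le> max M a" by blast
  qed
  then show False using ray[OF y' e', of "max M a"] by force
qed

text \<open>A linear term does not destroy superlinear growth, so the set where
  \<open>h p \<le> p \<bullet> v\<close> is bounded; outside it the expression is negative. This
  makes the supremum in \<open>Lagrangian\<close> a genuine one.\<close>

lemma superlinear_conjugate_bdd_above:
  fixes h :: "'e::euclidean_space \<Rightarrow> real"
  assumes cont: "continuous_on UNIV h" and cvx: "convex_on UNIV h"
    and ray: "\<And>q C. q \<noteq> 0 \<Longrightarrow> \<exists>t\<ge>1. h (t *\<^sub>R q) > C * t"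
  shows "bdd_above (range (\<lambda>p. p \<bullet> v - h p))"
proof -
  \<comment> \<open>The real parameter is a dummy: the uniform lemma is applied over the one-point
    set \<open>{0}\<close>.\<close>
  define H where "H y p = h p - p \<bullet> v" for y :: real and p
  have contH: "continuous_on UNIV (H y)" for y
    unfolding H_def by (intro continuous_intros cont)
  obtain B where B: "\<And>y p. y \<in> {0} \<Longrightarrow> H y p \<le> 0 \<Longrightarrow> norm p \<le> B"
  proof (rule sublevel_bounded_uniformly[of "{0}" H 0])
    show "continuous_on ({0} \<times> UNIV) (\<lambda>(y, p). H y p)"
      unfolding H_def case_prod_beta
      by (intro continuous_intros continuous_on_compose2[OF cont]) auto
    show "convex_on UNIV (H y)" for y
    proof (rule convex_onI)
      fix t :: real and p q :: 'e assume "0 < t" "t < 1"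
      then have "h ((1 - t) *\<^sub>R p + t *\<^sub>R q) \<le> (1 - t) * h p + t * h q"
        by (intro convex_onD[OF cvx]) auto
      then show "H y ((1 - t) *\<^sub>R p + t *\<^sub>R q) \<le> (1 - t) * H y p + t * H y q"
        by (simp add: H_def algebra_simps)
    qed simp
    fix y q C assume "q \<noteq> (0::'e)"
    \<comment> \<open>The summand \<open>q \<bullet> v\<close> compensates the linear term
      subtracted in \<open>H\<close>.\<close>
    obtain t where t: "t \<ge> 1" "h (t *\<^sub>R q) > (\<bar>C\<bar> + q \<bullet> v) * t" using ray[OF \<open>q \<noteq> 0\<close>] by blast
    have "C \<le> \<bar>C\<bar> * t" using t(1) by (metis abs_ge_self abs_ge_zero mult_right_le_one_le mult.commute mult_left_mono mult_1 order.trans)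
    then have "H y (t *\<^sub>R q) > C" using t by (simp add: H_def algebra_simps)
    then show "\<exists>t\<ge>0. H y (t *\<^sub>R q) > C" using t(1) by (intro exI[of _ t]) auto
  qed auto
  have "bounded (H 0 ` cball 0 B)"
    by (intro compact_imp_bounded compact_continuous_image continuous_on_subset[OF contH]) auto
  then obtain M where M: "\<And>p. norm p \<le> B \<Longrightarrow> \<bar>H 0 p\<bar> \<le> M" by (force simp: bounded_iff)
  have "p \<bullet> v - h p \<le> max 0 M" for p
  proof (cases "h p \<le> p \<bullet> v")
    case True
    then have "\<bar>H 0 p\<bar> \<le> M" using B[of 0 p] by (intro M) (simp add: H_def)
    then show ?thesis by (simp add: H_def)
  qed auto
  then show ?thesis by (intro bdd_aboveI[of _ "max 0 M"]) auto
qed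

text \<open>The segment from \<open>q\<close> to \<open>e\<close>, lifted to height
  \<open>c\<close>, is disjoint from the strict epigraph of \<open>h\<close>. A separating
  hyperplane is the graph of an affine function, and its slope is \<open>v\<close>. Using the whole
  segment, and not only \<open>q\<close>, is what fixes the sign of \<open>v\<close> in the
  direction of \<open>e\<close>.\<close>

lemma subgradient_along_segment:
  fixes h :: "'e::euclidean_space \<Rightarrow> real"
  assumes cvx: "convex_on UNIV h" and q: "h q \<le> c"
    and seg: "\<And>t. 0 \<le> t \<Longrightarrow> t \<le> 1 \<Longrightarrow> c \<le> h ((1 - t) *\<^sub>R q + t *\<^sub>R e)"
  obtains v where "0 \<le> v \<bullet> (e - q)" "\<And>p. c + v \<bullet> (p - q) \<le> h p"
proof -
  let ?S = "(\<lambda>x. (x, c)) ` closed_segment q e" and ?T = "{(p, \<tau>). h p < \<tau>}"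
  have "convex ?S"
  proof -
    have "?S = closed_segment q e \<times> {c}" by auto
    then show ?thesis by (simp add: convex_Times)
  qed
  moreover have "convex ?T"
  proof (rule convexI)
    fix x y :: "'e \<times> real" and u v :: real
    assume xy: "x \<in> ?T" "y \<in> ?T" and uv: "0 \<le> u" "0 \<le> v" "u + v = 1"
    have "h (u *\<^sub>R fst x + v *\<^sub>R fst y) \<le> u * h (fst x) + v * h (fst y)"
      using cvx uv by (auto simp: convex_on_def)
    also have "\<dots> < u * snd x + v * snd y"
    proof (cases "u = 0")
      case False
      then show ?thesis using xy uv
        by (intro add_less_le_mono mult_strict_left_mono mult_left_mono) (auto simp: case_prod_beta)
    qed (use xy uv in auto)
    finally show "u *\<^sub>R x + v *\<^sub>R y \<in> ?T" by (simp add: case_prod_beta)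
  qed
  moreover have "?S \<noteq> {}" by simp
  moreover have "?T \<noteq> {}" using lt_ex gt_ex[of "h q"] by auto
  moreover have "?S \<inter> ?T = {}" using seg by (force simp: in_segment)
  ultimately obtain a b where ab: "a \<noteq> 0" "\<And>x. x \<in> ?S \<Longrightarrow> a \<bullet> x \<le> b" "\<And>x. x \<in> ?T \<Longrightarrow> b \<le> a \<bullet> x"
    using separating_hyperplane_sets[of ?S ?T] by blast
  obtain a1 a2 where a: "a = (a1, a2)" by (cases a)
  have sep: "a1 \<bullet> x + a2 * c \<le> a1 \<bullet> p + a2 * \<tau>" if "x \<in> closed_segment q e" "h p < \<tau>" for x p \<tau>
    using ab(2)[of "(x, c)"] ab(3)[of "(p, \<tau>)"] that by (force simp: a)
  have qs: "q \<in> closed_segment q e" "e \<in> closed_segment q e" by auto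
  have "a2 \<ge> 0"
    using sep[OF qs(1), of q "c + 1"] q by (simp add: algebra_simps)
  \<comment> \<open>The epigraph lies over the whole space, so a vertical hyperplane cannot
    separate: moving from \<open>q\<close> by \<open>- a1\<close> would force
    \<open>a1 = 0\<close>.\<close>
  moreover have "a2 \<noteq> 0"
  proof
    assume "a2 = 0"
    then have "a1 \<bullet> q \<le> a1 \<bullet> (q - a1)" using sep[OF qs(1), of "q - a1" "h (q - a1) + 1"] by simp
    then have "a1 \<bullet> a1 \<le> 0" by (simp add: inner_diff_right)
    then have "a1 = 0" by (metis inner_eq_zero_iff inner_ge_zero order.antisym)
    with \<open>a2 = 0\<close> ab(1) a show False by (simp add: zero_prod_def)
  qed
  ultimately have a2: "a2 > 0" by simp
  define v where "v = - a1 /\<^sub>R a2"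
  have av: "a1 \<bullet> x = - a2 * (v \<bullet> x)" for x using a2 by (simp add: v_def)
  \<comment> \<open>The end \<open>x = q\<close> yields the subgradient inequality; the end
    \<open>x = e\<close>, taken with \<open>p = q\<close>, yields the sign.\<close>
  have main: "c + v \<bullet> (p - x) \<le> h p" if x: "x \<in> closed_segment q e" for p x
  proof (rule field_le_epsilon)
    fix \<epsilon> :: real assume "\<epsilon> > 0"
    then have "a2 * (c + v \<bullet> (p - x)) \<le> a2 * (h p + \<epsilon>)"
      using sep[OF x, of p "h p + \<epsilon>"] by (simp add: av inner_diff_right algebra_simps)
    then show "c + v \<bullet> (p - x) \<le> h p + \<epsilon>" using a2 by simp
  qed
  show ?thesis
  proof
    show "c + v \<bullet> (p - q) \<le> h p" for p by (rule main[OF qs(1)])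
    show "0 \<le> v \<bullet> (e - q)" using main[OF qs(2), of q] q by (simp add: inner_diff_right)
  qed
qed

section \<open>Doubling of variables\<close>

lemma has_derivative_square_distance:
  fixes z :: "'e::real_inner"
  shows "((\<lambda>x. (x - z) \<bullet> (x - z)) has_derivative (\<lambda>h. 2 * ((x - z) \<bullet> h))) (at x)"
  by (auto intro!: derivative_eq_intros simp: inner_commute)

text \<open>Neither \<open>u1\<close> nor \<open>u2\<close> need be differentiable at
  \<open>z\<close>. Penalised maximum points \<open>(x, y)\<close> near \<open>(z, z)\<close> give a
  test function for \<open>u1\<close> at \<open>x\<close> and one for \<open>u2\<close> at
  \<open>y\<close>, with linked gradients; coercivity keeps the gradients for \<open>u1\<close>
  bounded, and a limit yields both inequalities at \<open>z\<close>.\<close>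

lemma doubling_of_variables:
  fixes u1 u2 \<phi> :: "'e::euclidean_space \<Rightarrow> real" and d\<phi> :: "'e \<Rightarrow> 'e"
    and H :: "'e \<Rightarrow> 'e \<Rightarrow> real"
  assumes \<Omega>: "open \<Omega>" "z \<in> \<Omega>" and s: "0 < s" "s < 1"
    and cont: "continuous_on \<Omega> u1" "continuous_on \<Omega> u2" "continuous_on \<Omega> \<phi>" "continuous_on \<Omega> d\<phi>"
      "continuous_on (\<Omega> \<times> UNIV) (\<lambda>(y, p). H y p)"
    and coercive: "\<And>Q. compact Q \<Longrightarrow> Q \<subseteq> \<Omega> \<Longrightarrow> \<exists>B. \<forall>y\<in>Q. \<forall>p. H y p \<le> c \<longrightarrow> norm p \<le> B"
    and max: "\<And>y. y \<in> \<Omega> \<Longrightarrow> (1 - s) * u1 y + s * \<phi> y - u2 y \<le> (1 - s) * u1 z + s * \<phi> z - u2 z"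
    and sub: "\<And>y a f g. y \<in> \<Omega> \<Longrightarrow> continuous_on UNIV g \<Longrightarrow>
        (\<And>x. (f has_derivative (\<lambda>h. g x \<bullet> h)) (at x)) \<Longrightarrow>
        (\<forall>\<^sub>F x in nhds y. u1 x - (a * \<phi> x + f x) \<le> u1 y - (a * \<phi> y + f y)) \<Longrightarrow>
        H y (a *\<^sub>R d\<phi> y + g y) \<le> c"
    and super: "\<And>y f g. y \<in> \<Omega> \<Longrightarrow> continuous_on UNIV g \<Longrightarrow>
        (\<And>x. (f has_derivative (\<lambda>h. g x \<bullet> h)) (at x)) \<Longrightarrow>
        (\<forall>\<^sub>F x in nhds y. u2 x - f x \<ge> u2 y - f y) \<Longrightarrow> c \<le> H y (g y)"
  obtains q where "H z q \<le> c" "c \<le> H z ((1 - s) *\<^sub>R q + s *\<^sub>R d\<phi> z)"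
proof -
  obtain r where r: "r > 0" "cball z r \<subseteq> \<Omega>" using \<Omega> open_contains_cball by blast
  let ?B = "cball z r"
  define W where "W x = (1 - s) * u1 x + s * \<phi> x" for x
  have contB: "continuous_on ?B u1" "continuous_on ?B u2" "continuous_on ?B \<phi>" "continuous_on ?B d\<phi>"
    using cont r(2) by (auto intro: continuous_on_subset)
  have contW: "continuous_on ?B W" unfolding W_def by (intro continuous_intros contB)
  \<comment> \<open>The square around \<open>z\<close> forces convergence to \<open>z\<close> even
    if there are other maximum points; the term with factor \<open>n\<close> forces \<open>x\<close>
    and \<open>y\<close> together.\<close>
  define \<Phi> where "\<Phi> n xy = W (fst xy) - (fst xy - z) \<bullet> (fst xy - z) - u2 (snd xy)
      - real n * ((fst xy - snd xy) \<bullet> (fst xy - snd xy))" for n xy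
  have "continuous_on (?B \<times> ?B) (\<Phi> n)" for n
    unfolding \<Phi>_def
    by (intro continuous_intros continuous_on_compose2[OF contW] continuous_on_compose2[OF contB(2)]) auto
  moreover have "compact (?B \<times> ?B)" "?B \<times> ?B \<noteq> {}" using r(1) by (auto intro!: compact_Times)
  ultimately have "\<exists>xy\<in>?B \<times> ?B. \<forall>xy'\<in>?B \<times> ?B. \<Phi> n xy' \<le> \<Phi> n xy" for n
    by (intro continuous_attains_sup) auto
  then obtain xy where xy: "\<And>n. xy n \<in> ?B \<times> ?B" "\<And>n xy'. xy' \<in> ?B \<times> ?B \<Longrightarrow> \<Phi> n xy' \<le> \<Phi> n (xy n)"
    by metis
  define x y where "x n = fst (xy n)" and "y n = snd (xy n)" for n
  have xB: "x n \<in> ?B" and yB: "y n \<in> ?B" for n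
    using xy(1)[of n] by (auto simp: x_def y_def mem_Times_iff)
  have xy_max: "W x' - (x' - z) \<bullet> (x' - z) - u2 y' - real n * ((x' - y') \<bullet> (x' - y'))
      \<le> W (x n) - (x n - z) \<bullet> (x n - z) - u2 (y n) - real n * ((x n - y n) \<bullet> (x n - y n))"
    if "x' \<in> ?B" "y' \<in> ?B" for x' y' n
    using xy(2)[of "(x', y')" n] that by (simp add: \<Phi>_def x_def y_def)
  have zB: "z \<in> ?B" using r(1) by simp
  have key: "(x n - z) \<bullet> (x n - z) + real n * ((x n - y n) \<bullet> (x n - y n))
      \<le> W (x n) - u2 (y n) - (W z - u2 z)" for n
    using xy_max[OF zB zB, of n] by simp
  have "bounded ((\<lambda>x. W x) ` ?B)" "bounded ((\<lambda>x. u2 x) ` ?B)"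
    using contW contB by (auto intro!: compact_imp_bounded compact_continuous_image)
  then obtain M1 M2 where M: "\<And>x. x \<in> ?B \<Longrightarrow> \<bar>W x\<bar> \<le> M1" "\<And>x. x \<in> ?B \<Longrightarrow> \<bar>u2 x\<bar> \<le> M2"
    unfolding bounded_iff by (metis image_eqI real_norm_def)
  have "seq_compact (?B \<times> ?B)" by (intro compact_imp_seq_compact compact_Times) auto
  moreover have "\<forall>n. xy n \<in> ?B \<times> ?B" using xy(1) by blast
  ultimately obtain l k where l: "l \<in> ?B \<times> ?B" and k: "strict_mono (k :: nat \<Rightarrow> nat)"
    and lim: "(xy \<circ> k) \<longlonglongrightarrow> l" by (rule seq_compactE)
  obtain x' y' where l': "l = (x', y')" by (cases l)
  have x'B: "x' \<in> ?B" and y'B: "y' \<in> ?B" using l l' by auto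
  have lx: "(\<lambda>n. x (k n)) \<longlonglongrightarrow> x'" and ly: "(\<lambda>n. y (k n)) \<longlonglongrightarrow> y'"
    using tendsto_fst[OF lim] tendsto_snd[OF lim] by (simp_all add: l' o_def x_def y_def)
  have eq: "x' = y'"
  proof -
    have "(\<lambda>n. (x (k n) - y (k n)) \<bullet> (x (k n) - y (k n))) \<longlonglongrightarrow> 0"
    proof (rule Lim_null_comparison)
      have "(x n - y n) \<bullet> (x n - y n) \<le> (2 * M1 + 2 * M2) * inverse (real n)" if "n > 0" for n
      proof -
        have "real n * ((x n - y n) \<bullet> (x n - y n)) \<le> 2 * M1 + 2 * M2"
          using key[of n] M(1)[OF xB[of n]] M(2)[OF yB[of n]] M(1)[OF zB] M(2)[OF zB]
            inner_ge_zero[of "x n - z"] by linarith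
        then show ?thesis using that by (simp add: field_simps)
      qed
      moreover have "k n > 0" if "n > 0" for n using seq_suble[OF k, of n] that by simp
      ultimately show "\<forall>\<^sub>F n in sequentially. norm ((x (k n) - y (k n)) \<bullet> (x (k n) - y (k n)))
          \<le> (2 * M1 + 2 * M2) * inverse (real (k n))"
        by (intro eventually_mono[OF eventually_gt_at_top[of 0]]) simp
      have "filterlim (\<lambda>n. real (k n)) at_top sequentially"
        by (intro filterlim_compose[OF filterlim_real_sequentially filterlim_subseq[OF k]])
      then have "(\<lambda>n. inverse (real (k n))) \<longlonglongrightarrow> 0" by (rule tendsto_inverse_0_at_top)
      then show "(\<lambda>n. (2 * M1 + 2 * M2) * inverse (real (k n))) \<longlonglongrightarrow> 0"
        by (rule tendsto_mult_right_zero)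
    qed
    moreover have "(\<lambda>n. (x (k n) - y (k n)) \<bullet> (x (k n) - y (k n))) \<longlonglongrightarrow> (x' - y') \<bullet> (x' - y')"
      by (intro tendsto_intros lx ly)
    ultimately have "(x' - y') \<bullet> (x' - y') = 0" using LIMSEQ_unique by blast
    then show ?thesis by simp
  qed
  have x'z: "x' = z"
  proof -
    have "(x' - z) \<bullet> (x' - z) \<le> W x' - u2 y' - (W z - u2 z)"
    proof (rule LIMSEQ_le)
      show "(\<lambda>n. (x (k n) - z) \<bullet> (x (k n) - z)) \<longlonglongrightarrow> (x' - z) \<bullet> (x' - z)"
        by (intro tendsto_intros lx)
      show "(\<lambda>n. W (x (k n)) - u2 (y (k n)) - (W z - u2 z)) \<longlonglongrightarrow> W x' - u2 y' - (W z - u2 z)"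
        using xB yB by (intro tendsto_intros continuous_on_tendsto_compose[OF contW lx x'B]
            continuous_on_tendsto_compose[OF contB(2) ly y'B]) auto
      have "(x n - z) \<bullet> (x n - z) \<le> W (x n) - u2 (y n) - (W z - u2 z)" for n
        using key[of n] mult_nonneg_nonneg[OF of_nat_0_le_iff[of n] inner_ge_zero[of "x n - y n"]] by linarith
      then show "\<exists>N. \<forall>n\<ge>N. (x (k n) - z) \<bullet> (x (k n) - z) \<le> W (x (k n)) - u2 (y (k n)) - (W z - u2 z)"
        by blast
    qed
    also have "\<dots> \<le> 0" using max[of x'] x'B r(2) by (auto simp: eq W_def)
    finally have "(x' - z) \<bullet> (x' - z) \<le> 0" .
    then have "(x' - z) \<bullet> (x' - z) = 0" by (intro order.antisym inner_ge_zero)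
    then show ?thesis by simp
  qed
  have "\<forall>\<^sub>F n in sequentially. x (k n) \<in> ball z r \<and> y (k n) \<in> ball z r"
    using topological_tendstoD[OF lx, of "ball z r"] topological_tendstoD[OF ly, of "ball z r"] r(1)
    by (auto simp: x'z eq[symmetric] intro: eventually_conj)
  then obtain N where N: "\<And>n. n \<ge> N \<Longrightarrow> x (k n) \<in> ball z r \<and> y (k n) \<in> ball z r"
    by (auto simp: eventually_sequentially)
  \<comment> \<open>From index \<open>N\<close> on both points are interior to \<open>?B\<close>, so
    the maximum over \<open>?B\<close> is a local one, as \<open>sub\<close> and
    \<open>super\<close> require.\<close>
  define m X Y where "m n = k (n + N)" and "X n = x (k (n + N))" and "Y n = y (k (n + N))" for n
  have Xr: "X n \<in> ball z r" and Yr: "Y n \<in> ball z r" for n using N[of "n + N"] by (auto simp: X_def Y_def)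
  have lX: "X \<longlonglongrightarrow> z" and lY: "Y \<longlonglongrightarrow> z"
    using LIMSEQ_ignore_initial_segment[OF lx, of N] LIMSEQ_ignore_initial_segment[OF ly, of N]
    by (simp_all add: X_def[abs_def] Y_def[abs_def] x'z eq[symmetric])
  have XY_max: "W x' - (x' - z) \<bullet> (x' - z) - u2 y' - real (m n) * ((x' - y') \<bullet> (x' - y'))
      \<le> W (X n) - (X n - z) \<bullet> (X n - z) - u2 (Y n) - real (m n) * ((X n - Y n) \<bullet> (X n - Y n))"
    if "x' \<in> ?B" "y' \<in> ?B" for x' y' n
    using xy_max[OF that] by (simp add: X_def Y_def m_def)
  define p where "p n = (2 * real (m n)) *\<^sub>R (X n - Y n)" for n
  \<comment> \<open>Solving for \<open>u1\<close> divides by \<open>1 - s\<close> and moves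
    \<open>\<phi>\<close> into the test function with coefficient \<open>- s / (1 - s)\<close>;
    \<open>q n\<close> is the gradient of that test function at \<open>X n\<close>.\<close>
  define q where "q n = (- s / (1 - s)) *\<^sub>R d\<phi> (X n) + (1 / (1 - s)) *\<^sub>R (2 *\<^sub>R (X n - z) + p n)" for n
  have Hq: "H (X n) (q n) \<le> c" for n
    unfolding q_def p_def
  proof (rule sub[where g = "\<lambda>x. (1 / (1 - s)) *\<^sub>R (2 *\<^sub>R (x - z) + (2 * real (m n)) *\<^sub>R (x - Y n))"
      and f = "\<lambda>x. (1 / (1 - s)) * ((x - z) \<bullet> (x - z) + real (m n) * ((x - Y n) \<bullet> (x - Y n)))"])
    show "X n \<in> \<Omega>" using Xr[of n] r(2) by auto
    show "continuous_on UNIV (\<lambda>x. (1 / (1 - s)) *\<^sub>R (2 *\<^sub>R (x - z) + (2 * real (m n)) *\<^sub>R (x - Y n)))"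
      by (intro continuous_intros)
    show "((\<lambda>x. (1 / (1 - s)) * ((x - z) \<bullet> (x - z) + real (m n) * ((x - Y n) \<bullet> (x - Y n)))) has_derivative
        (\<lambda>h. ((1 / (1 - s)) *\<^sub>R (2 *\<^sub>R (x - z) + (2 * real (m n)) *\<^sub>R (x - Y n))) \<bullet> h)) (at x)" for x
      by (rule has_derivative_eq_rhs[OF has_derivative_mult_right[OF has_derivative_add[OF
              has_derivative_square_distance has_derivative_mult_right[OF has_derivative_square_distance]]]])
        (simp add: inner_add_left fun_eq_iff mult.assoc)
    have "\<forall>\<^sub>F x in nhds (X n). x \<in> ball z r" using Xr by (intro eventually_nhds_in_open) auto
    then show "\<forall>\<^sub>F x in nhds (X n).
        u1 x - (- s / (1 - s) * \<phi> x + (1 / (1 - s)) * ((x - z) \<bullet> (x - z) + real (m n) * ((x - Y n) \<bullet> (x - Y n))))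
        \<le> u1 (X n) - (- s / (1 - s) * \<phi> (X n) +
          (1 / (1 - s)) * ((X n - z) \<bullet> (X n - z) + real (m n) * ((X n - Y n) \<bullet> (X n - Y n))))"
    proof eventually_elim
      case (elim x)
      have e: "u1 x - (- s / (1 - s) * \<phi> x + (1 / (1 - s)) * ((x - z) \<bullet> (x - z) + real (m n) * ((x - Y n) \<bullet> (x - Y n))))
          = (1 / (1 - s)) * (W x - (x - z) \<bullet> (x - z) - real (m n) * ((x - Y n) \<bullet> (x - Y n)))" for x
        using s unfolding W_def by (simp add: diff_divide_distrib add_divide_distrib)
      show ?case
        unfolding e using XY_max[of x "Y n" n] elim Yr[of n] s by (intro mult_left_mono) auto
    qed
  qed
  have Hp: "c \<le> H (Y n) (p n)" for n
    unfolding p_def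
  proof (rule super[where g = "\<lambda>y. (2 * real (m n)) *\<^sub>R (X n - y)"
        and f = "\<lambda>y. - real (m n) * ((X n - y) \<bullet> (X n - y))"])
    show "Y n \<in> \<Omega>" using Yr[of n] r(2) by auto
    show "continuous_on UNIV (\<lambda>y. (2 * real (m n)) *\<^sub>R (X n - y))" by (intro continuous_intros)
    show "((\<lambda>y. - real (m n) * ((X n - y) \<bullet> (X n - y))) has_derivative
        (\<lambda>h. ((2 * real (m n)) *\<^sub>R (X n - x)) \<bullet> h)) (at x)" for x
      by (auto intro!: derivative_eq_intros simp: fun_eq_iff inner_commute)
    have "\<forall>\<^sub>F y in nhds (Y n). y \<in> ball z r" using Yr by (intro eventually_nhds_in_open) auto
    then show "\<forall>\<^sub>F y in nhds (Y n). u2 (Y n) - - real (m n) * ((X n - Y n) \<bullet> (X n - Y n))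
        \<le> u2 y - - real (m n) * ((X n - y) \<bullet> (X n - y))"
    proof eventually_elim
      case (elim y)
      then show ?case using XY_max[of "X n" y n] Xr[of n] by simp
    qed
  qed
  obtain Bq where Bq: "\<And>y p. y \<in> ?B \<Longrightarrow> H y p \<le> c \<Longrightarrow> norm p \<le> Bq"
    using coercive[OF compact_cball r(2)] by blast
  have "\<forall>n. q n \<in> cball 0 Bq" using Bq[OF _ Hq] Xr by (auto simp: less_imp_le)
  with compact_imp_seq_compact[OF compact_cball] obtain q' j where j: "strict_mono (j :: nat \<Rightarrow> nat)"
    and lq: "(q \<circ> j) \<longlonglongrightarrow> q'" by (rule seq_compactE)
  have lXj: "(\<lambda>n. X (j n)) \<longlonglongrightarrow> z" and lYj: "(\<lambda>n. Y (j n)) \<longlonglongrightarrow> z" and lqj: "(\<lambda>n. q (j n)) \<longlonglongrightarrow> q'"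
    using LIMSEQ_subseq_LIMSEQ[OF lX j] LIMSEQ_subseq_LIMSEQ[OF lY j] lq by (simp_all add: o_def)
  \<comment> \<open>The penalty gradient \<open>p n\<close> carries the factor \<open>m n\<close>
    and has no bound of its own; here it is tied to the bounded \<open>q n\<close>.\<close>
  have pq: "p n = (1 - s) *\<^sub>R q n + s *\<^sub>R d\<phi> (X n) - 2 *\<^sub>R (X n - z)" for n
  proof -
    have "(1 - s) * (- s / (1 - s)) = - s" "(1 - s) * (1 / (1 - s)) = 1" using s by auto
    then have "(1 - s) *\<^sub>R q n = (- s) *\<^sub>R d\<phi> (X n) + (2 *\<^sub>R (X n - z) + p n)"
      unfolding q_def scaleR_add_right[of "1 - s"] scaleR_scaleR by (simp only: scaleR_one)
    then show ?thesis by simp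
  qed
  have "(\<lambda>n. p (j n)) \<longlonglongrightarrow> (1 - s) *\<^sub>R q' + s *\<^sub>R d\<phi> z - 2 *\<^sub>R (z - z)"
    unfolding pq using Xr
    by (intro tendsto_intros lqj lXj continuous_on_tendsto_compose[OF contB(4) lXj zB])
      (auto simp: less_imp_le)
  then have lpj: "(\<lambda>n. p (j n)) \<longlonglongrightarrow> (1 - s) *\<^sub>R q' + s *\<^sub>R d\<phi> z" by simp
  have XY\<Omega>: "X n \<in> \<Omega>" "Y n \<in> \<Omega>" for n using Xr[of n] Yr[of n] r(2) by auto
  show ?thesis
  proof
    have "(\<lambda>n. H (X (j n)) (q (j n))) \<longlonglongrightarrow> H z q'"
      using continuous_on_tendsto_compose[OF cont(5) tendsto_Pair[OF lXj lqj]] XY\<Omega> \<Omega> by simp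
    then show "H z q' \<le> c" by (rule LIMSEQ_le_const2) (use Hq in blast)
    have "(\<lambda>n. H (Y (j n)) (p (j n))) \<longlonglongrightarrow> H z ((1 - s) *\<^sub>R q' + s *\<^sub>R d\<phi> z)"
      using continuous_on_tendsto_compose[OF cont(5) tendsto_Pair[OF lYj lpj]] XY\<Omega> \<Omega> by simp
    then show "c \<le> H z ((1 - s) *\<^sub>R q' + s *\<^sub>R d\<phi> z)" by (rule LIMSEQ_le_const) (use Hp in blast)
  qed
qed

section \<open>Charts, covectors and test functions\<close>

text \<open>\<open>Ck_on\<close> treats the directions one at a time; the derivatives along
  \<open>Basis\<close> assemble into one continuous gradient, the form used for all estimates in
  charts.\<close>

lemma Ck_on_1_iff:
  fixes f :: "'a::euclidean_space \<Rightarrow> real"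
  shows "Ck_on 1 S f \<longleftrightarrow>
    (\<exists>g. continuous_on S g \<and> (\<forall>x\<in>S. (f has_derivative (\<lambda>h. g x \<bullet> h)) (at x)))"
proof
  assume f: "Ck_on 1 S f"
  define g where "g x = (\<Sum>b\<in>Basis. frechet_derivative f (at x) b *\<^sub>R b)" for x
  have "continuous_on S g" unfolding g_def using f by (auto intro!: continuous_intros)
  moreover have "(f has_derivative (\<lambda>h. g x \<bullet> h)) (at x)" if "x \<in> S" for x
  proof -
    have D: "(f has_derivative frechet_derivative f (at x)) (at x)"
      using f that by (simp add: frechet_derivative_works)
    then interpret bounded_linear "frechet_derivative f (at x)" by (rule has_derivative_bounded_linear)
    have "frechet_derivative f (at x) = (\<lambda>h. g x \<bullet> h)"
    proof
      fix h
      have "frechet_derivative f (at x) h = frechet_derivative f (at x) (\<Sum>b\<in>Basis. (h \<bullet> b) *\<^sub>R b)"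
        by (simp add: euclidean_representation)
      also have "\<dots> = g x \<bullet> h"
        unfolding g_def inner_sum_left by (simp add: sum scaleR inner_commute mult.commute)
      finally show "frechet_derivative f (at x) h = g x \<bullet> h" .
    qed
    then show ?thesis using D by simp
  qed
  ultimately show "\<exists>g. continuous_on S g \<and> (\<forall>x\<in>S. (f has_derivative (\<lambda>h. g x \<bullet> h)) (at x))" by blast
next
  assume "\<exists>g. continuous_on S g \<and> (\<forall>x\<in>S. (f has_derivative (\<lambda>h. g x \<bullet> h)) (at x))"
  then obtain g where g: "continuous_on S g" "\<And>x. x \<in> S \<Longrightarrow> (f has_derivative (\<lambda>h. g x \<bullet> h)) (at x)"
    by blast
  have eq: "frechet_derivative f (at x) h = g x \<bullet> h" if "x \<in> S" for x h
    using frechet_derivative_at[OF g(2)[OF that]] by metis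
  have "continuous_on S (\<lambda>x. g x \<bullet> h)" for h by (intro continuous_intros g(1))
  then have "continuous_on S (\<lambda>x. frechet_derivative f (at x) h)" for h
    by (rule continuous_on_eq) (simp add: eq)
  then show "Ck_on 1 S f" using g(2) by (auto simp: differentiable_def)
qed

lemma Ck_on_1_cong:
  fixes f g :: "'a::euclidean_space \<Rightarrow> real"
  assumes "Ck_on 1 U g" "open U" "\<And>x. x \<in> U \<Longrightarrow> f x = g x"
  shows "Ck_on 1 U f"
proof -
  obtain D where D: "continuous_on U D" "\<And>x. x \<in> U \<Longrightarrow> (g has_derivative (\<lambda>h. D x \<bullet> h)) (at x)"
    using assms(1) unfolding Ck_on_1_iff by blast
  have "(f has_derivative (\<lambda>h. D x \<bullet> h)) (at x)" if "x \<in> U" for x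
    by (rule has_derivative_transform_within_open[OF D(2)[OF that] assms(2) that]) (simp add: assms(3))
  then show ?thesis using D(1) unfolding Ck_on_1_iff by blast
qed

lemma Ck_on_1_local:
  fixes f :: "'a::euclidean_space \<Rightarrow> real"
  assumes "\<And>x. x \<in> S \<Longrightarrow> \<exists>U. open U \<and> x \<in> U \<and> Ck_on 1 U f"
  shows "Ck_on 1 S f"
proof -
  have "f differentiable (at x)" if "x \<in> S" for x using assms[OF that] by auto
  moreover have "continuous_on S (\<lambda>x. frechet_derivative f (at x) h)" for h
  proof (rule continuous_at_imp_continuous_on, rule ballI)
    fix x assume "x \<in> S"
    then obtain U where "open U" "x \<in> U" "Ck_on 1 U f" using assms by blast
    then show "isCont (\<lambda>x. frechet_derivative f (at x) h) x"
      by (simp add: continuous_on_eq_continuous_at)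
  qed
  ultimately show ?thesis by simp
qed

text \<open>Squaring the positive part removes its corner. Test functions have to be C^1 only, so
  cutoffs can be composed from this function.\<close>

lemma has_derivative_max_0_squared:
  "((\<lambda>t::real. (max 0 t)\<^sup>2) has_real_derivative 2 * max 0 t) (at t)"
proof (cases t "0 :: real" rule: linorder_cases)
  case less
  have "((\<lambda>t::real. 0) has_real_derivative 2 * max 0 t) (at t)"
    using less by (simp add: max_def)
  then show ?thesis
    by (rule has_field_derivative_transform_within_open[of _ _ _ "{..<0}"]) (use less in \<open>auto simp: max_def\<close>)
next
  case equal
  have "(\<lambda>h::real. (max 0 h)\<^sup>2 / h) \<midarrow>0\<rightarrow> 0"
  proof (rule Lim_null_comparison)
    show "\<forall>\<^sub>F h in at 0. norm ((max 0 h)\<^sup>2 / h) \<le> \<bar>h::real\<bar>"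
      by (intro always_eventually allI) (auto simp: max_def power2_eq_square)
    show "(\<lambda>h. \<bar>h::real\<bar>) \<midarrow>0\<rightarrow> 0" by (intro tendsto_rabs_zero tendsto_ident_at)
  qed
  then show ?thesis using equal by (simp add: DERIV_def)
next
  case greater
  have "((\<lambda>t::real. t\<^sup>2) has_real_derivative 2 * max 0 t) (at t)"
    using greater by (auto intro!: derivative_eq_intros simp: max_def)
  then show ?thesis
    by (rule has_field_derivative_transform_within_open[of _ _ _ "{0<..}"]) (use greater in \<open>auto simp: max_def\<close>)
qed

lemma C1_bump:
  fixes z :: "'e::euclidean_space"
  assumes r: "r > 0"
  obtains \<eta> :: "'e \<Rightarrow> real" and g where "continuous_on UNIV g"
    "\<And>x. (\<eta> has_derivative (\<lambda>h. g x \<bullet> h)) (at x)"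
    "\<And>x. x \<in> ball z (r/2) \<Longrightarrow> \<eta> x = 1" "\<And>x. x \<notin> cball z (3*r/4) \<Longrightarrow> \<eta> x = 0"
proof -
  define k :: "real \<Rightarrow> real" where "k t = (max 0 t)\<^sup>2" for t
  \<comment> \<open>\<open>\<tau>\<close> is at most 0 up to radius \<open>r/2\<close> and at least
    4 times 9/16 minus 1, that is 5/4, beyond \<open>3*r/4\<close>. Hence
    \<open>k (1 - k (\<tau> x))\<close> is 1 inside and 0 outside.\<close>
  define \<tau> where "\<tau> x = 4 / r\<^sup>2 * ((x - z) \<bullet> (x - z)) - 1" for x
  define g where "g x = (- 32 / r\<^sup>2 * max 0 (1 - k (\<tau> x)) * max 0 (\<tau> x)) *\<^sub>R (x - z)" for x
  have dk: "(k has_derivative (\<lambda>h. 2 * max 0 t * h)) (at t)" for t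
    using has_derivative_max_0_squared[of t] by (simp add: has_field_derivative_def k_def[abs_def] mult_commute_abs)
  show ?thesis
  proof
    have \<tau>: "continuous_on UNIV \<tau>" unfolding \<tau>_def by (intro continuous_intros)
    have "continuous_on UNIV k" unfolding k_def by (intro continuous_intros)
    from continuous_on_compose2[OF this \<tau>] have "continuous_on UNIV (\<lambda>x. k (\<tau> x))" by simp
    then show "continuous_on UNIV g" unfolding g_def by (intro continuous_intros \<tau>)
    have d\<tau>: "(\<tau> has_derivative (\<lambda>h. 8 / r\<^sup>2 * ((x - z) \<bullet> h))) (at x)" for x
      unfolding \<tau>_def[abs_def]
      by (rule has_derivative_eq_rhs[OF has_derivative_diff[OF has_derivative_mult_right[OF
              has_derivative_square_distance] has_derivative_const]]) simp
    have "((\<lambda>x. k (1 - k (\<tau> x))) has_derivative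
        (\<lambda>h. 2 * max 0 (1 - k (\<tau> x)) * (0 - 2 * max 0 (\<tau> x) * (8 / r\<^sup>2 * ((x - z) \<bullet> h))))) (at x)" for x
      by (rule has_derivative_compose[OF has_derivative_diff[OF has_derivative_const
            has_derivative_compose[OF d\<tau> dk]] dk])
    then show "((\<lambda>x. k (1 - k (\<tau> x))) has_derivative (\<lambda>h. g x \<bullet> h)) (at x)" for x
      by (rule has_derivative_eq_rhs) (auto simp: g_def fun_eq_iff)
    show "k (1 - k (\<tau> x)) = 1" if "x \<in> ball z (r/2)" for x
    proof -
      have "(norm (x - z))\<^sup>2 \<le> (r/2)\<^sup>2"
        using that by (intro power_mono) (auto simp: dist_norm norm_minus_commute)
      then have "\<tau> x \<le> 0" using r by (simp add: \<tau>_def dot_square_norm power_divide field_simps)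
      then show ?thesis by (simp add: k_def)
    qed
    show "k (1 - k (\<tau> x)) = 0" if "x \<notin> cball z (3*r/4)" for x
    proof -
      have "(3*r/4)\<^sup>2 \<le> (norm (x - z))\<^sup>2"
        using that r by (intro power_mono) (auto simp: dist_norm norm_minus_commute)
      then have "\<tau> x \<ge> 5/4" using r by (simp add: \<tau>_def dot_square_norm power_divide field_simps)
      then have "1 \<le> (max 0 (\<tau> x))\<^sup>2" by (intro one_le_power) auto
      then show ?thesis by (simp add: k_def)
    qed
  qed
qed

text \<open>The inverse of \<open>covec_coords\<close>. The value 0 off the tangent space is the
  normal form demanded by \<open>cotangent_space\<close>.\<close>

definition covec_of ::
  "('m::t2_space, 'e::euclidean_space) chart set \<Rightarrow> ('m, 'e) chart \<Rightarrow> 'm \<Rightarrow> 'e \<Rightarrow> ('m, 'e) covec" where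
  "covec_of A c x p = (\<lambda>v. if v \<in> tangent_space A x then p \<bullet> v c else 0)"

definition overlap :: "('m, 'e) chart \<Rightarrow> ('m, 'e) chart \<Rightarrow> 'e set" where
  "overlap c d = chart_map c ` (chart_dom c \<inter> chart_dom d)"

section \<open>Tangent vectors, covectors and differentials in charts\<close>

locale atlas =
  fixes A :: "('m::t2_space, 'e::euclidean_space) chart set"
  assumes atlas: "smooth_atlas A"
begin

lemma chart_cover: obtains c where "c \<in> A" "x \<in> chart_dom c"
  using atlas unfolding smooth_atlas_def by blast

lemma open_chart_dom: "c \<in> A \<Longrightarrow> open (chart_dom c)"
  and open_chart_img: "c \<in> A \<Longrightarrow> open (chart_img c)"
  and chart_homeo: "c \<in> A \<Longrightarrow> homeomorphism (chart_dom c) (chart_img c) (chart_map c) (chart_inv c)"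
  using atlas by (auto simp: smooth_atlas_def)

lemma chart_inv_map [simp]: "c \<in> A \<Longrightarrow> x \<in> chart_dom c \<Longrightarrow> chart_inv c (chart_map c x) = x"
  and chart_map_inv [simp]: "c \<in> A \<Longrightarrow> y \<in> chart_img c \<Longrightarrow> chart_map c (chart_inv c y) = y"
  and chart_map_img [simp]: "c \<in> A \<Longrightarrow> x \<in> chart_dom c \<Longrightarrow> chart_map c x \<in> chart_img c"
  and chart_inv_dom [simp]: "c \<in> A \<Longrightarrow> y \<in> chart_img c \<Longrightarrow> chart_inv c y \<in> chart_dom c"
  using chart_homeo[of c] by (auto simp: homeomorphism_def chart_img_def)

lemma continuous_on_chart_map: "c \<in> A \<Longrightarrow> continuous_on (chart_dom c) (chart_map c)"
  and continuous_on_chart_inv: "c \<in> A \<Longrightarrow> continuous_on (chart_img c) (chart_inv c)"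
  using chart_homeo[of c] by (auto simp: homeomorphism_def)

lemma mem_overlap_iff:
  "c \<in> A \<Longrightarrow> y \<in> overlap c d \<longleftrightarrow> y \<in> chart_img c \<and> chart_inv c y \<in> chart_dom d"
  by (force simp: overlap_def chart_img_def)

lemma open_chart_vimage:
  assumes "c \<in> A" "open U"
  shows "open {y \<in> chart_img c. chart_inv c y \<in> U}"
  using continuous_open_preimage[OF continuous_on_chart_inv open_chart_img assms(2), OF assms(1) assms(1)]
  by (simp add: vimage_def Int_def)

lemma open_overlap: "c \<in> A \<Longrightarrow> d \<in> A \<Longrightarrow> open (overlap c d)"
  using open_chart_vimage[of c "chart_dom d"] open_chart_dom[of d]
  by (simp add: mem_overlap_iff[symmetric] cong: conj_cong)

lemma transition_smooth: "c \<in> A \<Longrightarrow> d \<in> A \<Longrightarrow> smooth_on (overlap c d) (transition c d)"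
  using atlas by (auto simp: smooth_atlas_def overlap_def)

lemma transition_has_derivative:
  assumes "c \<in> A" "d \<in> A" "y \<in> overlap c d"
  shows "(transition c d has_derivative frechet_derivative (transition c d) (at y)) (at y)"
proof -
  have "Ck_on (Suc 0) (overlap c d) (transition c d)"
    using transition_smooth[OF assms(1,2)] unfolding smooth_on_def by blast
  then show ?thesis using assms by (simp add: frechet_derivative_works)
qed

lemma continuous_on_transition_derivative:
  assumes "c \<in> A" "d \<in> A"
  shows "continuous_on (overlap c d) (\<lambda>y. frechet_derivative (transition c d) (at y) h)"
proof -
  have "Ck_on (Suc 0) (overlap c d) (transition c d)"
    using transition_smooth[OF assms(1,2)] unfolding smooth_on_def by blast
  then show ?thesis by simp
qed

lemma continuous_on_transition: "c \<in> A \<Longrightarrow> d \<in> A \<Longrightarrow> continuous_on (overlap c d) (transition c d)"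
  using transition_smooth[of c d] unfolding smooth_on_def by (metis Ck_on.simps(1))

lemma transition_in_overlap: "c \<in> A \<Longrightarrow> d \<in> A \<Longrightarrow> y \<in> overlap c d \<Longrightarrow> transition c d y \<in> overlap d c"
  by (auto simp: overlap_def transition_def)

abbreviation dtr :: "('m, 'e) chart \<Rightarrow> ('m, 'e) chart \<Rightarrow> 'm \<Rightarrow> 'e \<Rightarrow> 'e" where
  "dtr c d x \<equiv> frechet_derivative (transition c d) (at (chart_map c x))"

lemma dtr:
  assumes "c \<in> A" "d \<in> A" "x \<in> chart_dom c" "x \<in> chart_dom d"
  shows "(transition c d has_derivative dtr c d x) (at (chart_map c x))"
  using assms by (intro transition_has_derivative) (auto simp: overlap_def)

lemma dtr_linear:
  assumes "c \<in> A" "d \<in> A" "x \<in> chart_dom c" "x \<in> chart_dom d"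
  shows "dtr c d x (a *\<^sub>R v + b *\<^sub>R w) = a *\<^sub>R dtr c d x v + b *\<^sub>R dtr c d x w"
proof -
  interpret bounded_linear "dtr c d x" using dtr[OF assms] by (rule has_derivative_bounded_linear)
  show ?thesis by (simp add: add scaleR)
qed

lemma dtr_refl:
  assumes "c \<in> A" "x \<in> chart_dom c"
  shows "dtr c c x h = h"
proof -
  have "((\<lambda>y. y) has_derivative (\<lambda>h. h)) (at (chart_map c x))" by (rule has_derivative_ident)
  then have "(transition c c has_derivative (\<lambda>h. h)) (at (chart_map c x))"
    by (rule has_derivative_transform_within_open[OF _ open_chart_img[OF assms(1)]])
      (use assms in \<open>auto simp: transition_def\<close>)
  from frechet_derivative_at[OF this] show ?thesis by metis
qed

lemma dtr_dtr:
  assumes "c \<in> A" "d \<in> A" "e \<in> A" "x \<in> chart_dom c" "x \<in> chart_dom d" "x \<in> chart_dom e"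
  shows "dtr d e x (dtr c d x h) = dtr c e x h"
proof -
  have x: "transition c d (chart_map c x) = chart_map d x" using assms by (simp add: transition_def)
  have "((\<lambda>y. transition d e (transition c d y)) has_derivative (\<lambda>h. dtr d e x (dtr c d x h))) (at (chart_map c x))"
    using dtr[of d e x] assms x by (intro has_derivative_compose[OF dtr[of c d x]]) auto
  then have "(transition c e has_derivative (\<lambda>h. dtr d e x (dtr c d x h))) (at (chart_map c x))"
    by (rule has_derivative_transform_within_open[OF _ open_overlap[OF assms(1,2)]])
      (use assms in \<open>auto simp: transition_def overlap_def\<close>)
  from frechet_derivative_at[OF this] show ?thesis by metis
qed

lemma tangent_space_component:
  assumes "v \<in> tangent_space A x" "c \<in> A" "d \<in> A" "x \<in> chart_dom c" "x \<in> chart_dom d"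
  shows "dtr c d x (v c) = v d"
proof (rule sym)
  note v = assms(1)[unfolded tangent_space_def mem_Collect_eq, THEN conjunct2]
  show "v d = dtr c d x (v c)" by (rule v[rule_format]) (use assms in auto)
qed

lemma tangent_space_eq_0:
  assumes "v \<in> tangent_space A x" "c \<notin> A \<or> x \<notin> chart_dom c"
  shows "v c = 0"
  by (rule assms(1)[unfolded tangent_space_def mem_Collect_eq, THEN conjunct1, rule_format]) fact

lemma tangent_spaceI:
  assumes "\<And>c. c \<notin> A \<or> x \<notin> chart_dom c \<Longrightarrow> v c = 0"
    and "\<And>c d. c \<in> A \<Longrightarrow> d \<in> A \<Longrightarrow> x \<in> chart_dom c \<Longrightarrow> x \<in> chart_dom d \<Longrightarrow> v d = dtr c d x (v c)"
  shows "v \<in> tangent_space A x"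
  unfolding tangent_space_def
  by (intro CollectI conjI allI impI ballI) (use assms(1) in simp, rule assms(2), auto)

lemma tangent_space_combination:
  assumes "v \<in> tangent_space A x" "w \<in> tangent_space A x"
  shows "(\<lambda>c. a *\<^sub>R v c + b *\<^sub>R w c) \<in> tangent_space A x"
  by (rule tangent_spaceI)
    (simp_all add: tangent_space_eq_0[OF assms(1)] tangent_space_eq_0[OF assms(2)]
      dtr_linear tangent_space_component[OF assms(1)] tangent_space_component[OF assms(2)])

lemma coord_vector_in_tangent_space:
  assumes "c \<in> A" "x \<in> chart_dom c"
  shows "coord_vector A c x e \<in> tangent_space A x"
  using assms by (intro tangent_spaceI) (auto simp: coord_vector_def dtr_dtr)

lemma coord_vector_self: "c \<in> A \<Longrightarrow> x \<in> chart_dom c \<Longrightarrow> coord_vector A c x e c = e"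
  by (simp add: coord_vector_def dtr_refl)

lemma coord_vector_component:
  assumes "v \<in> tangent_space A x" "c \<in> A" "x \<in> chart_dom c"
  shows "coord_vector A c x (v c) = v"
proof
  fix d
  show "coord_vector A c x (v c) d = v d"
    using tangent_space_component[OF assms(1,2) _ assms(3), of d] tangent_space_eq_0[OF assms(1), of d]
    by (auto simp: coord_vector_def)
qed

lemma coord_vector_combination:
  assumes "c \<in> A" "x \<in> chart_dom c"
  shows "coord_vector A c x (a *\<^sub>R v + b *\<^sub>R w) = (\<lambda>d. a *\<^sub>R coord_vector A c x v d + b *\<^sub>R coord_vector A c x w d)"
  using assms by (auto simp: coord_vector_def fun_eq_iff dtr_linear)

lemma covec_of_in_cotangent_space: "covec_of A c x p \<in> cotangent_space A x"
  unfolding cotangent_space_def covec_of_def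
  by (auto simp: tangent_space_combination inner_add_right)

lemma covec_of_apply: "v \<in> tangent_space A x \<Longrightarrow> covec_of A c x p v = p \<bullet> v c"
  by (simp add: covec_of_def)

lemma covec_of_covec_coords:
  assumes P: "P \<in> cotangent_space A x" and c: "c \<in> A" "x \<in> chart_dom c"
  shows "covec_of A c x (covec_coords A c x P) = P"
proof
  fix v
  show "covec_of A c x (covec_coords A c x P) v = P v"
  proof (cases "v \<in> tangent_space A x")
    case True
    define f where "f e = P (coord_vector A c x e)" for e
    have comb: "f (a *\<^sub>R e + b *\<^sub>R e') = a * f e + b * f e'" for a b e e'
      using P coord_vector_in_tangent_space[OF c] unfolding cotangent_space_def f_def
      by (simp add: coord_vector_combination[OF c])
    have "linear f"
      using comb[of 1 _ 1] comb[of _ _ 0 0] by (intro linearI) auto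
    then have "f (\<Sum>b\<in>Basis. (v c \<bullet> b) *\<^sub>R b) = (\<Sum>b\<in>Basis. (v c \<bullet> b) * f b)"
      by (simp add: linear_sum linear_scale)
    then have "f (v c) = covec_coords A c x P \<bullet> v c"
      unfolding euclidean_representation covec_coords_def inner_sum_left
      by (simp add: f_def inner_commute mult.commute)
    then show ?thesis using True c by (simp add: covec_of_apply f_def coord_vector_component)
  next
    case False
    then show ?thesis using P by (simp add: covec_of_def cotangent_space_def)
  qed
qed

lemma covec_coords_covec_of:
  assumes "c \<in> A" "d \<in> A" "x \<in> chart_dom c" "x \<in> chart_dom d"
  shows "covec_coords A d x (covec_of A c x p) = (\<Sum>b\<in>Basis. (p \<bullet> dtr d c x b) *\<^sub>R b)"
  using assms by (simp add: covec_coords_def covec_of_apply coord_vector_in_tangent_space)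
    (simp add: coord_vector_def)

lemma ex_covec_of:
  assumes "P \<in> cotangent_space A x" "c \<in> A" "x \<in> chart_dom c"
  obtains p where "P = covec_of A c x p"
  using covec_of_covec_coords[OF assms] by metis

lemma covec_of_combination:
  "(\<lambda>v. a * covec_of A c x p v + b * covec_of A c x q v) = covec_of A c x (a *\<^sub>R p + b *\<^sub>R q)"
  by (auto simp: covec_of_def fun_eq_iff inner_add_left)

text \<open>The bundle topology is generated by chart conditions, so continuity of the inverse
  bundle chart is checked on these generators alone; \<open>G\<close> is then composed with
  it.\<close>

lemma continuous_on_covec_chart:
  assumes G: "continuous_map (cotangent_topology A) euclideanreal G" and c: "c \<in> A"
  shows "continuous_on (chart_img c \<times> UNIV) (\<lambda>(y, p). G (chart_inv c y, covec_of A c (chart_inv c y) p))"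
proof -
  let ?S = "chart_img c \<times> (UNIV :: 'e set)"
  let ?f = "\<lambda>(y, p). (chart_inv c y, covec_of A c (chart_inv c y) p)"
  have "continuous_map (top_of_set ?S) (cotangent_topology A) ?f"
    unfolding cotangent_topology_def
  proof (rule continuous_on_generated_topo)
    let ?gens = "{{(x, p) \<in> cotangent_bundle A. x \<in> chart_dom d \<and> (chart_map d x, covec_coords A d x p) \<in> W} | d W.
        d \<in> A \<and> open W}"
    show "openin (top_of_set ?S) (?f -` U \<inter> topspace (top_of_set ?S))" if U: "U \<in> ?gens" for U
    proof -
      obtain d W where d: "d \<in> A" and W: "open W" and
        U: "U = {(x, p) \<in> cotangent_bundle A. x \<in> chart_dom d \<and> (chart_map d x, covec_coords A d x p) \<in> W}"
        using U by blast
      \<comment> \<open>The change of covector coordinates: \<open>p\<close> is transformed by the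
        transpose of the derivative of the transition back from \<open>d\<close> to
        \<open>c\<close>.\<close>
      let ?g = "\<lambda>(y, p). (transition c d y,
        \<Sum>b\<in>Basis. (p \<bullet> frechet_derivative (transition d c) (at (transition c d y)) b) *\<^sub>R b)"
      have "continuous_on (overlap c d \<times> UNIV) ?g"
        unfolding case_prod_beta
        by (intro continuous_intros continuous_on_compose2[OF continuous_on_transition[OF c d]]
            continuous_on_compose2[OF continuous_on_transition_derivative[OF d c]])
          (auto simp: transition_in_overlap c d)
      then have "open ((overlap c d \<times> UNIV) \<inter> ?g -` W)"
        using W open_overlap[OF c d] by (intro continuous_open_preimage) (auto intro!: open_Times)
      moreover have "?f -` U \<inter> topspace (top_of_set ?S) = (overlap c d \<times> UNIV) \<inter> ?g -` W"
        using c d by (auto simp: U cotangent_bundle_def covec_of_in_cotangent_space mem_overlap_iff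
            covec_coords_covec_of transition_def)
      ultimately have "open (?f -` U \<inter> topspace (top_of_set ?S))" by (simp only:)
      then show ?thesis by (rule open_subset[rotated]) simp
    qed
    show "?f ` topspace (top_of_set ?S) \<subseteq> \<Union> ?gens"
    proof
      fix w assume "w \<in> ?f ` topspace (top_of_set ?S)"
      then obtain y p where y: "y \<in> chart_img c" and w: "w = (chart_inv c y, covec_of A c (chart_inv c y) p)"
        by auto
      have "w \<in> {(x, p) \<in> cotangent_bundle A. x \<in> chart_dom c \<and> (chart_map c x, covec_coords A c x p) \<in> UNIV}"
        using c y by (simp add: w cotangent_bundle_def covec_of_in_cotangent_space)
      then show "w \<in> \<Union> ?gens" using c open_UNIV by blast
    qed
 qed
  from continuous_map_compose[OF this G] show ?thesis
    by (simp add: o_def case_prod_beta)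
qed

text \<open>\<open>differential\<close> uses a chart picked by \<open>SOME\<close>. The chain rule
  along the transition map shows that every chart around \<open>x\<close> gives the same
  covector.\<close>

lemma differential_eq_covec_of:
  assumes c: "c \<in> A" "x \<in> chart_dom c"
    and \<phi>: "(\<phi> \<circ> chart_inv c has_derivative (\<lambda>h. p \<bullet> h)) (at (chart_map c x))"
  shows "differential A \<phi> x = covec_of A c x p"
proof
  fix v
  define d where "d = (SOME d. d \<in> A \<and> x \<in> chart_dom d)"
  have d: "d \<in> A" "x \<in> chart_dom d"
    using someI[of "\<lambda>d. d \<in> A \<and> x \<in> chart_dom d" c] c by (auto simp: d_def)
  show "differential A \<phi> x v = covec_of A c x p v"
  proof (cases "v \<in> tangent_space A x")
    case True
    have x: "transition d c (chart_map d x) = chart_map c x" using c d by (simp add: transition_def)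
    have "(\<phi> \<circ> chart_inv c has_derivative (\<lambda>h. p \<bullet> h)) (at (transition d c (chart_map d x)))"
      using \<phi> x by simp
    from has_derivative_compose[OF dtr[OF d(1) c(1) d(2) c(2)] this]
    have "(\<phi> \<circ> chart_inv d has_derivative (\<lambda>h. p \<bullet> dtr d c x h)) (at (chart_map d x))"
      by (rule has_derivative_transform_within_open[OF _ open_overlap[OF d(1) c(1)]])
        (use c d in \<open>auto simp: transition_def overlap_def\<close>)
    from frechet_derivative_at[OF this]
    have "frechet_derivative (\<phi> \<circ> chart_inv d) (at (chart_map d x)) (v d) = p \<bullet> dtr d c x (v d)" by metis
    also have "dtr d c x (v d) = v c" using True c d by (intro tangent_space_component)
    finally show ?thesis using True by (simp add: differential_def covec_of_apply Let_def o_def flip: d_def)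
  qed (simp add: differential_def covec_of_def)
qed

lemma C1_functions_iff:
  "f \<in> C1_functions A \<longleftrightarrow> (\<forall>c\<in>A. \<exists>g. continuous_on (chart_img c) g \<and>
    (\<forall>y\<in>chart_img c. (f \<circ> chart_inv c has_derivative (\<lambda>h. g y \<bullet> h)) (at y)))"
  unfolding C1_functions_def Ck_on_1_iff by simp

text \<open>The gradient in coordinates; it is unique wherever it exists, and arbitrary
  elsewhere.\<close>

definition chart_grad :: "('m, 'e) chart \<Rightarrow> ('m \<Rightarrow> real) \<Rightarrow> 'e \<Rightarrow> 'e" where
  "chart_grad c f y = (SOME p. (f \<circ> chart_inv c has_derivative (\<lambda>h. p \<bullet> h)) (at y))"

lemma chart_grad_eqI:
  assumes "(f \<circ> chart_inv c has_derivative (\<lambda>h. p \<bullet> h)) (at y)"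
  shows "chart_grad c f y = p"
proof -
  have "(f \<circ> chart_inv c has_derivative (\<lambda>h. chart_grad c f y \<bullet> h)) (at y)"
    unfolding chart_grad_def by (rule someI) (rule assms)
  from has_derivative_unique[OF this assms] have "chart_grad c f y \<bullet> h = p \<bullet> h" for h by metis
  then show ?thesis using vector_eq_rdot[of "chart_grad c f y" p] by blast
qed

lemma has_derivative_chart_grad:
  assumes "f \<in> C1_functions A" "c \<in> A" "y \<in> chart_img c"
  shows "(f \<circ> chart_inv c has_derivative (\<lambda>h. chart_grad c f y \<bullet> h)) (at y)"
proof -
  obtain g where "(f \<circ> chart_inv c has_derivative (\<lambda>h. g y \<bullet> h)) (at y)"
    using assms unfolding C1_functions_iff by blast
  then show ?thesis unfolding chart_grad_def by (rule someI)
qed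

lemma continuous_on_chart_grad:
  assumes "f \<in> C1_functions A" "c \<in> A"
  shows "continuous_on (chart_img c) (chart_grad c f)"
proof -
  obtain g where g: "continuous_on (chart_img c) g"
    "\<forall>y\<in>chart_img c. (f \<circ> chart_inv c has_derivative (\<lambda>h. g y \<bullet> h)) (at y)"
    using assms unfolding C1_functions_iff by blast
  from g(1) show ?thesis by (rule continuous_on_eq) (use g(2) in \<open>auto intro: chart_grad_eqI[symmetric]\<close>)
qed

lemma differential_chart_grad:
  assumes "f \<in> C1_functions A" "c \<in> A" "x \<in> chart_dom c"
  shows "differential A f x = covec_of A c x (chart_grad c f (chart_map c x))"
  using assms by (intro differential_eq_covec_of has_derivative_chart_grad) auto

lemma C1_combination:
  assumes "f \<in> C1_functions A" "g \<in> C1_functions A"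
  shows "(\<lambda>x. a * f x + b * g x) \<in> C1_functions A"
    and "\<And>c y. c \<in> A \<Longrightarrow> y \<in> chart_img c \<Longrightarrow>
      chart_grad c (\<lambda>x. a * f x + b * g x) y = a *\<^sub>R chart_grad c f y + b *\<^sub>R chart_grad c g y"
proof -
  have D: "((\<lambda>x. a * f x + b * g x) \<circ> chart_inv c has_derivative
      (\<lambda>h. (a *\<^sub>R chart_grad c f y + b *\<^sub>R chart_grad c g y) \<bullet> h)) (at y)"
    if "c \<in> A" "y \<in> chart_img c" for c y
  proof -
    have "((\<lambda>y. a * (f \<circ> chart_inv c) y + b * (g \<circ> chart_inv c) y) has_derivative
        (\<lambda>h. a * (chart_grad c f y \<bullet> h) + b * (chart_grad c g y \<bullet> h))) (at y)"
      by (intro has_derivative_add has_derivative_mult_right has_derivative_chart_grad assms that)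
    then show ?thesis by (simp add: o_def inner_add_left)
  qed
  show "\<And>c y. c \<in> A \<Longrightarrow> y \<in> chart_img c \<Longrightarrow>
      chart_grad c (\<lambda>x. a * f x + b * g x) y = a *\<^sub>R chart_grad c f y + b *\<^sub>R chart_grad c g y"
    by (intro chart_grad_eqI D)
  show "(\<lambda>x. a * f x + b * g x) \<in> C1_functions A"
    unfolding C1_functions_iff
  proof
    fix c assume c: "c \<in> A"
    have "continuous_on (chart_img c) (\<lambda>y. a *\<^sub>R chart_grad c f y + b *\<^sub>R chart_grad c g y)"
      by (intro continuous_intros continuous_on_chart_grad assms c)
    then show "\<exists>k. continuous_on (chart_img c) k \<and> (\<forall>y\<in>chart_img c.
        ((\<lambda>x. a * f x + b * g x) \<circ> chart_inv c has_derivative (\<lambda>h. k y \<bullet> h)) (at y))"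
      by (intro exI conjI ballI) (auto intro: D[OF c])
  qed
qed

lemma C1_const: "(\<lambda>x. k) \<in> C1_functions A"
  unfolding C1_functions_iff o_def
  by (intro ballI exI[of _ "\<lambda>y. 0"] conjI has_derivative_eq_rhs[OF has_derivative_const]) auto

lemma continuous_on_C1:
  assumes "f \<in> C1_functions A" "c \<in> A"
  shows "continuous_on (chart_img c) (f \<circ> chart_inv c)"
  by (intro continuous_at_imp_continuous_on ballI has_derivative_continuous[OF has_derivative_chart_grad[OF assms]])

section \<open>From test functions in a chart to test functions on the manifold\<close>

text \<open>Viscosity solutions are tested by global functions, while doubling of variables produces
  functions of the coordinates. A cutoff supported well inside the chart, followed by extension by
  0, bridges the gap.\<close>

lemma C1_extension:
  fixes f :: "'e \<Rightarrow> real"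
  assumes c: "c \<in> A" and r: "r > 0" "cball z r \<subseteq> chart_img c"
    and f: "continuous_on UNIV g" "\<And>x. (f has_derivative (\<lambda>h. g x \<bullet> h)) (at x)"
  obtains F where "F \<in> C1_functions A" "\<And>y. y \<in> ball z (r/2) \<Longrightarrow> F (chart_inv c y) = f y"
proof -
  obtain \<eta> :: "'e \<Rightarrow> real" and k where \<eta>: "continuous_on UNIV k"
    "\<And>x. (\<eta> has_derivative (\<lambda>h. k x \<bullet> h)) (at x)"
    "\<And>x. x \<in> ball z (r/2) \<Longrightarrow> \<eta> x = 1" "\<And>x. x \<notin> cball z (3*r/4) \<Longrightarrow> \<eta> x = 0"
    by (rule C1_bump[OF r(1), of z]) (rule that)
  let ?K = "cball z (3*r/4)"
  have Kc: "?K \<subseteq> chart_img c" using r by (intro order.trans[OF _ r(2)] subset_cball) auto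
  define q where "q x = \<eta> x *\<^sub>R g x + f x *\<^sub>R k x" for x
  have df: "((\<lambda>x. \<eta> x * f x) has_derivative (\<lambda>h. q x \<bullet> h)) (at x)" for x
    by (rule has_derivative_eq_rhs[OF has_derivative_mult[OF \<eta>(2) f(2)]])
      (simp add: q_def inner_add_left fun_eq_iff)
  have cf: "continuous_on UNIV f" "continuous_on UNIV \<eta>"
    by (intro continuous_at_imp_continuous_on ballI has_derivative_continuous[OF f(2)]
        has_derivative_continuous[OF \<eta>(2)])+
  have cq: "continuous_on UNIV q" unfolding q_def by (intro continuous_intros cf f \<eta>)
  define F where "F x = (if x \<in> chart_dom c then \<eta> (chart_map c x) * f (chart_map c x) else 0)" for x
  define C where "C = chart_inv c ` ?K"
  have "compact C" unfolding C_def
    by (intro compact_continuous_image continuous_on_subset[OF continuous_on_chart_inv[OF c] Kc]) auto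
  then have C: "closed C" by (rule compact_imp_closed)
  have F0: "F x = 0" if "x \<notin> C" for x
  proof (cases "x \<in> chart_dom c")
    case True
    then have "chart_map c x \<notin> ?K" using that c unfolding C_def by (metis chart_inv_map image_eqI)
    then show ?thesis by (simp add: F_def \<eta>(4))
  qed (simp add: F_def)
  have "F \<in> C1_functions A"
    unfolding C1_functions_def
  proof (intro CollectI ballI Ck_on_1_local)
    fix d y assume d: "d \<in> A" and y: "y \<in> chart_img d"
    show "\<exists>U. open U \<and> y \<in> U \<and> Ck_on 1 U (F \<circ> chart_inv d)"
    proof (cases "chart_inv d y \<in> chart_dom c")
      case True
      let ?g = "\<lambda>y. \<Sum>b\<in>Basis. (q (transition d c y) \<bullet> frechet_derivative (transition d c) (at y) b) *\<^sub>R b"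
      have "continuous_on (overlap d c) ?g"
        by (intro continuous_intros continuous_on_compose2[OF cq continuous_on_transition[OF d c]]
            continuous_on_transition_derivative d c) auto
      moreover have "((\<lambda>y. \<eta> (transition d c y) * f (transition d c y)) has_derivative (\<lambda>h. ?g y \<bullet> h)) (at y)"
        if "y \<in> overlap d c" for y
      proof -
        let ?D = "frechet_derivative (transition d c) (at y)"
        have D: "(transition d c has_derivative ?D) (at y)"
          by (rule transition_has_derivative[OF d c that])
        then interpret D: bounded_linear ?D by (rule has_derivative_bounded_linear)
        have eq: "q (transition d c y) \<bullet> ?D h = ?g y \<bullet> h" for h
        proof -
          have "?D h = ?D (\<Sum>b\<in>Basis. (h \<bullet> b) *\<^sub>R b)" by (simp add: euclidean_representation)
          then have "?D h = (\<Sum>b\<in>Basis. (h \<bullet> b) *\<^sub>R ?D b)" by (simp add: D.sum D.scaleR)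
          then show ?thesis by (simp add: inner_sum_left inner_sum_right inner_commute mult.commute)
        qed
        show ?thesis
          by (rule has_derivative_eq_rhs[OF has_derivative_compose[OF D df]]) (rule ext, rule eq)
      qed
      ultimately have "Ck_on 1 (overlap d c) (\<lambda>y. \<eta> (transition d c y) * f (transition d c y))"
        unfolding Ck_on_1_iff by blast
      then have "Ck_on 1 (overlap d c) (F \<circ> chart_inv d)"
        by (rule Ck_on_1_cong[OF _ open_overlap[OF d c]])
          (auto simp: F_def transition_def mem_overlap_iff[OF d])
      then show ?thesis using open_overlap[OF d c] True y d mem_overlap_iff by blast
    next
      case False
      \<comment> \<open>A point outside the chart \<open>c\<close> has a neighbourhood missing
        \<open>C\<close>, which is closed because it is compact in a Hausdorff space;
        \<open>F\<close> is 0 there.\<close>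
      let ?U = "{y \<in> chart_img d. chart_inv d y \<in> - C}"
      have U: "open ?U" using C d by (intro open_chart_vimage) auto
      have "Ck_on 1 ?U (\<lambda>y. 0 :: real)" unfolding Ck_on_1_iff
        by (intro exI[of _ "\<lambda>y. 0"] conjI ballI has_derivative_eq_rhs[OF has_derivative_const]) auto
      then have "Ck_on 1 ?U (F \<circ> chart_inv d)"
        by (rule Ck_on_1_cong[OF _ U]) (auto simp: F0)
      moreover have "y \<in> ?U" using False y c Kc by (auto simp: C_def)
      ultimately show ?thesis using U by blast
    qed
  qed
  moreover have "F (chart_inv c y) = f y" if "y \<in> ball z (r/2)" for y
  proof -
    have "y \<in> chart_img c" using that r by auto
    then show ?thesis using c \<eta>(3)[OF that] by (simp add: F_def)
  qed
  ultimately show ?thesis by (rule that)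
qed

text \<open>Only \<open>f\<close> has to be cut off, since \<open>\<phi>\<close> is global already.
  The predicate \<open>P\<close> carries local statements from the chart to the manifold, for maxima
  and minima alike.\<close>

lemma chart_test_function:
  fixes f :: "'e \<Rightarrow> real"
  assumes c: "c \<in> A" "y \<in> chart_img c" and \<phi>: "\<phi> \<in> C1_functions A"
    and f: "continuous_on UNIV g" "\<And>x. (f has_derivative (\<lambda>h. g x \<bullet> h)) (at x)"
  obtains \<psi> where "\<psi> \<in> C1_functions A"
    "differential A \<psi> (chart_inv c y) = covec_of A c (chart_inv c y) (a *\<^sub>R chart_grad c \<phi> y + g y)"
    "\<And>P. (\<forall>\<^sub>F x in nhds y. P x (a * \<phi> (chart_inv c x) + f x)) \<Longrightarrow>
      \<forall>\<^sub>F x in nhds (chart_inv c y). P (chart_map c x) (\<psi> x) \<and> x \<in> chart_dom c"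
    "\<psi> (chart_inv c y) = a * \<phi> (chart_inv c y) + f y"
proof -
  obtain r where r: "r > 0" "cball y r \<subseteq> chart_img c"
    using open_chart_img[OF c(1)] c(2) open_contains_cball by blast
  obtain F where F: "F \<in> C1_functions A" "\<And>x. x \<in> ball y (r/2) \<Longrightarrow> F (chart_inv c x) = f x"
    using C1_extension[OF c(1) r f] by blast
  let ?\<psi> = "\<lambda>x. a * \<phi> x + 1 * F x"
  have y: "y \<in> ball y (r/2)" using r by simp
  show ?thesis
  proof (rule that[of ?\<psi>])
    show \<psi>: "?\<psi> \<in> C1_functions A" by (rule C1_combination[OF \<phi> F(1)])
    have "(f has_derivative (\<lambda>h. g y \<bullet> h)) (at y)" by (rule f)
    then have "(F \<circ> chart_inv c has_derivative (\<lambda>h. g y \<bullet> h)) (at y)"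
      by (rule has_derivative_transform_within_open[OF _ open_ball y]) (simp add: F(2))
    then have "chart_grad c F y = g y" by (rule chart_grad_eqI)
    then show "differential A ?\<psi> (chart_inv c y) = covec_of A c (chart_inv c y) (a *\<^sub>R chart_grad c \<phi> y + g y)"
      using C1_combination(2)[OF \<phi> F(1) c, of a 1] differential_chart_grad[OF \<psi> c(1), of "chart_inv c y"] c
      by simp
    show "?\<psi> (chart_inv c y) = a * \<phi> (chart_inv c y) + f y" using F(2)[OF y] by simp
    fix P assume P: "\<forall>\<^sub>F x in nhds y. P x (a * \<phi> (chart_inv c x) + f x)"
    have dom: "\<forall>\<^sub>F x in nhds (chart_inv c y). x \<in> chart_dom c"
      using c open_chart_dom by (intro eventually_nhds_in_open) auto
    have "isCont (chart_map c) (chart_inv c y)"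
      using continuous_on_chart_map[OF c(1)] open_chart_dom[OF c(1)] c by (simp add: continuous_on_eq_continuous_at)
    then have "filterlim (chart_map c) (nhds (chart_map c (chart_inv c y))) (nhds (chart_inv c y))"
      by (simp only: isCont_def tendsto_at_iff_tendsto_nhds)
    then have "filterlim (chart_map c) (nhds y) (nhds (chart_inv c y))" using c by simp
    moreover have "\<forall>\<^sub>F x in nhds y. P x (a * \<phi> (chart_inv c x) + f x) \<and> x \<in> ball y (r/2)"
      using P y by (intro eventually_conj eventually_nhds_in_open) auto
    ultimately have "\<forall>\<^sub>F x in nhds (chart_inv c y).
        P (chart_map c x) (a * \<phi> (chart_inv c (chart_map c x)) + f (chart_map c x)) \<and> chart_map c x \<in> ball y (r/2)"
      by (rule eventually_compose_filterlim[rotated])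
    with dom show "\<forall>\<^sub>F x in nhds (chart_inv c y). P (chart_map c x) (?\<psi> x) \<and> x \<in> chart_dom c"
    proof eventually_elim
      case (elim x)
      then show ?case using F(2)[of "chart_map c x"] c by simp
    qed
  qed
qed

text \<open>Provides the hypothesis \<open>sub\<close> of \<open>doubling_of_variables\<close>,
  where \<open>a\<close> becomes \<open>- s / (1 - s)\<close>.\<close>

lemma viscosity_subsolution_in_chart:
  fixes f :: "'e \<Rightarrow> real"
  assumes u: "viscosity_solution A G k u" and c: "c \<in> A" "y \<in> chart_img c" and \<phi>: "\<phi> \<in> C1_functions A"
    and f: "continuous_on UNIV g" "\<And>x. (f has_derivative (\<lambda>h. g x \<bullet> h)) (at x)"
    and max: "\<forall>\<^sub>F x in nhds y. u (chart_inv c x) - (a * \<phi> (chart_inv c x) + f x)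
        \<le> u (chart_inv c y) - (a * \<phi> (chart_inv c y) + f y)"
  shows "G (chart_inv c y, covec_of A c (chart_inv c y) (a *\<^sub>R chart_grad c \<phi> y + g y)) \<le> k"
proof -
  obtain \<psi> where \<psi>: "\<psi> \<in> C1_functions A"
    "differential A \<psi> (chart_inv c y) = covec_of A c (chart_inv c y) (a *\<^sub>R chart_grad c \<phi> y + g y)"
    "\<And>P. (\<forall>\<^sub>F x in nhds y. P x (a * \<phi> (chart_inv c x) + f x)) \<Longrightarrow>
      \<forall>\<^sub>F x in nhds (chart_inv c y). P (chart_map c x) (\<psi> x) \<and> x \<in> chart_dom c"
    "\<psi> (chart_inv c y) = a * \<phi> (chart_inv c y) + f y"
    by (rule chart_test_function[OF c \<phi> f, of a]) (rule that)
  have "\<forall>\<^sub>F x in nhds (chart_inv c y). u x - \<psi> x \<le> u (chart_inv c y) - \<psi> (chart_inv c y)"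
    using \<psi>(3)[of "\<lambda>x t. u (chart_inv c x) - t \<le> u (chart_inv c y) - (a * \<phi> (chart_inv c y) + f y)", OF max]
    by (rule eventually_mono) (use c \<psi>(4) in auto)
  then have "G (chart_inv c y, differential A \<psi> (chart_inv c y)) \<le> k"
    using u \<psi>(1) unfolding viscosity_solution_def by blast
  then show ?thesis by (simp only: \<psi>(2))
qed

lemma viscosity_supersolution_in_chart:
  fixes f :: "'e \<Rightarrow> real"
  assumes u: "viscosity_solution A G k u" and c: "c \<in> A" "y \<in> chart_img c"
    and f: "continuous_on UNIV g" "\<And>x. (f has_derivative (\<lambda>h. g x \<bullet> h)) (at x)"
    and min: "\<forall>\<^sub>F x in nhds y. u (chart_inv c x) - f x \<ge> u (chart_inv c y) - f y"
  shows "k \<le> G (chart_inv c y, covec_of A c (chart_inv c y) (g y))"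
proof -
  obtain \<psi> where \<psi>: "\<psi> \<in> C1_functions A"
    "differential A \<psi> (chart_inv c y) = covec_of A c (chart_inv c y) (0 *\<^sub>R chart_grad c (\<lambda>x. 0) y + g y)"
    "\<And>P. (\<forall>\<^sub>F x in nhds y. P x (0 * 0 + f x)) \<Longrightarrow>
      \<forall>\<^sub>F x in nhds (chart_inv c y). P (chart_map c x) (\<psi> x) \<and> x \<in> chart_dom c"
    "\<psi> (chart_inv c y) = 0 * 0 + f y"
    by (rule chart_test_function[OF c C1_const[of 0] f, of 0]) (rule that)
  have "\<forall>\<^sub>F x in nhds (chart_inv c y). u x - \<psi> x \<ge> u (chart_inv c y) - \<psi> (chart_inv c y)"
    using \<psi>(3)[of "\<lambda>x t. u (chart_inv c x) - t \<ge> u (chart_inv c y) - f y"] min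
    by (auto elim!: eventually_mono simp: \<psi>(4) c)
  then have "G (chart_inv c y, differential A \<psi> (chart_inv c y)) \<ge> k"
    using u \<psi>(1) unfolding viscosity_solution_def by blast
  then show ?thesis by (simp add: \<psi>(2))
qed

end

section \<open>Hamiltonians in charts\<close>

locale hamiltonian = atlas A for A :: "('m::t2_space, 'e::euclidean_space) chart set" +
  fixes g :: "'m \<Rightarrow> ('m, 'e) tvec \<Rightarrow> ('m, 'e) tvec \<Rightarrow> real"
    and G :: "'m \<times> ('m, 'e) covec \<Rightarrow> real"
  assumes compact_M: "compact (UNIV :: 'm set)"
    and metric: "riemannian_metric A g"
    and G_cont: "continuous_map (cotangent_topology A) euclideanreal G"
    and G_convex: "convex_in_p A G"
    and G_superlinear: "superlinear_in_p A g G"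
begin

definition H :: "('m, 'e) chart \<Rightarrow> 'e \<Rightarrow> 'e \<Rightarrow> real" where
  "H c y p = G (chart_inv c y, covec_of A c (chart_inv c y) p)"

lemma continuous_on_H: "c \<in> A \<Longrightarrow> continuous_on (chart_img c \<times> UNIV) (\<lambda>(y, p). H c y p)"
  unfolding H_def by (rule continuous_on_covec_chart[OF G_cont])

lemma continuous_on_H_fiber:
  assumes "c \<in> A" "y \<in> chart_img c"
  shows "continuous_on UNIV (H c y)"
proof -
  have "continuous_on UNIV (\<lambda>p :: 'e. (y, p))" by (intro continuous_intros)
  from continuous_on_compose2[OF continuous_on_H[OF assms(1)] this] show ?thesis using assms by auto
qed

lemma convex_on_H: "convex_on UNIV (H c y)"
proof (rule convex_onI)
  fix t :: real and p q :: 'e assume t: "0 < t" "t < 1"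
  let ?x = "chart_inv c y"
  have "G (?x, \<lambda>v. (1 - t) * covec_of A c ?x p v + t * covec_of A c ?x q v)
      \<le> (1 - t) * G (?x, covec_of A c ?x p) + t * G (?x, covec_of A c ?x q)"
    using G_convex t covec_of_in_cotangent_space[of c ?x] unfolding convex_in_p_def by auto
  then show "H c y ((1 - t) *\<^sub>R p + t *\<^sub>R q) \<le> (1 - t) * H c y p + t * H c y q"
    by (simp only: covec_of_combination H_def)
qed simp

text \<open>Bilinearity makes the metric a polynomial in the components, whence its continuity in
  the fibre and, with the smooth coefficients, jointly in point and vector.\<close>

lemma metric_in_coordinates:
  assumes c: "c \<in> A" "x \<in> chart_dom c"
  shows "g x (coord_vector A c x v) (coord_vector A c x w) =
    (\<Sum>i\<in>Basis. \<Sum>j\<in>Basis. (v \<bullet> i) * (w \<bullet> j) * g x (coord_vector A c x i) (coord_vector A c x j))"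
proof -
  let ?b = "\<lambda>v w. g x (coord_vector A c x v) (coord_vector A c x w)"
  note cv = coord_vector_in_tangent_space[OF c]
  have lin: "?b (a *\<^sub>R v + b *\<^sub>R v') w = a * ?b v w + b * ?b v' w" for a b v v' w
    using metric cv unfolding riemannian_metric_def by (simp add: coord_vector_combination[OF c])
  have scale: "?b (s *\<^sub>R v) w = s * ?b v w" for s v w using lin[of s v 0 v w] by simp
  have sym: "?b v w = ?b w v" for v w using metric cv unfolding riemannian_metric_def by blast
  have "linear (\<lambda>v. ?b v w)" for w
    using lin[of 1 _ 1] lin[of _ _ 0 0] by (intro linearI) auto
  then have sum: "?b v w = (\<Sum>i\<in>Basis. (v \<bullet> i) * ?b i w)" for v w
    using linear_sum[of "\<lambda>v. ?b v w" "\<lambda>i. (v \<bullet> i) *\<^sub>R i" Basis]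
    by (simp add: euclidean_representation scale)
  have sum': "?b i w = (\<Sum>j\<in>Basis. (w \<bullet> j) * ?b i j)" for i
    unfolding sym[of i w] sum[of w i] by (intro sum.cong refl, subst sym, rule refl)
  have "?b v w = (\<Sum>i\<in>Basis. (v \<bullet> i) * ?b i w)" by (rule sum)
  also have "\<dots> = (\<Sum>i\<in>Basis. (v \<bullet> i) * (\<Sum>j\<in>Basis. (w \<bullet> j) * ?b i j))"
    by (intro sum.cong refl, subst sum', rule refl)
  finally show ?thesis by (simp add: sum_distrib_left mult.assoc)
qed

lemma metric_pos:
  assumes c: "c \<in> A" "x \<in> chart_dom c" and "v \<noteq> 0"
  shows "g x (coord_vector A c x v) (coord_vector A c x v) > 0"
proof -
  have "coord_vector A c x v \<noteq> (\<lambda>c. 0)"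
    using coord_vector_self[OF c, of v] \<open>v \<noteq> 0\<close> by (metis)
  then show ?thesis
    using metric coord_vector_in_tangent_space[OF c] unfolding riemannian_metric_def by blast
qed

lemma metric_scale:
  assumes c: "c \<in> A" "x \<in> chart_dom c"
  shows "g x (coord_vector A c x (s *\<^sub>R v)) (coord_vector A c x (s *\<^sub>R v)) =
    s\<^sup>2 * g x (coord_vector A c x v) (coord_vector A c x v)"
  unfolding metric_in_coordinates[OF c, of "s *\<^sub>R v" "s *\<^sub>R v"] metric_in_coordinates[OF c, of v v]
  by (simp add: sum_distrib_left power2_eq_square algebra_simps)

lemma continuous_on_metric_fiber:
  assumes c: "c \<in> A" "x \<in> chart_dom c"
  shows "continuous_on S (\<lambda>v. g x (coord_vector A c x v) (coord_vector A c x v))"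
proof -
  have "continuous_on S (\<lambda>v. \<Sum>i\<in>Basis. \<Sum>j\<in>Basis. (v \<bullet> i) * (v \<bullet> j) *
      g x (coord_vector A c x i) (coord_vector A c x j))" by (intro continuous_intros)
  then show ?thesis by (rule continuous_on_eq) (rule metric_in_coordinates[OF c, symmetric])
qed

text \<open>Makes the supremum in \<open>conorm\<close> a genuine one. The metric has a positive
  minimum \<open>m\<close> on the Euclidean unit sphere, so metric unit vectors have components of
  norm at most \<open>1 / sqrt m\<close>.\<close>

lemma covec_bdd_above:
  assumes c: "c \<in> A" "x \<in> chart_dom c"
  shows "bdd_above (covec_of A c x p ` {v \<in> tangent_space A x. tnorm g x v \<le> 1})"
proof -
  let ?q = "\<lambda>v. g x (coord_vector A c x v) (coord_vector A c x v)"
  obtain b :: 'e where "b \<in> Basis" using nonempty_Basis by blast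
  then have "sphere (0::'e) 1 \<noteq> {}" by (intro ex_in_conv[THEN iffD1] exI[of _ b]) simp
  then obtain e where e: "e \<in> sphere 0 1" "\<And>v. v \<in> sphere 0 1 \<Longrightarrow> ?q e \<le> ?q v"
    using continuous_attains_inf[OF compact_sphere _ continuous_on_metric_fiber[OF c]] by blast
  define m where "m = ?q e"
  have m: "m > 0" unfolding m_def using e(1) by (intro metric_pos c) auto
  have "covec_of A c x p v \<le> norm p / sqrt m" if v: "v \<in> tangent_space A x" "tnorm g x v \<le> 1" for v
  proof (cases "v c = 0")
    case False
    let ?n = "norm (v c)"
    have "m \<le> ?q (v c /\<^sub>R ?n)" unfolding m_def using False by (intro e(2)) simp
    then have "?n\<^sup>2 * m \<le> ?n\<^sup>2 * ?q (v c /\<^sub>R ?n)" by (intro mult_left_mono) auto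
    also have "\<dots> = g x v v"
      using False metric_scale[OF c, of ?n "v c /\<^sub>R ?n"] coord_vector_component[OF v(1) c] by simp
    also have "\<dots> \<le> 1" using v(2) by (simp add: tnorm_def)
    finally have "sqrt (?n\<^sup>2 * m) \<le> 1" by simp
    then have "?n \<le> 1 / sqrt m" using m by (simp add: real_sqrt_mult field_simps)
    moreover have "p \<bullet> v c \<le> norm p * ?n" by (rule norm_cauchy_schwarz)
    ultimately have "p \<bullet> v c \<le> norm p * (1 / sqrt m)" by (meson mult_left_mono norm_ge_zero order.trans)
    then show ?thesis using v(1) by (simp add: covec_of_apply)
  qed (use v m in \<open>simp add: covec_of_apply\<close>)
  then show ?thesis by (intro bdd_aboveI[of _ "norm p / sqrt m"]) auto
qed

text \<open>The conorm of \<open>t *\<^sub>R q\<close> is at least its value on the metric unit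
  vector along \<open>q\<close>, hence at least \<open>t * n\<close>. The filter statement about the
  conorm thereby becomes growth along rays in coordinates.\<close>

lemma H_superlinear:
  assumes c: "c \<in> A" "y \<in> chart_img c" and q: "q \<noteq> 0"
  shows "\<exists>t\<ge>1. H c y (t *\<^sub>R q) > C * t"
proof -
  let ?x = "chart_inv c y" and ?b = "\<lambda>v. g (chart_inv c y) (coord_vector A c (chart_inv c y) v) (coord_vector A c (chart_inv c y) v)"
  have x: "?x \<in> chart_dom c" using c by simp
  have bq: "?b q > 0" by (rule metric_pos[OF c(1) x q])
  define e where "e = q /\<^sub>R sqrt (?b q)"
  define v where "v = coord_vector A c ?x e"
  have v: "v \<in> tangent_space A ?x" unfolding v_def by (rule coord_vector_in_tangent_space[OF c(1) x])
  have "g ?x v v = 1"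
    using bq metric_scale[OF c(1) x, of "inverse (sqrt (?b q))" q]
    by (simp add: v_def e_def power_inverse)
  then have v1: "tnorm g ?x v \<le> 1" by (simp add: tnorm_def)
  define n where "n = q \<bullet> e"
  have n: "n > 0" using q bq by (simp add: n_def e_def)
  have le: "t * n \<le> conorm A g ?x (covec_of A c ?x (t *\<^sub>R q))" for t
  proof -
    have "covec_of A c ?x (t *\<^sub>R q) v \<le> conorm A g ?x (covec_of A c ?x (t *\<^sub>R q))"
      unfolding conorm_def using v v1 by (intro cSUP_upper covec_bdd_above[OF c(1) x]) auto
    moreover have "covec_of A c ?x (t *\<^sub>R q) v = t * n"
      using v coord_vector_self[OF c(1) x, of e] by (simp add: covec_of_apply n_def v_def[symmetric])
    ultimately show ?thesis by simp
  qed
  \<comment> \<open>Chosen so that \<open>Z * (t * n)\<close> equals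
    \<open>(\<bar>C\<bar> + 1) * t\<close>, which exceeds \<open>C * t\<close>.\<close>
  define Z where "Z = (\<bar>C\<bar> + 1) / n"
  have "eventually (\<lambda>P. Z \<le> G (?x, P) / conorm A g ?x P)
      (inf (filtercomap (conorm A g ?x) at_top) (principal (cotangent_space A ?x)))"
    using G_superlinear unfolding superlinear_in_p_def filterlim_at_top by blast
  then obtain K where K: "\<And>P. conorm A g ?x P \<ge> K \<Longrightarrow> P \<in> cotangent_space A ?x \<Longrightarrow> Z \<le> G (?x, P) / conorm A g ?x P"
    unfolding eventually_inf_principal eventually_filtercomap_at_top_linorder by blast
  define t where "t = max 1 (K / n)"
  have t: "t \<ge> 1" "K \<le> t * n" using n by (auto simp: t_def max_def field_simps)
  let ?P = "covec_of A c ?x (t *\<^sub>R q)"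
  have pos: "0 < t * n" using t n by simp
  have "Z \<le> G (?x, ?P) / conorm A g ?x ?P"
    using le[of t] t by (intro K covec_of_in_cotangent_space) simp
  then have "Z * conorm A g ?x ?P \<le> G (?x, ?P)" using le[of t] pos by (simp add: field_simps)
  moreover have "Z * (t * n) \<le> Z * conorm A g ?x ?P" using le[of t] n by (intro mult_left_mono) (auto simp: Z_def)
  moreover have "Z * (t * n) = (\<bar>C\<bar> + 1) * t" using n by (simp add: Z_def)
  moreover have "C * t < (\<bar>C\<bar> + 1) * t" using t by (intro mult_strict_right_mono) auto
  ultimately have "C * t < H c y (t *\<^sub>R q)" by (simp add: H_def)
  then show ?thesis using t by blast
qed

lemma H_coercive:
  assumes c: "c \<in> A" and Q: "compact Q" "Q \<subseteq> chart_img c"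
  shows "\<exists>B. \<forall>y\<in>Q. \<forall>p. H c y p \<le> a \<longrightarrow> norm p \<le> B"
proof (rule sublevel_bounded_uniformly[OF Q(1), of "H c" a])
  show "continuous_on (Q \<times> UNIV) (\<lambda>(y, p). H c y p)"
    by (rule continuous_on_subset[OF continuous_on_H[OF c]]) (use Q in auto)
  show "convex_on UNIV (H c y)" for y by (rule convex_on_H)
  fix y q C assume "y \<in> Q" and q: "q \<noteq> (0 :: 'e)"
  then obtain t where t: "t \<ge> 1" "H c y (t *\<^sub>R q) > \<bar>C\<bar> * t" using H_superlinear[OF c] Q by blast
  have "C \<le> \<bar>C\<bar> * 1" by simp
  also have "\<dots> \<le> \<bar>C\<bar> * t" using t(1) by (intro mult_left_mono) auto
  finally have "C < H c y (t *\<^sub>R q)" using t(2) by simp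
  then show "\<exists>t\<ge>0. C < H c y (t *\<^sub>R q)" using t(1) by (intro exI[of _ t]) auto
qed blast

lemma Lagrangian_in_chart:
  assumes c: "c \<in> A" "x \<in> chart_dom c" and v: "v \<in> tangent_space A x"
  shows "Lagrangian A G (x, v) = (SUP p. p \<bullet> v c - H c (chart_map c x) p)"
proof -
  have "cotangent_space A x = range (covec_of A c x)"
    using ex_covec_of[OF _ c] covec_of_in_cotangent_space by blast
  then show ?thesis using c v
    by (simp add: Lagrangian_def image_image covec_of_apply H_def)
qed

lemma Lagrangian_bdd:
  assumes "c \<in> A" "y \<in> chart_img c"
  shows "bdd_above (range (\<lambda>p. p \<bullet> w - H c y p))"
  by (intro superlinear_conjugate_bdd_above continuous_on_H_fiber convex_on_H H_superlinear assms)

lemma Lagrangian_coord_vector: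
  assumes c: "c \<in> A" "y \<in> chart_img c"
  shows "Lagrangian A G (chart_inv c y, coord_vector A c (chart_inv c y) w) = (SUP p. p \<bullet> w - H c y p)"
  using c by (subst Lagrangian_in_chart[of c]) (simp_all add: coord_vector_in_tangent_space coord_vector_self)

text \<open>A unit step from \<open>q\<close> in the direction of \<open>v\<close> raises the affine
  minorant by \<open>norm v\<close>, while \<open>H\<close> is bounded on the enlarged compact set.
  The second bound controls the value \<open>\<tau> = v \<bullet> q - k\<close> that will dominate
  the Lagrangian.\<close>

lemma subgradients_bounded:
  assumes c: "c \<in> A" and Q: "compact Q" "Q \<subseteq> chart_img c"
  shows "\<exists>R. \<forall>y\<in>Q. \<forall>q v. H c y q \<le> k \<longrightarrow> (\<forall>p. k + v \<bullet> (p - q) \<le> H c y p) \<longrightarrow> norm v \<le> R \<and> \<bar>v \<bullet> q - k\<bar> \<le> R"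
proof -
  obtain B where B: "\<And>y p. y \<in> Q \<Longrightarrow> H c y p \<le> k \<Longrightarrow> norm p \<le> B" using H_coercive[OF c Q] by blast
  have "compact (Q \<times> cball (0::'e) (B + 1))" using Q by (intro compact_Times) auto
  moreover have "continuous_on (Q \<times> cball 0 (B + 1)) (\<lambda>(y, p). H c y p)"
    by (rule continuous_on_subset[OF continuous_on_H[OF c]]) (use Q in auto)
  ultimately have "bounded ((\<lambda>(y, p). H c y p) ` (Q \<times> cball 0 (B + 1)))"
    by (intro compact_imp_bounded compact_continuous_image)
  then obtain M where M: "\<And>y p. y \<in> Q \<Longrightarrow> norm p \<le> B + 1 \<Longrightarrow> \<bar>H c y p\<bar> \<le> M"
    unfolding bounded_iff by force
  define R where "R = \<bar>M\<bar> + \<bar>k\<bar>"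
  have "norm v \<le> R + R * \<bar>B\<bar> + \<bar>k\<bar> \<and> \<bar>v \<bullet> q - k\<bar> \<le> R + R * \<bar>B\<bar> + \<bar>k\<bar>"
    if y: "y \<in> Q" and q: "H c y q \<le> k" and v: "\<forall>p. k + v \<bullet> (p - q) \<le> H c y p" for y q v
  proof -
    have R: "R \<ge> 0" by (simp add: R_def)
    have nq: "norm q \<le> \<bar>B\<bar>" using B[OF y q] by simp
    have nv: "norm v \<le> R"
    proof (cases "v = 0")
      case False
      have "norm (q + v /\<^sub>R norm v) \<le> norm q + norm (v /\<^sub>R norm v)" by (rule norm_triangle_ineq)
      also have "\<dots> \<le> B + 1" using B[OF y q] False by simp
      finally have "\<bar>H c y (q + v /\<^sub>R norm v)\<bar> \<le> M" by (rule M[OF y])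
      moreover have "k + v \<bullet> (v /\<^sub>R norm v) \<le> H c y (q + v /\<^sub>R norm v)"
        using v[rule_format, of "q + v /\<^sub>R norm v"] by simp
      moreover have "v \<bullet> (v /\<^sub>R norm v) = norm v"
        using False by (simp add: dot_square_norm power2_eq_square)
      ultimately show ?thesis unfolding R_def by linarith
    qed (use R in simp)
    have "\<bar>v \<bullet> q\<bar> \<le> norm v * norm q" by (rule Cauchy_Schwarz_ineq2)
    also have "\<dots> \<le> R * \<bar>B\<bar>" using nv nq R by (intro mult_mono) auto
    finally have "\<bar>v \<bullet> q\<bar> \<le> R * \<bar>B\<bar>" .
    then show ?thesis using nv R mult_nonneg_nonneg[OF R abs_ge_zero[of B]] by linarith
  qed
  then show ?thesis by blast
qed

text \<open>Charts are numbered because the number later becomes a real coordinate of the parameter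
  space.\<close>

lemma finite_chart_cover:
  obtains N :: nat and cs :: "nat \<Rightarrow> ('m, 'e) chart" and Q :: "nat \<Rightarrow> 'e set"
  where "\<And>j. j < N \<Longrightarrow> cs j \<in> A" "\<And>j. j < N \<Longrightarrow> compact (Q j)" "\<And>j. j < N \<Longrightarrow> Q j \<subseteq> chart_img (cs j)"
    "\<And>x. \<exists>j<N. x \<in> chart_dom (cs j) \<and> chart_map (cs j) x \<in> Q j"
proof -
  have "\<forall>x. \<exists>c r. c \<in> A \<and> x \<in> chart_dom c \<and> r > 0 \<and> cball (chart_map c x) r \<subseteq> chart_img c"
  proof
    fix x
    obtain c where c: "c \<in> A" "x \<in> chart_dom c" by (rule chart_cover)
    obtain r where "r > 0" "cball (chart_map c x) r \<subseteq> chart_img c"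
      using open_chart_img[OF c(1), unfolded open_contains_cball] chart_map_img[OF c] by blast
    with c show "\<exists>c r. c \<in> A \<and> x \<in> chart_dom c \<and> r > 0 \<and> cball (chart_map c x) r \<subseteq> chart_img c"
      by blast
  qed
  then obtain c r where c: "\<And>x. c x \<in> A" "\<And>x. x \<in> chart_dom (c x)" and r: "\<And>x. r x > (0::real)"
    "\<And>x. cball (chart_map (c x) x) (r x) \<subseteq> chart_img (c x)" by metis
  define U where "U x = chart_dom (c x) \<inter> chart_map (c x) -` ball (chart_map (c x) x) (r x)" for x
  have "open (U x)" for x unfolding U_def
    by (intro continuous_open_preimage continuous_on_chart_map open_chart_dom c open_ball)
  moreover have "UNIV \<subseteq> (\<Union>x\<in>UNIV. U x)" using c r by (auto simp: U_def)
  ultimately obtain T where T: "finite T" "UNIV \<subseteq> (\<Union>x\<in>T. U x)"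
    using compactE_image[OF compact_M, of UNIV U] by metis
  obtain b where b: "bij_betw b {0..<card T} T" using ex_bij_betw_nat_finite[OF T(1)] by blast
  show ?thesis
  proof (rule that[of "card T" "\<lambda>j. c (b j)" "\<lambda>j. cball (chart_map (c (b j)) (b j)) (r (b j))"])
    fix x
    obtain x' where "x' \<in> T" "x \<in> U x'" using T(2) by blast
    moreover from \<open>x' \<in> T\<close> obtain j where "j < card T" "b j = x'"
      using bij_betw_imp_surj_on[OF b] by (metis atLeastLessThan_iff imageE)
    ultimately show "\<exists>j<card T. x \<in> chart_dom (c (b j)) \<and> chart_map (c (b j)) x \<in> cball (chart_map (c (b j)) (b j)) (r (b j))"
      by (auto simp: U_def less_imp_le)
  qed (use c r in auto)
qed

end

context atlas
begin

lemma continuous_on_UNIV_C1: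
  assumes f: "f \<in> C1_functions A"
  shows "continuous_on UNIV f"
proof -
  have "continuous_on (chart_dom c) f" if c: "c \<in> A" for c
  proof -
    have "continuous_on (chart_dom c) ((f \<circ> chart_inv c) \<circ> chart_map c)"
      by (rule continuous_on_compose[OF continuous_on_chart_map[OF c]])
        (rule continuous_on_subset[OF continuous_on_C1[OF f c]], use c in auto)
    then show ?thesis by (rule continuous_on_eq) (use c in auto)
  qed
  then have "continuous_on (\<Union>c\<in>A. chart_dom c) f"
    by (intro continuous_on_open_UN open_chart_dom)
  moreover have "(\<Union>c\<in>A. chart_dom c) = UNIV" using atlas by (simp add: smooth_atlas_def)
  ultimately show ?thesis by (simp only:)
qed

lemma continuous_on_in_chart:
  assumes "continuous_on UNIV u" "c \<in> A"
  shows "continuous_on (chart_img c) (\<lambda>y. u (chart_inv c y))"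
  by (rule continuous_on_compose2[OF assms(1) continuous_on_chart_inv[OF assms(2)]]) simp

end

section \<open>Contact points of two viscosity solutions\<close>

context hamiltonian
begin

lemma contact_covector:
  assumes u: "viscosity_solution A G k u1" "viscosity_solution A G k u2" and \<phi>: "\<phi> \<in> C1_functions A"
    and s: "0 < s" "s < 1" and c: "c \<in> A" "y \<in> chart_img c"
    and max: "\<And>x. (1 - s) * u1 x + s * \<phi> x - u2 x
      \<le> (1 - s) * u1 (chart_inv c y) + s * \<phi> (chart_inv c y) - u2 (chart_inv c y)"
  obtains q where "H c y q \<le> k" "k \<le> H c y ((1 - s) *\<^sub>R q + s *\<^sub>R chart_grad c \<phi> y)"
proof (rule doubling_of_variables[OF open_chart_img[OF c(1)] c(2) s,
      of "\<lambda>y. u1 (chart_inv c y)" "\<lambda>y. u2 (chart_inv c y)" "\<lambda>y. \<phi> (chart_inv c y)" "chart_grad c \<phi>" "H c" k])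
  show "continuous_on (chart_img c) (\<lambda>y. u1 (chart_inv c y))" "continuous_on (chart_img c) (\<lambda>y. u2 (chart_inv c y))"
    using u by (auto simp: viscosity_solution_def intro!: continuous_on_in_chart c)
  show "continuous_on (chart_img c) (\<lambda>y. \<phi> (chart_inv c y))"
    by (intro continuous_on_in_chart continuous_on_UNIV_C1 \<phi> c)
  show "continuous_on (chart_img c) (chart_grad c \<phi>)" by (rule continuous_on_chart_grad[OF \<phi> c(1)])
  show "continuous_on (chart_img c \<times> UNIV) (\<lambda>(y, p). H c y p)" by (rule continuous_on_H[OF c(1)])
  show "\<exists>B. \<forall>y\<in>Q. \<forall>p. H c y p \<le> k \<longrightarrow> norm p \<le> B" if "compact Q" "Q \<subseteq> chart_img c" for Q
    by (rule H_coercive[OF c(1) that])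
  show "(1 - s) * u1 (chart_inv c x) + s * \<phi> (chart_inv c x) - u2 (chart_inv c x)
      \<le> (1 - s) * u1 (chart_inv c y) + s * \<phi> (chart_inv c y) - u2 (chart_inv c y)" for x
    by (rule max)
  show "H c x (a *\<^sub>R chart_grad c \<phi> x + gr x) \<le> k"
    if "x \<in> chart_img c" "continuous_on UNIV gr" "\<And>x. (f has_derivative (\<lambda>h. gr x \<bullet> h)) (at x)"
      "\<forall>\<^sub>F x' in nhds x. u1 (chart_inv c x') - (a * \<phi> (chart_inv c x') + f x')
        \<le> u1 (chart_inv c x) - (a * \<phi> (chart_inv c x) + f x)" for x a f gr
    unfolding H_def by (rule viscosity_subsolution_in_chart[OF u(1) c(1) that(1) \<phi> that(2-4)])
  show "k \<le> H c x (gr x)"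
    if "x \<in> chart_img c" "continuous_on UNIV gr" "\<And>x. (f has_derivative (\<lambda>h. gr x \<bullet> h)) (at x)"
      "\<forall>\<^sub>F x' in nhds x. u2 (chart_inv c x) - f x \<le> u2 (chart_inv c x') - f x'" for x f gr
    unfolding H_def by (rule viscosity_supersolution_in_chart[OF u(2) c(1) that])
qed (rule that)

text \<open>Let \<open>s\<close> tend to 0 in \<open>contact_covector\<close>. The perturbation by
  \<open>\<phi>\<close> disappears from the maximum condition, but convexity has already spread the
  lower bound along the whole segment to the gradient of \<open>\<phi>\<close>, where it
  survives.\<close>

lemma contact_segment:
  fixes N :: nat and cs :: "nat \<Rightarrow> ('m, 'e) chart" and Q :: "nat \<Rightarrow> 'e set"
  assumes u: "viscosity_solution A G k u1" "viscosity_solution A G k u2" and \<phi>: "\<phi> \<in> C1_functions A"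
    and cs: "\<And>j. j < N \<Longrightarrow> cs j \<in> A" and Q: "\<And>j. j < N \<Longrightarrow> compact (Q j)" "\<And>j. j < N \<Longrightarrow> Q j \<subseteq> chart_img (cs j)"
    and cover: "\<And>x. \<exists>j<N. x \<in> chart_dom (cs j) \<and> chart_map (cs j) x \<in> Q j"
  obtains j y q where "j < N" "y \<in> Q j"
    "\<And>x. u1 x - u2 x \<le> u1 (chart_inv (cs j) y) - u2 (chart_inv (cs j) y)"
    "H (cs j) y q \<le> k"
    "\<And>t. 0 \<le> t \<Longrightarrow> t \<le> 1 \<Longrightarrow> k \<le> H (cs j) y ((1 - t) *\<^sub>R q + t *\<^sub>R chart_grad (cs j) \<phi> y)"
proof -
  have cu: "continuous_on UNIV u1" "continuous_on UNIV u2" using u by (auto simp: viscosity_solution_def)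
  have c\<phi>: "continuous_on UNIV \<phi>" by (rule continuous_on_UNIV_C1[OF \<phi>])
  \<comment> \<open>The second \<open>Suc\<close> keeps \<open>s 0\<close> below 1.\<close>
  define s where "s n = inverse (real (Suc (Suc n)))" for n
  have s: "0 < s n" "s n < 1" for n by (auto simp: s_def field_simps)
  have s0: "s \<longlonglongrightarrow> 0"
    unfolding s_def by (rule LIMSEQ_Suc[OF LIMSEQ_inverse_real_of_nat])
  define P where "P n j y q \<longleftrightarrow> j < N \<and> y \<in> Q j \<and>
      (\<forall>x. (1 - s n) * u1 x + s n * \<phi> x - u2 x
        \<le> (1 - s n) * u1 (chart_inv (cs j) y) + s n * \<phi> (chart_inv (cs j) y) - u2 (chart_inv (cs j) y)) \<and>
      H (cs j) y q \<le> k \<and> k \<le> H (cs j) y ((1 - s n) *\<^sub>R q + s n *\<^sub>R chart_grad (cs j) \<phi> y)" for n j y q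
  have "\<exists>j y q. P n j y q" for n
  proof -
    have "continuous_on UNIV (\<lambda>x. (1 - s n) * u1 x + s n * \<phi> x - u2 x)"
      by (intro continuous_intros cu c\<phi>)
    then obtain z where z: "\<And>x. (1 - s n) * u1 x + s n * \<phi> x - u2 x \<le> (1 - s n) * u1 z + s n * \<phi> z - u2 z"
      using continuous_attains_sup[OF compact_M] by auto
    obtain j where j: "j < N" "z \<in> chart_dom (cs j)" "chart_map (cs j) z \<in> Q j" using cover by blast
    let ?y = "chart_map (cs j) z"
    have zy: "chart_inv (cs j) ?y = z" using j cs by simp
    obtain q where "H (cs j) ?y q \<le> k" "k \<le> H (cs j) ?y ((1 - s n) *\<^sub>R q + s n *\<^sub>R chart_grad (cs j) \<phi> ?y)"
    proof (rule contact_covector[OF u \<phi> s[of n] cs[OF j(1)], of ?y])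
      show "?y \<in> chart_img (cs j)" using j Q by blast
    qed (use z zy in auto)
    then have "P n j ?y q" unfolding P_def zy using j z by blast
    then show ?thesis by blast
  qed
  then obtain J Y q where P: "\<And>n. P n (J n) (Y n) (q n)" by metis
  \<comment> \<open>Among finitely many charts one occurs infinitely often, so the limit can be
    taken in fixed coordinates.\<close>
  have "J ` UNIV \<subseteq> {..<N}" using P unfolding P_def by blast
  then have "finite (range J)" by (rule finite_subset) simp
  then obtain n0 where "infinite {n \<in> UNIV. J n = J n0}"
    using pigeonhole_infinite[OF infinite_UNIV_nat] by blast
  then obtain r where r: "strict_mono (r :: nat \<Rightarrow> nat)" "\<And>n. r n \<in> {n \<in> UNIV. J n = J n0}"
    using infinite_enumerate by blast
  define j where "j = J n0"
  have Jr: "J (r n) = j" for n using r(2)[of n] by (simp add: j_def)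
  have j: "j < N" using P[of n0] unfolding P_def j_def by blast
  let ?c = "cs j"
  note c = cs[OF j] and Qj = Q[OF j]
  have P': "P (r n) j (Y (r n)) (q (r n))" for n using P[of "r n"] Jr[of n] by simp
  obtain B where B: "\<And>y p. y \<in> Q j \<Longrightarrow> H ?c y p \<le> k \<Longrightarrow> norm p \<le> B" using H_coercive[OF c Qj] by blast
  have "seq_compact (Q j \<times> cball (0::'e) B)" using Qj by (intro compact_imp_seq_compact compact_Times) auto
  moreover have "\<forall>n. (Y (r n), q (r n)) \<in> Q j \<times> cball 0 B" using P' B unfolding P_def by auto
  ultimately obtain l m where l: "l \<in> Q j \<times> cball 0 B" and m: "strict_mono (m :: nat \<Rightarrow> nat)"
    and lim: "((\<lambda>n. (Y (r n), q (r n))) \<circ> m) \<longlonglongrightarrow> l" by (rule seq_compactE)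
  define y p where "y = fst l" and "p = snd l"
  define y' q' s' where "y' n = Y (r (m n))" and "q' n = q (r (m n))" and "s' n = s (r (m n))" for n
  have ly: "y' \<longlonglongrightarrow> y" and lq: "q' \<longlonglongrightarrow> p"
    using tendsto_fst[OF lim] tendsto_snd[OF lim] by (simp_all add: y'_def[abs_def] q'_def[abs_def] y_def p_def o_def)
  have ls: "s' \<longlonglongrightarrow> 0"
    using LIMSEQ_subseq_LIMSEQ[OF s0 strict_mono_o[OF r(1) m]] by (simp add: s'_def[abs_def] o_def)
  have P'': "P (r (m n)) j (y' n) (q' n)" for n unfolding y'_def q'_def by (rule P')
  have yQ: "y \<in> Q j" using l by (auto simp: y_def)
  have y'Q: "y' n \<in> Q j" for n using P'' unfolding P_def by blast
  have yimg: "y \<in> chart_img ?c" "y' n \<in> chart_img ?c" for n using yQ y'Q Qj by auto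
  have limu: "(\<lambda>n. w (chart_inv ?c (y' n))) \<longlonglongrightarrow> w (chart_inv ?c y)" if "continuous_on UNIV w" for w :: "'m \<Rightarrow> real"
    using continuous_on_tendsto_compose[OF continuous_on_in_chart[OF that c] ly] yimg by simp
  have le: "(\<lambda>n. chart_grad ?c \<phi> (y' n)) \<longlonglongrightarrow> chart_grad ?c \<phi> y"
    using continuous_on_tendsto_compose[OF continuous_on_chart_grad[OF \<phi> c] ly] yimg by simp
  have limH: "(\<lambda>n. H ?c (y' n) (f n)) \<longlonglongrightarrow> H ?c y f'" if "f \<longlonglongrightarrow> f'" for f f'
    using continuous_on_tendsto_compose[OF continuous_on_H[OF c] tendsto_Pair[OF ly that]] yimg by simp
  show ?thesis
  proof (rule that[OF j yQ])
    fix x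
    show "u1 x - u2 x \<le> u1 (chart_inv ?c y) - u2 (chart_inv ?c y)"
    proof (rule LIMSEQ_le)
      have "(\<lambda>n. (1 - s' n) * u1 x + s' n * \<phi> x - u2 x) \<longlonglongrightarrow> (1 - 0) * u1 x + 0 * \<phi> x - u2 x"
        by (intro tendsto_intros ls)
      then show "(\<lambda>n. (1 - s' n) * u1 x + s' n * \<phi> x - u2 x) \<longlonglongrightarrow> u1 x - u2 x" by simp
      have "(\<lambda>n. (1 - s' n) * u1 (chart_inv ?c (y' n)) + s' n * \<phi> (chart_inv ?c (y' n)) - u2 (chart_inv ?c (y' n)))
          \<longlonglongrightarrow> (1 - 0) * u1 (chart_inv ?c y) + 0 * \<phi> (chart_inv ?c y) - u2 (chart_inv ?c y)"
        by (intro tendsto_intros ls limu cu c\<phi>)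
      then show "(\<lambda>n. (1 - s' n) * u1 (chart_inv ?c (y' n)) + s' n * \<phi> (chart_inv ?c (y' n)) - u2 (chart_inv ?c (y' n)))
          \<longlonglongrightarrow> u1 (chart_inv ?c y) - u2 (chart_inv ?c y)" by simp
      show "\<exists>n0. \<forall>n\<ge>n0. (1 - s' n) * u1 x + s' n * \<phi> x - u2 x
          \<le> (1 - s' n) * u1 (chart_inv ?c (y' n)) + s' n * \<phi> (chart_inv ?c (y' n)) - u2 (chart_inv ?c (y' n))"
        using P'' unfolding P_def s'_def by blast
    qed
  next
    have "H ?c (y' n) (q' n) \<le> k" for n using P'' unfolding P_def by blast
    then show "H ?c y p \<le> k" by (intro LIMSEQ_le_const2[OF limH[OF lq]]) blast
  next
    fix t :: real assume t: "0 \<le> t" "t \<le> 1"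
    have P1: "H ?c (y' n) (q' n) \<le> k"
      "k \<le> H ?c (y' n) ((1 - s' n) *\<^sub>R q' n + s' n *\<^sub>R chart_grad ?c \<phi> (y' n))" for n
      using P'' unfolding P_def s'_def by blast+
    show "k \<le> H ?c y ((1 - t) *\<^sub>R p + t *\<^sub>R chart_grad ?c \<phi> y)"
    \<comment> \<open>For \<open>t = 0\<close> no \<open>s' n\<close> falls below \<open>t\<close>;
      there the perturbed covectors themselves converge to \<open>p\<close>.\<close>
    proof (cases "t = 0")
      case True
      have "(\<lambda>n. (1 - s' n) *\<^sub>R q' n + s' n *\<^sub>R chart_grad ?c \<phi> (y' n)) \<longlonglongrightarrow>
          (1 - 0) *\<^sub>R p + 0 *\<^sub>R chart_grad ?c \<phi> y"
        by (intro tendsto_intros ls lq le)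
      then show ?thesis unfolding True by (intro LIMSEQ_le_const[OF limH]) (use P1(2) in auto)
    next
      case False
      have "(\<lambda>n. (1 - t) *\<^sub>R q' n + t *\<^sub>R chart_grad ?c \<phi> (y' n)) \<longlonglongrightarrow> (1 - t) *\<^sub>R p + t *\<^sub>R chart_grad ?c \<phi> y"
        by (intro tendsto_intros lq le)
      then show ?thesis
      proof (rule LIMSEQ_le_const[OF limH])
        have "\<forall>\<^sub>F n in sequentially. s' n < t" using order_tendstoD(2)[OF ls, of t] False t by auto
        then obtain n1 where n1: "\<And>n. n \<ge> n1 \<Longrightarrow> s' n < t" by (auto simp: eventually_sequentially)
        have "k \<le> H ?c (y' n) ((1 - t) *\<^sub>R q' n + t *\<^sub>R chart_grad ?c \<phi> (y' n))" if "n \<ge> n1" for n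
        proof -
          \<comment> \<open>The point with parameter \<open>s' n\<close> divides the segment from
            \<open>q' n\<close> to the point with parameter \<open>t\<close> in the fraction
            \<open>a\<close>. As \<open>H\<close> is at most \<open>k\<close> at \<open>q' n\<close>
            and at least \<open>k\<close> at the dividing point, it is at least \<open>k\<close> at
            the far end.\<close>
          define a where "a = s' n / t"
          have a: "0 < a" "a \<le> 1" using n1[OF that] s[of "r (m n)"] t False
            by (auto simp: a_def s'_def field_simps)
          have at: "a * t = s' n" using False by (simp add: a_def)
          let ?e = "chart_grad ?c \<phi> (y' n)"
          have "(1 - s' n) *\<^sub>R q' n + s' n *\<^sub>R ?e = (1 - a) *\<^sub>R q' n + a *\<^sub>R ((1 - t) *\<^sub>R q' n + t *\<^sub>R ?e)"
            unfolding at[symmetric] by (simp add: algebra_simps)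
          then have "k \<le> H ?c (y' n) ((1 - a) *\<^sub>R q' n + a *\<^sub>R ((1 - t) *\<^sub>R q' n + t *\<^sub>R ?e))"
            using P1(2)[of n] by simp
          also have "\<dots> \<le> (1 - a) * H ?c (y' n) (q' n) + a * H ?c (y' n) ((1 - t) *\<^sub>R q' n + t *\<^sub>R ?e)"
            using a by (intro convex_onD[OF convex_on_H]) auto
          also have "\<dots> \<le> (1 - a) * k + a * H ?c (y' n) ((1 - t) *\<^sub>R q' n + t *\<^sub>R ?e)"
            using a P1(1)[of n] by (intro add_right_mono mult_left_mono) auto
          finally have "a * k \<le> a * H ?c (y' n) ((1 - t) *\<^sub>R q' n + t *\<^sub>R ?e)" by (simp add: algebra_simps)
          then show ?thesis using a by simp
        qed
        then show "\<exists>n1. \<forall>n\<ge>n1. k \<le> H ?c (y' n) ((1 - t) *\<^sub>R q' n + t *\<^sub>R chart_grad ?c \<phi> (y' n))" by blast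
      qed
    qed
  qed
qed

end

section \<open>Measures on the tangent bundle\<close>

text \<open>Distinct labels keep the finitely many closed pieces disjoint, so continuity needs no
  compatibility between them.\<close>

lemma continuous_on_indexed_pieces:
  fixes f :: "real \<times> 'b::topological_space \<Rightarrow> 'c::topological_space"
  assumes "\<And>j::nat. j < N \<Longrightarrow> closed (S j)" "\<And>j. j < N \<Longrightarrow> continuous_on (S j) (\<lambda>w. f (real j, w))"
  shows "continuous_on (\<Union>j<N. {real j} \<times> S j) f"
proof (rule continuous_on_closed_Union)
  fix j assume "j \<in> {..<N}"
  then have j: "j < N" by simp
  show "closed ({real j} \<times> S j)" by (intro closed_Times assms j) auto
  have "continuous_on ({real j} \<times> S j) (\<lambda>w. f (real j, snd w))"
    by (rule continuous_on_compose2[OF assms(2)[OF j]]) (auto intro!: continuous_intros)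
  then show "continuous_on ({real j} \<times> S j) f" by (rule continuous_on_eq) auto
qed simp

context atlas
begin

lemma openin_tangent_chart:
  assumes "c \<in> A" "open W"
  shows "openin (tangent_topology A) {(x, v) \<in> tangent_bundle A. x \<in> chart_dom c \<and> (chart_map c x, v c) \<in> W}"
  unfolding tangent_topology_def by (rule topology_generated_by_Basis) (use assms in blast)

lemma openin_tangent_subset: "openin (tangent_topology A) W \<Longrightarrow> W \<subseteq> tangent_bundle A"
  by (drule openin_subset) (auto simp: tangent_topology_def topology_generated_by_topspace)

lemma tangent_bundleI: "c \<in> A \<Longrightarrow> y \<in> chart_img c \<Longrightarrow> (chart_inv c y, coord_vector A c (chart_inv c y) w) \<in> tangent_bundle A"
  by (simp add: tangent_bundle_def coord_vector_in_tangent_space)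

lemma space_tangent_borel: "space (tangent_borel A) = tangent_bundle A"
  unfolding tangent_borel_def by (rule space_measure_of) (use openin_tangent_subset in blast)

lemma sets_tangent_borelI: "openin (tangent_topology A) W \<Longrightarrow> W \<in> sets (tangent_borel A)"
  unfolding tangent_borel_def
  by (subst sets_measure_of) (use openin_tangent_subset in \<open>auto intro: sigma_sets.Basic\<close>)

text \<open>The set is even open: it is the union of its parts over the single charts, each of which
  generates the topology.\<close>

lemma sets_tangent_borel_chartwise:
  assumes open_W: "\<And>c. c \<in> A \<Longrightarrow> open {(y, w). y \<in> chart_img c \<and> P (chart_inv c y) (coord_vector A c (chart_inv c y) w)}"
  shows "{(x, v) \<in> tangent_bundle A. P x v} \<in> sets (tangent_borel A)"
proof -
  let ?W = "\<lambda>c. {(y, w). y \<in> chart_img c \<and> P (chart_inv c y) (coord_vector A c (chart_inv c y) w)}"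
  let ?U = "\<lambda>c. {(x, v) \<in> tangent_bundle A. x \<in> chart_dom c \<and> (chart_map c x, v c) \<in> ?W c}"
  have "openin (tangent_topology A) (\<Union>(?U ` A))"
    using openin_tangent_chart[OF _ open_W] by (intro openin_Union) auto
  moreover have "\<Union>(?U ` A) = {(x, v) \<in> tangent_bundle A. P x v}"
  proof (intro equalityI subsetI)
    fix z assume "z \<in> {(x, v) \<in> tangent_bundle A. P x v}"
    then obtain x v where z: "z = (x, v)" "(x, v) \<in> tangent_bundle A" "P x v" by blast
    obtain c where c: "c \<in> A" "x \<in> chart_dom c" by (rule chart_cover)
    have "coord_vector A c x (v c) = v" using z c by (intro coord_vector_component) (auto simp: tangent_bundle_def)
    then have "z \<in> ?U c" using z c by simp
    then show "z \<in> \<Union>(?U ` A)" using c by blast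
  next
    fix z assume "z \<in> \<Union>(?U ` A)"
    then obtain c x v where c: "c \<in> A" and z: "z = (x, v)" "(x, v) \<in> tangent_bundle A" "x \<in> chart_dom c"
      "P (chart_inv c (chart_map c x)) (coord_vector A c (chart_inv c (chart_map c x)) (v c))" by blast
    moreover have "coord_vector A c x (v c) = v" using z c by (intro coord_vector_component) (auto simp: tangent_bundle_def)
    ultimately show "z \<in> {(x, v) \<in> tangent_bundle A. P x v}" by simp
  qed
  ultimately have "openin (tangent_topology A) {(x, v) \<in> tangent_bundle A. P x v}" by (simp only:)
  then show ?thesis by (rule sets_tangent_borelI)
qed

text \<open>Lower semicontinuity in charts is enough, and it is what the Lagrangian offers.\<close>

lemma borel_measurable_tangentI:
  fixes f :: "'m \<times> ('m, 'e) tvec \<Rightarrow> real"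
  assumes "\<And>c a. c \<in> A \<Longrightarrow> open {(y, w). y \<in> chart_img c \<and> a < f (chart_inv c y, coord_vector A c (chart_inv c y) w)}"
  shows "f \<in> borel_measurable (tangent_borel A)"
proof (subst borel_measurable_iff_greater, rule allI)
  fix a
  have "{(x, v) \<in> tangent_bundle A. a < f (x, v)} \<in> sets (tangent_borel A)"
    by (rule sets_tangent_borel_chartwise) (rule assms)
  moreover have "{(x, v) \<in> tangent_bundle A. a < f (x, v)} = {z \<in> space (tangent_borel A). a < f z}"
    by (auto simp: space_tangent_borel)
  ultimately show "{z \<in> space (tangent_borel A). a < f z} \<in> sets (tangent_borel A)" by simp
qed

lemma borel_measurable_tangent_continuous:
  fixes f :: "'m \<times> ('m, 'e) tvec \<Rightarrow> real"
  assumes "\<And>c. c \<in> A \<Longrightarrow>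
    continuous_on (chart_img c \<times> UNIV) (\<lambda>(y, w). f (chart_inv c y, coord_vector A c (chart_inv c y) w))"
  shows "f \<in> borel_measurable (tangent_borel A)"
proof (rule borel_measurable_tangentI)
  fix c a assume c: "c \<in> A"
  have "open ((chart_img c \<times> UNIV) \<inter> (\<lambda>(y, w). f (chart_inv c y, coord_vector A c (chart_inv c y) w)) -` {a<..})"
    using open_chart_img[OF c] by (intro continuous_open_preimage assms c) (auto intro!: open_Times)
  moreover have "(chart_img c \<times> UNIV) \<inter> (\<lambda>(y, w). f (chart_inv c y, coord_vector A c (chart_inv c y) w)) -` {a<..}
      = {(y, w). y \<in> chart_img c \<and> a < f (chart_inv c y, coord_vector A c (chart_inv c y) w)}" by auto
  ultimately show "open {(y, w). y \<in> chart_img c \<and> a < f (chart_inv c y, coord_vector A c (chart_inv c y) w)}"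
    by simp
qed

lemma measurable_fst_tangent: "fst \<in> measurable (tangent_borel A) borel"
proof (rule borel_measurableI)
  fix U :: "'m set" assume U: "open U"
  have "{(x, v) \<in> tangent_bundle A. x \<in> U} \<in> sets (tangent_borel A)"
  proof (rule sets_tangent_borel_chartwise)
    fix c assume "c \<in> A"
    then have "open ({y \<in> chart_img c. chart_inv c y \<in> U} \<times> (UNIV :: 'e set))"
      using U by (intro open_Times open_chart_vimage) auto
    moreover have "{y \<in> chart_img c. chart_inv c y \<in> U} \<times> (UNIV :: 'e set)
        = {(y, w). y \<in> chart_img c \<and> chart_inv c y \<in> U}" by auto
    ultimately show "open {(y, w :: 'e). y \<in> chart_img c \<and> chart_inv c y \<in> U}" by simp
  qed
  moreover have "{(x, v) \<in> tangent_bundle A. x \<in> U} = fst -` U \<inter> space (tangent_borel A)"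
    by (auto simp: space_tangent_borel)
  ultimately show "fst -` U \<inter> space (tangent_borel A) \<in> sets (tangent_borel A)" by simp
qed

lemma differential_coord_vector:
  assumes "f \<in> C1_functions A" "c \<in> A" "y \<in> chart_img c"
  shows "differential A f (chart_inv c y) (coord_vector A c (chart_inv c y) w) = chart_grad c f y \<bullet> w"
  using assms by (simp add: differential_chart_grad covec_of_apply coord_vector_in_tangent_space coord_vector_self)

lemma borel_measurable_differential:
  assumes "f \<in> C1_functions A"
  shows "(\<lambda>(x, v). differential A f x v) \<in> borel_measurable (tangent_borel A)"
proof (rule borel_measurable_tangent_continuous)
  fix c assume c: "c \<in> A"
  have "continuous_on (chart_img c \<times> UNIV) (\<lambda>(y, w :: 'e). chart_grad c f y \<bullet> w)"
    unfolding case_prod_beta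
    by (intro continuous_intros continuous_on_compose2[OF continuous_on_chart_grad[OF assms c]]) auto
  then show "continuous_on (chart_img c \<times> UNIV)
      (\<lambda>(y, w). case (chart_inv c y, coord_vector A c (chart_inv c y) w) of (x, v) \<Rightarrow> differential A f x v)"
    by (rule continuous_on_eq) (use assms c in \<open>auto simp: differential_coord_vector\<close>)
qed

text \<open>The first coordinate of the parameter space labels the chart.\<close>

lemma measurable_tangent_param:
  fixes N :: nat and cs :: "nat \<Rightarrow> ('m, 'e) chart" and S :: "nat \<Rightarrow> ('e \<times> 'e \<times> real) set"
  assumes cs: "\<And>j. j < N \<Longrightarrow> cs j \<in> A" and S: "\<And>j. j < N \<Longrightarrow> S j \<subseteq> chart_img (cs j) \<times> UNIV"
    and K: "K = (\<Union>j<N. {real j} \<times> S j)"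
    and \<Theta>: "\<And>j y v \<tau>. \<Theta> (real j, y, v, \<tau>) = (chart_inv (cs j) y, coord_vector A (cs j) (chart_inv (cs j) y) v)"
  shows "\<Theta> \<in> measurable (restrict_space borel K) (tangent_borel A)"
proof -
  have \<Theta>_bundle: "\<Theta> z \<in> tangent_bundle A" if z: "z \<in> K" for z
  proof -
    obtain j y v \<tau> where "j < N" "z = (real j, y, v, \<tau>)" "(y, v, \<tau>) \<in> S j" using z K by auto
    then show ?thesis using cs S[of j] by (auto simp: \<Theta> intro!: tangent_bundleI)
  qed
  have "continuous_map (top_of_set K) (tangent_topology A) \<Theta>"
    unfolding tangent_topology_def
  proof (rule continuous_on_generated_topo)
    let ?gens = "{{(x, v) \<in> tangent_bundle A. x \<in> chart_dom c \<and> (chart_map c x, v c) \<in> W} | c W. c \<in> A \<and> open W}"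
    show "\<Theta> ` topspace (top_of_set K) \<subseteq> \<Union> ?gens"
    proof
      fix w assume "w \<in> \<Theta> ` topspace (top_of_set K)"
      then have w: "w \<in> tangent_bundle A" using \<Theta>_bundle by auto
      obtain c where c: "c \<in> A" "fst w \<in> chart_dom c" by (rule chart_cover)
      have "w \<in> {(x, v) \<in> tangent_bundle A. x \<in> chart_dom c \<and> (chart_map c x, v c) \<in> UNIV}"
        using w c by auto
      then show "w \<in> \<Union> ?gens" using c open_UNIV by blast
    qed
    show "openin (top_of_set K) (\<Theta> -` U \<inter> topspace (top_of_set K))" if "U \<in> ?gens" for U
    proof -
      obtain d W where d: "d \<in> A" and W: "open W" and
        U: "U = {(x, v) \<in> tangent_bundle A. x \<in> chart_dom d \<and> (chart_map d x, v d) \<in> W}"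
        using \<open>U \<in> ?gens\<close> by blast
      \<comment> \<open>Coordinates in \<open>d\<close> of the vector given in the chart
        \<open>cs j\<close>. Expanding in \<open>Basis\<close> makes joint continuity visible, since
        the derivative is known to be continuous only for a fixed direction.\<close>
      let ?f = "\<lambda>j w. (transition (cs j) d (fst w),
        \<Sum>b\<in>Basis. (fst (snd w) \<bullet> b) *\<^sub>R frechet_derivative (transition (cs j) d) (at (fst w)) b)"
      define O' where "O' j = (overlap (cs j) d \<times> (UNIV :: ('e \<times> real) set)) \<inter> ?f j -` W" for j
      have "open (O' j)" if j: "j < N" for j
        unfolding O'_def
      proof (rule continuous_open_preimage[OF _ _ W])
        show "open (overlap (cs j) d \<times> (UNIV :: ('e \<times> real) set))"
          by (intro open_Times open_overlap cs j d) auto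
        show "continuous_on (overlap (cs j) d \<times> UNIV) (?f j)"
          by (intro continuous_intros continuous_on_compose2[OF continuous_on_transition[OF cs[OF j] d]]
              continuous_on_compose2[OF continuous_on_transition_derivative[OF cs[OF j] d]]) auto
      qed
      \<comment> \<open>Balls of radius 1/2 around distinct natural numbers are disjoint, so the
        label of a point of \<open>K\<close> decides which \<open>O' j\<close> applies.\<close>
      then have op: "open (\<Union>j<N. ball (real j) (1/2) \<times> O' j)" by (intro open_UN open_Times ballI) auto
      have eq: "\<Theta> -` U \<inter> topspace (top_of_set K) = K \<inter> (\<Union>j<N. ball (real j) (1/2) \<times> O' j)"
      proof -
        have *: "\<Theta> (real j, w) \<in> U \<longleftrightarrow> w \<in> O' j" if j: "j < N" and w: "w \<in> S j" for j w
        proof -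
          obtain y v \<tau> where w': "w = (y, v, \<tau>)" by (cases w) auto
          have y: "y \<in> chart_img (cs j)" using S[OF j] w w' by auto
          let ?x = "chart_inv (cs j) y"
          have "coord_vector A (cs j) ?x v d = frechet_derivative (transition (cs j) d) (at y) v" if "?x \<in> chart_dom d"
            using that d cs[OF j] y by (simp add: coord_vector_def)
          moreover have "frechet_derivative (transition (cs j) d) (at y) v =
              (\<Sum>b\<in>Basis. (v \<bullet> b) *\<^sub>R frechet_derivative (transition (cs j) d) (at y) b)" if "?x \<in> chart_dom d"
          proof -
            have "y \<in> overlap (cs j) d" using that y cs[OF j] by (simp add: mem_overlap_iff)
            then interpret D: bounded_linear "frechet_derivative (transition (cs j) d) (at y)"
              using transition_has_derivative[OF cs[OF j] d] by (blast intro: has_derivative_bounded_linear)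
            have "frechet_derivative (transition (cs j) d) (at y) (\<Sum>b\<in>Basis. (v \<bullet> b) *\<^sub>R b) =
              (\<Sum>b\<in>Basis. (v \<bullet> b) *\<^sub>R frechet_derivative (transition (cs j) d) (at y) b)"
              by (simp add: D.sum D.scaleR)
            then show ?thesis by (simp add: euclidean_representation)
          qed
          ultimately show ?thesis
            using tangent_bundleI[OF cs[OF j] y, of v] y cs[OF j]
            by (auto simp: w' \<Theta> U O'_def mem_overlap_iff transition_def)
        qed
        have same: "i = j" if "real j \<in> ball (real i) (1/2)" for i j :: nat
          using that by (cases i j rule: linorder_cases) (auto simp: dist_real_def)
        show ?thesis
        proof (intro equalityI subsetI)
          fix z assume "z \<in> \<Theta> -` U \<inter> topspace (top_of_set K)"
          then have z: "z \<in> K" "\<Theta> z \<in> U" by auto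
          then obtain j w where j: "j < N" "z = (real j, w)" "w \<in> S j" unfolding K by blast
          then have "z \<in> ball (real j) (1/2) \<times> O' j" using *[OF j(1,3)] z(2) by simp
          then show "z \<in> K \<inter> (\<Union>j<N. ball (real j) (1/2) \<times> O' j)" using z(1) j(1) by blast
        next
          fix z assume z: "z \<in> K \<inter> (\<Union>j<N. ball (real j) (1/2) \<times> O' j)"
          then obtain j w where j: "j < N" "z = (real j, w)" "w \<in> S j" unfolding K by blast
          obtain i where i: "real j \<in> ball (real i) (1/2)" "w \<in> O' i" using z j(2) by blast
          then have "\<Theta> z \<in> U" using *[OF j(1,3)] same[OF i(1)] j(2) by simp
          then show "z \<in> \<Theta> -` U \<inter> topspace (top_of_set K)" using z by simp
        qed
      qed
      show ?thesis by (subst eq) (rule openin_open_Int[OF op])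
    qed
  qed
  then have cm: "openin (top_of_set K) {z \<in> K. \<Theta> z \<in> W}" if "openin (tangent_topology A) W" for W
    using that unfolding continuous_map_def by auto
  show ?thesis
    unfolding tangent_borel_def
  proof (rule measurable_measure_of)
    show "{W. openin (tangent_topology A) W} \<subseteq> Pow (tangent_bundle A)" using openin_tangent_subset by blast
    show "\<Theta> \<in> space (restrict_space borel K) \<rightarrow> tangent_bundle A"
      using \<Theta>_bundle by (auto simp: space_restrict_space)
    fix W assume "W \<in> {W. openin (tangent_topology A) W}"
    then obtain T where "open T" "{z \<in> K. \<Theta> z \<in> W} = K \<inter> T" using cm[of W] by (auto simp: openin_open)
    moreover have "\<Theta> -` W \<inter> space (restrict_space borel K) = {z \<in> K. \<Theta> z \<in> W}"
      by (auto simp: space_restrict_space)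
    ultimately show "\<Theta> -` W \<inter> space (restrict_space borel K) \<in> sets (restrict_space borel K)"
      by (auto simp: sets_restrict_space)
  qed
qed

end

section \<open>A Mather measure over the maximum points\<close>

context hamiltonian
begin

text \<open>A supremum of continuous functions has open superlevel sets, as unions over
  \<open>p\<close>. The bound \<open>Lagrangian_bdd\<close> is what lets a strict inequality for the
  supremum be read as an inequality for some \<open>p\<close>.\<close>

lemma borel_measurable_Lagrangian: "Lagrangian A G \<in> borel_measurable (tangent_borel A)"
proof (rule borel_measurable_tangentI)
  fix c a assume c: "c \<in> A"
  have "open ((chart_img c \<times> UNIV) \<inter> (\<lambda>(y, w). p \<bullet> w - H c y p) -` {a<..})" for p :: 'e
  proof (rule continuous_open_preimage)
    have "continuous_on (chart_img c \<times> UNIV) (\<lambda>z. case (fst z, p) of (y, p) \<Rightarrow> H c y p)"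
      by (rule continuous_on_compose2[OF continuous_on_H[OF c]]) (auto intro!: continuous_intros)
    then show "continuous_on (chart_img c \<times> UNIV) (\<lambda>(y, w). p \<bullet> w - H c y p)"
      unfolding case_prod_beta by (intro continuous_intros) auto
    show "open (chart_img c \<times> (UNIV :: 'e set))" using open_chart_img[OF c] by (intro open_Times) auto
  qed auto
  then have "open (\<Union>p. (chart_img c \<times> UNIV) \<inter> (\<lambda>(y, w). p \<bullet> w - H c y p) -` {a<..})" by blast
  moreover have "(\<Union>p. (chart_img c \<times> UNIV) \<inter> (\<lambda>(y, w). p \<bullet> w - H c y p) -` {a<..}) =
      {(y, w). y \<in> chart_img c \<and> a < Lagrangian A G (chart_inv c y, coord_vector A c (chart_inv c y) w)}"
    using c by (auto simp: Lagrangian_coord_vector less_cSUP_iff[OF UNIV_not_empty Lagrangian_bdd])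
  ultimately show "open {(y, w). y \<in> chart_img c \<and> a < Lagrangian A G (chart_inv c y, coord_vector A c (chart_inv c y) w)}"
    by simp
qed

lemma continuous_on_tnorm:
  assumes c: "c \<in> A"
  shows "continuous_on (chart_img c \<times> UNIV) (\<lambda>(y, w). tnorm g (chart_inv c y) (coord_vector A c (chart_inv c y) w))"
proof -
  let ?g = "\<lambda>i j y. g (chart_inv c y) (coord_vector A c (chart_inv c y) i) (coord_vector A c (chart_inv c y) j)"
  have "continuous_on (chart_img c \<times> UNIV) (\<lambda>z :: 'e \<times> 'e. ?g i j (fst z))" for i j
  proof (rule continuous_on_compose2[of "chart_img c" "?g i j"])
    have "smooth_on (chart_img c) (?g i j)" using metric c unfolding riemannian_metric_def by blast
    then have "Ck_on 0 (chart_img c) (?g i j)" unfolding smooth_on_def by blast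
    then show "continuous_on (chart_img c) (?g i j)" by simp
  qed (auto intro!: continuous_intros)
  then have "continuous_on (chart_img c \<times> UNIV)
      (\<lambda>z :: 'e \<times> 'e. sqrt (\<Sum>i\<in>Basis. \<Sum>j\<in>Basis. (snd z \<bullet> i) * (snd z \<bullet> j) * ?g i j (fst z)))"
    by (intro continuous_intros)
  then show ?thesis
  proof (rule continuous_on_eq)
    fix z :: "'e \<times> 'e" assume "z \<in> chart_img c \<times> UNIV"
    then have "chart_inv c (fst z) \<in> chart_dom c" using c by auto
    from metric_in_coordinates[OF c this, of "snd z" "snd z"]
    show "sqrt (\<Sum>i\<in>Basis. \<Sum>j\<in>Basis. (snd z \<bullet> i) * (snd z \<bullet> j) * ?g i j (fst z)) =
        (case z of (y, w) \<Rightarrow> tnorm g (chart_inv c y) (coord_vector A c (chart_inv c y) w))"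
      by (simp add: tnorm_def case_prod_beta)
  qed
qed

lemma borel_measurable_tnorm: "(\<lambda>(x, v). tnorm g x v) \<in> borel_measurable (tangent_borel A)"
  by (rule borel_measurable_tangent_continuous) (use continuous_on_tnorm in \<open>simp add: case_prod_beta\<close>)

text \<open>Ensures that the supremum in \<open>critical_value\<close> dominates the values of
  \<open>G\<close>, as the lower bound on the action requires.\<close>

lemma bdd_above_G_differential:
  assumes \<phi>: "\<phi> \<in> C1_functions A"
  shows "bdd_above (range (\<lambda>x. G (x, differential A \<phi> x)))"
proof -
  obtain N :: nat and cs :: "nat \<Rightarrow> ('m, 'e) chart" and Q :: "nat \<Rightarrow> 'e set"
  where cs: "\<And>j. j < N \<Longrightarrow> cs j \<in> A" and Q: "\<And>j. j < N \<Longrightarrow> compact (Q j)" "\<And>j. j < N \<Longrightarrow> Q j \<subseteq> chart_img (cs j)"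
    and cover: "\<And>x. \<exists>j<N. x \<in> chart_dom (cs j) \<and> chart_map (cs j) x \<in> Q j"
    by (rule finite_chart_cover) (rule that)
  let ?h = "\<lambda>j y. H (cs j) y (chart_grad (cs j) \<phi> y)"
  have "bounded (?h j ` Q j)" if j: "j < N" for j
  proof (intro compact_imp_bounded compact_continuous_image Q j)
    have gr: "continuous_on (Q j) (\<lambda>y. (y, chart_grad (cs j) \<phi> y))"
      by (intro continuous_intros continuous_on_subset[OF continuous_on_chart_grad[OF \<phi> cs[OF j]] Q(2)[OF j]])
    show "continuous_on (Q j) (?h j)"
      using continuous_on_compose2[OF continuous_on_H[OF cs[OF j]] gr] Q(2)[OF j] by auto
  qed
  then have "bounded (\<Union>j<N. ?h j ` Q j)" by (intro bounded_UN) auto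
  moreover have "range (\<lambda>x. G (x, differential A \<phi> x)) \<subseteq> (\<Union>j<N. ?h j ` Q j)"
  proof
    fix w assume "w \<in> range (\<lambda>x. G (x, differential A \<phi> x))"
    then obtain x where w: "w = G (x, differential A \<phi> x)" by blast
    obtain j where j: "j < N" "x \<in> chart_dom (cs j)" "chart_map (cs j) x \<in> Q j" using cover by blast
    then have "w = ?h j (chart_map (cs j) x)"
      using cs by (simp add: w H_def differential_chart_grad[OF \<phi> cs])
    then show "w \<in> (\<Union>j<N. ?h j ` Q j)" using j by blast
  qed
  ultimately show ?thesis by (intro bounded_imp_bdd_above) (rule bounded_subset)
qed

text \<open>The parameter set contains only points over maximum points of \<open>u1 - u2\<close>, so
  the difference of the integrals averages the maximum.\<close>

lemma mather_measure_on_maximizers: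
  assumes u: "viscosity_solution A G (critical_value A G) u1" "viscosity_solution A G (critical_value A G) u2"
  obtains \<mu> where "mather_measure A g G \<mu>"
    "\<And>x. u1 x - u2 x \<le> (\<integral>y. u1 y \<partial>distr \<mu> borel fst) - (\<integral>y. u2 y \<partial>distr \<mu> borel fst)"
proof -
  define k where "k = critical_value A G"
  note u' = u[folded k_def]
  have cu: "continuous_on UNIV u1" "continuous_on UNIV u2" using u by (auto simp: viscosity_solution_def)
  obtain N :: nat and cs :: "nat \<Rightarrow> ('m, 'e) chart" and Q :: "nat \<Rightarrow> 'e set"
  where cs: "\<And>j. j < N \<Longrightarrow> cs j \<in> A" and Q: "\<And>j. j < N \<Longrightarrow> compact (Q j)" "\<And>j. j < N \<Longrightarrow> Q j \<subseteq> chart_img (cs j)"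
    and cover: "\<And>x. \<exists>j<N. x \<in> chart_dom (cs j) \<and> chart_map (cs j) x \<in> Q j"
    by (rule finite_chart_cover) (rule that)
  have "\<forall>j. \<exists>R. j < N \<longrightarrow> (\<forall>y\<in>Q j. \<forall>q v. H (cs j) y q \<le> k \<longrightarrow>
      (\<forall>p. k + v \<bullet> (p - q) \<le> H (cs j) y p) \<longrightarrow> norm v \<le> R \<and> \<bar>v \<bullet> q - k\<bar> \<le> R)"
    using subgradients_bounded[OF cs Q] by blast
  from this[THEN choice] obtain Rj where Rj: "\<And>j y q v. j < N \<Longrightarrow> y \<in> Q j \<Longrightarrow> H (cs j) y q \<le> k \<Longrightarrow>
      (\<And>p. k + v \<bullet> (p - q) \<le> H (cs j) y p) \<Longrightarrow> norm v \<le> Rj j \<and> \<bar>v \<bullet> q - k\<bar> \<le> Rj j" by blast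
  \<comment> \<open>One bound for all charts; it does not depend on the test function.\<close>
  define R where "R = (\<Sum>j<N. \<bar>Rj j\<bar>)"
  have RjR: "Rj j \<le> R" if "j < N" for j
    using member_le_sum[of j "{..<N}" "\<lambda>j. \<bar>Rj j\<bar>"] that by (simp add: R_def)
  define w where "w x = u1 x - u2 x" for x
  have cw: "continuous_on UNIV w" unfolding w_def by (intro continuous_intros cu)
  \<comment> \<open>Triples \<open>(y, v, \<tau>)\<close> with \<open>y\<close> a maximum point and
    \<open>\<tau>\<close> above the Lagrangian. Writing the latter as one inequality for each
    \<open>p\<close> shows closedness.\<close>
  define S where "S j = {z \<in> Q j \<times> cball 0 R \<times> cball 0 R.
      (\<forall>p. p \<bullet> fst (snd z) - H (cs j) (fst z) p \<le> snd (snd z)) \<and> (\<forall>x. w x \<le> w (chart_inv (cs j) (fst z)))}" for j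
  have SQ: "S j \<subseteq> Q j \<times> cball 0 R \<times> cball 0 R" for j by (auto simp: S_def)
  have S_img: "S j \<subseteq> chart_img (cs j) \<times> UNIV" if "j < N" for j using SQ[of j] Q(2)[OF that] by auto
  have compact_S: "compact (S j)" if j: "j < N" for j
  proof -
    let ?B = "Q j \<times> cball (0::'e) R \<times> cball (0::real) R"
    have B: "compact ?B" using Q j by (intro compact_Times) auto
    have 1: "closed {z \<in> ?B. p \<bullet> fst (snd z) - H (cs j) (fst z) p \<le> snd (snd z)}" for p
    proof (rule continuous_on_closed_Collect_le)
      have "continuous_on ?B (\<lambda>z. case (fst z, p) of (y, p) \<Rightarrow> H (cs j) y p)"
        by (rule continuous_on_compose2[OF continuous_on_H[OF cs[OF j]]])
          (use Q(2)[OF j] in \<open>auto intro!: continuous_intros\<close>)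
      then show "continuous_on ?B (\<lambda>z. p \<bullet> fst (snd z) - H (cs j) (fst z) p)"
        by (intro continuous_intros) auto
    qed (use B in \<open>auto intro!: continuous_intros compact_imp_closed\<close>)
    have 2: "closed {z \<in> ?B. w x \<le> w (chart_inv (cs j) (fst z))}" for x
    proof (rule continuous_on_closed_Collect_le)
      show "continuous_on ?B (\<lambda>z. w (chart_inv (cs j) (fst z)))"
        by (rule continuous_on_compose2[OF continuous_on_in_chart[OF cw cs[OF j]]])
          (use Q(2)[OF j] in \<open>auto intro!: continuous_intros\<close>)
    qed (use B in \<open>auto intro!: continuous_intros compact_imp_closed\<close>)
    have "S j = ?B \<inter> (\<Inter>p. {z \<in> ?B. p \<bullet> fst (snd z) - H (cs j) (fst z) p \<le> snd (snd z)}) \<inter>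
        (\<Inter>x. {z \<in> ?B. w x \<le> w (chart_inv (cs j) (fst z))})"
      by (auto simp: S_def)
    then show ?thesis using B 1 2 by (auto intro!: compact_Int_closed closed_INT)
  qed
  define K where "K = (\<Union>j<N. {real j} \<times> S j)"
  have compact_K: "compact K" unfolding K_def by (intro compact_UN compact_Times compact_S) auto
  have K_cases: "\<exists>j y v \<tau>. z = (real j, y, v, \<tau>) \<and> j < N \<and> (y, v, \<tau>) \<in> S j \<and> cs j \<in> A \<and> y \<in> Q j \<and> y \<in> chart_img (cs j)"
    if z: "z \<in> K" for z
  proof -
    obtain j s where "j < N" "z = (real j, s)" "s \<in> S j" using z by (auto simp: K_def)
    moreover obtain y v \<tau> where "s = (y, v, \<tau>)" by (cases s) auto
    ultimately show ?thesis using cs SQ[of j] Q(2)[of j] by blast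
  qed
  have cont_K: "continuous_on K f" if "\<And>j. j < N \<Longrightarrow> continuous_on (S j) (\<lambda>z. f (real j, z))"
    for f :: "real \<times> 'e \<times> 'e \<times> real \<Rightarrow> real"
    unfolding K_def using that compact_S by (intro continuous_on_indexed_pieces compact_imp_closed)
  \<comment> \<open>The differential of \<open>\<phi>\<close> on the coded vector; the floor
    recovers the label. The value 0 off \<open>K\<close> makes linearity in \<open>\<phi>\<close> an
    equality of functions.\<close>
  define F where "F \<phi> z = (if z \<in> K
      then chart_grad (cs (nat \<lfloor>fst z\<rfloor>)) \<phi> (fst (snd z)) \<bullet> fst (snd (snd z)) else 0)" for \<phi> z
  have F_eq: "F \<phi> (real j, y, v, \<tau>) = chart_grad (cs j) \<phi> y \<bullet> v" if "j < N" "(y, v, \<tau>) \<in> S j" for \<phi> j y v \<tau>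
    using that by (auto simp: F_def K_def)
  have F_comb: "F (\<lambda>x. a * \<phi> x + b * \<psi> x) z = a * F \<phi> z + b * F \<psi> z"
    if "\<phi> \<in> C1_functions A" "\<psi> \<in> C1_functions A" for a b \<phi> \<psi> z
  proof (cases "z \<in> K")
    case True
    then obtain j y v \<tau> where z: "z = (real j, y, v, \<tau>)" "j < N" "(y, v, \<tau>) \<in> S j" "cs j \<in> A" "y \<in> chart_img (cs j)"
      using K_cases by blast
    show ?thesis unfolding z(1) F_eq[OF z(2,3)] C1_combination(2)[OF that z(4,5)] by (simp add: inner_add_left)
  qed (simp add: F_def)
  have cont_F: "continuous_on K (F \<phi>)" if "\<phi> \<in> C1_functions A" for \<phi>
  proof (rule cont_K)
    fix j assume j: "j < N"
    have "continuous_on (S j) (\<lambda>z. chart_grad (cs j) \<phi> (fst z) \<bullet> fst (snd z))"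
      by (intro continuous_intros continuous_on_compose2[OF continuous_on_chart_grad[OF that cs[OF j]]])
        (use S_img[OF j] in auto)
    then show "continuous_on (S j) (\<lambda>z. F \<phi> (real j, z))"
      by (rule continuous_on_eq) (use j F_eq in auto)
  qed
  obtain \<nu> where \<nu>: "prob_space \<nu>" "sets \<nu> = sets (restrict_space borel K)"
    and \<nu>F: "\<And>f. f \<in> F ` C1_functions A \<Longrightarrow> (\<integral>z. f z \<partial>\<nu>) = 0"
    and \<nu>h: "(\<integral>z. snd (snd (snd z)) + k \<partial>\<nu>) \<le> 0"
  proof (rule annihilating_probability[OF compact_K, of "F ` C1_functions A" "\<lambda>z. snd (snd (snd z)) + k"])
    show "continuous_on K f" if "f \<in> F ` C1_functions A" for f using that cont_F by blast
    have "F (\<lambda>x. 0) = (\<lambda>z. 0)" using F_comb[OF C1_const[of 0] C1_const[of 0], of 0 0] by auto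
    then show "(\<lambda>z. 0) \<in> F ` C1_functions A" using C1_const[of 0] by (metis image_eqI)
    show "(\<lambda>z. f z + f' z) \<in> F ` C1_functions A" if ff: "f \<in> F ` C1_functions A" "f' \<in> F ` C1_functions A" for f f'
    proof -
      obtain \<phi> \<psi> where *: "\<phi> \<in> C1_functions A" "\<psi> \<in> C1_functions A" "f = F \<phi>" "f' = F \<psi>" using ff by blast
      have "(\<lambda>z. f z + f' z) = F (\<lambda>x. 1 * \<phi> x + 1 * \<psi> x)" using F_comb[OF *(1,2), of 1 1] * by auto
      then show ?thesis using C1_combination(1)[OF *(1,2), of 1 1] by blast
    qed
    show "(\<lambda>z. a * f z) \<in> F ` C1_functions A" if ff: "f \<in> F ` C1_functions A" for f a
    proof -
      obtain \<phi> where *: "\<phi> \<in> C1_functions A" "f = F \<phi>" using ff by blast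
      have "(\<lambda>z. a * f z) = F (\<lambda>x. a * \<phi> x + 0 * \<phi> x)" using F_comb[OF *(1,1), of a 0] * by auto
      then show ?thesis using C1_combination(1)[OF *(1,1), of a 0] by blast
    qed
    show "continuous_on K (\<lambda>z. snd (snd (snd z)) + k)" by (intro continuous_intros)
    fix f assume "f \<in> F ` C1_functions A"
    then obtain \<phi> where \<phi>: "\<phi> \<in> C1_functions A" and f: "f = F \<phi>" by blast
    obtain j y q where j: "j < N" and y: "y \<in> Q j"
      and ymax: "\<And>x. u1 x - u2 x \<le> u1 (chart_inv (cs j) y) - u2 (chart_inv (cs j) y)"
      and q: "H (cs j) y q \<le> k"
      and seg: "\<And>t. 0 \<le> t \<Longrightarrow> t \<le> 1 \<Longrightarrow> k \<le> H (cs j) y ((1 - t) *\<^sub>R q + t *\<^sub>R chart_grad (cs j) \<phi> y)"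
      by (rule contact_segment[OF u' \<phi> cs Q cover]) (assumption | rule that)+
    obtain v where v: "0 \<le> v \<bullet> (chart_grad (cs j) \<phi> y - q)" "\<And>p. k + v \<bullet> (p - q) \<le> H (cs j) y p"
      by (rule subgradient_along_segment[OF convex_on_H q seg]) (assumption | rule that)+
    \<comment> \<open>By the subgradient inequality this number lies above the Lagrangian at
      \<open>v\<close>.\<close>
    define \<tau> where "\<tau> = v \<bullet> q - k"
    have "norm v \<le> R" "\<bar>\<tau>\<bar> \<le> R" using Rj[OF j y q v(2)] RjR[OF j] by (auto simp: \<tau>_def)
    moreover have "p \<bullet> v - H (cs j) y p \<le> \<tau>" for p
      using v(2)[of p] by (simp add: \<tau>_def inner_diff_right inner_commute)
    ultimately have yS: "(y, v, \<tau>) \<in> S j" using y ymax by (simp add: S_def w_def)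
    \<comment> \<open>The left side is \<open>v \<bullet> q\<close>, so this is the sign obtained
      from the separation.\<close>
    have "\<tau> + k \<le> F \<phi> (real j, y, v, \<tau>)"
      unfolding F_eq[OF j yS] using v(1) by (simp add: \<tau>_def inner_diff_right inner_commute)
    moreover have "(real j, y, v, \<tau>) \<in> K" using j yS by (auto simp: K_def)
    ultimately show "\<exists>z\<in>K. snd (snd (snd z)) + k \<le> f z" unfolding f by force
  qed (rule that)
  interpret \<nu>: prob_space \<nu> by (rule \<nu>)
  have sp: "space \<nu> = K" using sets_eq_imp_space_eq[OF \<nu>(2)] by (simp add: space_restrict_space)
  have meas: "f \<in> borel_measurable \<nu>" if "continuous_on K f" for f :: "real \<times> 'e \<times> 'e \<times> real \<Rightarrow> real"
    using borel_measurable_continuous_on_restrict[OF that] \<nu>(2) by (simp cong: measurable_cong_sets)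
  have bdd: "\<exists>B. \<forall>z\<in>K. \<bar>f z\<bar> \<le> B" if "continuous_on K f" for f :: "real \<times> 'e \<times> 'e \<times> real \<Rightarrow> real"
    using compact_imp_bounded[OF compact_continuous_image[OF that compact_K]] by (auto simp: bounded_iff)
  have intg: "integrable \<nu> f" if f: "continuous_on K f" for f :: "real \<times> 'e \<times> 'e \<times> real \<Rightarrow> real"
  proof -
    obtain B where "\<forall>z\<in>K. \<bar>f z\<bar> \<le> B" using bdd[OF f] by blast
    then show ?thesis using meas[OF f] sp by (intro \<nu>.integrable_const_bound[where B=B] AE_I2) auto
  qed
  define \<Theta> where "\<Theta> z = (chart_inv (cs (nat \<lfloor>fst z\<rfloor>)) (fst (snd z)),
      coord_vector A (cs (nat \<lfloor>fst z\<rfloor>)) (chart_inv (cs (nat \<lfloor>fst z\<rfloor>)) (fst (snd z))) (fst (snd (snd z))))"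
    for z :: "real \<times> 'e \<times> 'e \<times> real"
  have \<Theta>_eq: "\<Theta> (real j, y, v, \<tau>) = (chart_inv (cs j) y, coord_vector A (cs j) (chart_inv (cs j) y) v)" for j y v \<tau>
    by (simp add: \<Theta>_def)
  have m\<Theta>: "\<Theta> \<in> measurable \<nu> (tangent_borel A)"
    using measurable_tangent_param[OF cs S_img K_def \<Theta>_eq] \<nu>(2) by (simp cong: measurable_cong_sets)
  define \<mu> where "\<mu> = distr \<nu> (tangent_borel A) \<Theta>"
  have int\<mu>: "(\<integral>z. f z \<partial>\<mu>) = (\<integral>z. f (\<Theta> z) \<partial>\<nu>)" if "f \<in> borel_measurable (tangent_borel A)"
    for f :: "'m \<times> ('m, 'e) tvec \<Rightarrow> real"
    unfolding \<mu>_def by (rule integral_distr[OF m\<Theta> that])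
  have diff_\<Theta>: "(case \<Theta> z of (x, v) \<Rightarrow> differential A \<phi> x v) = F \<phi> z" if "z \<in> K" "\<phi> \<in> C1_functions A" for z \<phi>
  proof -
    obtain j y v \<tau> where z: "z = (real j, y, v, \<tau>)" "j < N" "(y, v, \<tau>) \<in> S j" "cs j \<in> A" "y \<in> chart_img (cs j)"
      using K_cases[OF \<open>z \<in> K\<close>] by blast
    show ?thesis using that(2) z by (simp add: \<Theta>_eq F_eq differential_coord_vector)
  qed
  have closed: "closed_prob_measure A g \<mu>"
    unfolding closed_prob_measure_def
  proof (intro conjI ballI)
    show "prob_space \<mu>" unfolding \<mu>_def by (rule \<nu>.prob_space_distr[OF m\<Theta>])
    show "sets \<mu> = sets (tangent_borel A)" by (simp add: \<mu>_def)
    show "(\<integral>(x, v). differential A \<phi> x v \<partial>\<mu>) = 0" if "\<phi> \<in> C1_functions A" for \<phi>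
    proof -
      have "(\<integral>(x, v). differential A \<phi> x v \<partial>\<mu>) = (\<integral>z. F \<phi> z \<partial>\<nu>)"
        unfolding int\<mu>[OF borel_measurable_differential[OF that]]
        by (rule Bochner_Integration.integral_cong) (use diff_\<Theta> that sp in auto)
      then show ?thesis using \<nu>F that by simp
    qed
    have "continuous_on K (\<lambda>z. case \<Theta> z of (x, v) \<Rightarrow> tnorm g x v)"
    proof (rule cont_K)
      fix j assume j: "j < N"
      have "continuous_on (S j) (\<lambda>z. case (fst z, fst (snd z)) of (y, w) \<Rightarrow>
          tnorm g (chart_inv (cs j) y) (coord_vector A (cs j) (chart_inv (cs j) y) w))"
        by (rule continuous_on_compose2[OF continuous_on_tnorm[OF cs[OF j]]])
          (use S_img[OF j] in \<open>auto intro!: continuous_intros\<close>)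
      then show "continuous_on (S j) (\<lambda>z. case \<Theta> (real j, z) of (x, v) \<Rightarrow> tnorm g x v)"
        by (rule continuous_on_eq) (auto simp: \<Theta>_eq)
    qed
    from bdd[OF this] obtain B where B: "\<And>z. z \<in> K \<Longrightarrow> \<bar>case \<Theta> z of (x, v) \<Rightarrow> tnorm g x v\<bar> \<le> B" by blast
    have mt: "(\<lambda>z. ennreal (case z of (x, v) \<Rightarrow> tnorm g x v)) \<in> borel_measurable (tangent_borel A)"
      using borel_measurable_tnorm by (rule measurable_compose) simp
    have "(\<integral>\<^sup>+ (x, v). ennreal (tnorm g x v) \<partial>\<mu>) = (\<integral>\<^sup>+ z. ennreal (case z of (x, v) \<Rightarrow> tnorm g x v) \<partial>\<mu>)"
      by (intro nn_integral_cong) (simp add: case_prod_beta)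
    also have "\<dots> = (\<integral>\<^sup>+ z. ennreal (case \<Theta> z of (x, v) \<Rightarrow> tnorm g x v) \<partial>\<nu>)"
      unfolding \<mu>_def using mt by (intro nn_integral_distr[OF m\<Theta>]) simp
    also have "\<dots> \<le> (\<integral>\<^sup>+ z. ennreal B \<partial>\<nu>)"
      using B sp by (intro nn_integral_mono ennreal_leI) (auto simp: abs_le_iff)
    also have "\<dots> < \<infinity>" by (simp add: \<nu>.emeasure_space_1)
    finally show "(\<integral>\<^sup>+ (x, v). ennreal (tnorm g x v) \<partial>\<mu>) < \<infinity>" .
  qed
  let ?L = "\<lambda>z. Lagrangian A G (\<Theta> z)"
  have mL: "?L \<in> borel_measurable \<nu>" by (rule measurable_compose[OF m\<Theta> borel_measurable_Lagrangian])
  have L_upper: "?L z \<le> snd (snd (snd z))" if "z \<in> K" for z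
  proof -
    obtain j y v \<tau> where z: "z = (real j, y, v, \<tau>)" "j < N" "(y, v, \<tau>) \<in> S j" "cs j \<in> A" "y \<in> chart_img (cs j)"
      using K_cases[OF \<open>z \<in> K\<close>] by blast
    have "(SUP p. p \<bullet> v - H (cs j) y p) \<le> \<tau>" using z(3) by (intro cSUP_least) (auto simp: S_def)
    then show ?thesis by (simp add: z(1) \<Theta>_eq Lagrangian_coord_vector[OF z(4,5)])
  qed
  define s where "s \<phi> = (SUP x. G (x, differential A \<phi> x))" for \<phi>
  \<comment> \<open>The Fenchel inequality at the differential of \<open>\<phi>\<close>, with
    \<open>G\<close> replaced by its supremum.\<close>
  have L_lower: "F \<phi> z - s \<phi> \<le> ?L z" if "z \<in> K" "\<phi> \<in> C1_functions A" for z \<phi>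
  proof -
    obtain j y v \<tau> where z: "z = (real j, y, v, \<tau>)" "j < N" "(y, v, \<tau>) \<in> S j" "cs j \<in> A" "y \<in> chart_img (cs j)"
      using K_cases[OF \<open>z \<in> K\<close>] by blast
    let ?p = "chart_grad (cs j) \<phi> y"
    have "H (cs j) y ?p = G (chart_inv (cs j) y, differential A \<phi> (chart_inv (cs j) y))"
      using z that(2) by (simp add: H_def differential_chart_grad)
    also have "\<dots> \<le> s \<phi>" unfolding s_def by (rule cSUP_upper[OF UNIV_I bdd_above_G_differential[OF that(2)]])
    finally have "F \<phi> z - s \<phi> \<le> ?p \<bullet> v - H (cs j) y ?p" by (simp add: z(1) F_eq[OF z(2,3)])
    also have "\<dots> \<le> (SUP p. p \<bullet> v - H (cs j) y p)" by (rule cSUP_upper[OF UNIV_I Lagrangian_bdd[OF z(4,5)]])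
    also have "\<dots> = ?L z" by (simp add: z(1) \<Theta>_eq Lagrangian_coord_vector[OF z(4,5)])
    finally show ?thesis .
  qed
  have cont_\<tau>: "continuous_on K (\<lambda>z. snd (snd (snd z)))" by (intro continuous_intros)
  have iL: "integrable \<nu> ?L"
  proof -
    \<comment> \<open>The coordinate \<open>\<tau>\<close> bounds the Lagrangian from above, and
      \<open>L_lower\<close> with the test function 0 bounds it from below.\<close>
    obtain B1 B2 where B: "\<forall>z\<in>K. \<bar>F (\<lambda>x. 0) z\<bar> \<le> B1" "\<forall>z\<in>K. \<bar>snd (snd (snd z))\<bar> \<le> B2"
      using bdd[OF cont_F[OF C1_const[of 0]]] bdd[OF cont_\<tau>] by blast
    have "\<bar>?L z\<bar> \<le> B1 + \<bar>s (\<lambda>x. 0)\<bar> + B2" if "z \<in> K" for z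
    proof -
      have "\<bar>F (\<lambda>x. 0) z\<bar> \<le> B1" "\<bar>snd (snd (snd z))\<bar> \<le> B2" using B that by blast+
      then show ?thesis using L_upper[OF that] L_lower[OF that C1_const[of 0]] by linarith
    qed
    then show ?thesis using mL sp by (intro \<nu>.integrable_const_bound[where B="B1 + \<bar>s (\<lambda>x. 0)\<bar> + B2"] AE_I2) auto
  qed
  have "(\<integral>z. ?L z \<partial>\<nu>) \<le> (\<integral>z. snd (snd (snd z)) \<partial>\<nu>)"
    using L_upper sp by (intro integral_mono iL intg cont_\<tau>) auto
  also have "\<dots> \<le> - k" using \<nu>h intg[OF cont_\<tau>] by (simp add: \<nu>.prob_space)
  finally have upper: "(\<integral>z. ?L z \<partial>\<nu>) \<le> - k" .
  \<comment> \<open>Annihilation removes \<open>F \<phi>\<close>; the infimum over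
    \<open>\<phi>\<close> then turns \<open>s \<phi>\<close> into the critical value.\<close>
  have "- (\<integral>z. ?L z \<partial>\<nu>) \<le> s \<phi>" if \<phi>: "\<phi> \<in> C1_functions A" for \<phi>
  proof -
    have "(\<integral>z. F \<phi> z - s \<phi> \<partial>\<nu>) \<le> (\<integral>z. ?L z \<partial>\<nu>)"
      using L_lower[OF _ \<phi>] sp
      by (intro integral_mono iL Bochner_Integration.integrable_diff intg cont_F \<phi>) auto
    then show ?thesis using \<nu>F[of "F \<phi>"] \<phi> intg[OF cont_F[OF \<phi>]] by (simp add: \<nu>.prob_space)
  qed
  then have "- (\<integral>z. ?L z \<partial>\<nu>) \<le> k"
    unfolding k_def critical_value_def using C1_const by (intro cINF_greatest) (auto simp: s_def)
  with upper have L_eq: "(\<integral>z. ?L z \<partial>\<nu>) = - k" by simp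
  have "mather_measure A g G \<mu>"
    unfolding mather_measure_def
  proof (intro conjI closed)
    show "integrable \<mu> (Lagrangian A G)"
      unfolding \<mu>_def using iL by (simp add: integrable_distr_eq[OF m\<Theta> borel_measurable_Lagrangian])
    show "(\<integral>z. Lagrangian A G z \<partial>\<mu>) = - critical_value A G"
      using L_eq by (simp add: int\<mu>[OF borel_measurable_Lagrangian] k_def)
  qed
  moreover have "u1 x - u2 x \<le> (\<integral>y. u1 y \<partial>distr \<mu> borel fst) - (\<integral>y. u2 y \<partial>distr \<mu> borel fst)" for x
  proof -
    have int: "(\<integral>y. f y \<partial>distr \<mu> borel fst) = (\<integral>z. f (fst (\<Theta> z)) \<partial>\<nu>)" "integrable \<nu> (\<lambda>z. f (fst (\<Theta> z)))"
      if f: "continuous_on UNIV f" for f :: "'m \<Rightarrow> real"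
    proof -
      have fb: "f \<in> borel_measurable borel" by (rule borel_measurable_continuous_onI[OF f])
      have mfst: "fst \<in> measurable \<mu> borel" using measurable_fst_tangent by (simp add: \<mu>_def)
      have "(\<integral>y. f y \<partial>distr \<mu> borel fst) = (\<integral>z. f (fst z) \<partial>\<mu>)" by (rule integral_distr[OF mfst fb])
      also have "\<dots> = (\<integral>z. f (fst (\<Theta> z)) \<partial>\<nu>)" by (rule int\<mu>[OF measurable_compose[OF measurable_fst_tangent fb]])
      finally show "(\<integral>y. f y \<partial>distr \<mu> borel fst) = (\<integral>z. f (fst (\<Theta> z)) \<partial>\<nu>)" .
      have "continuous_on K (\<lambda>z. f (fst (\<Theta> z)))"
      proof (rule cont_K)
        fix j assume j: "j < N"
        have "continuous_on (S j) (\<lambda>z. f (chart_inv (cs j) (fst z)))"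
          by (rule continuous_on_compose2[OF continuous_on_in_chart[OF f cs[OF j]]])
            (use S_img[OF j] in \<open>auto intro!: continuous_intros\<close>)
        then show "continuous_on (S j) (\<lambda>z. f (fst (\<Theta> (real j, z))))"
          by (rule continuous_on_eq) (auto simp: \<Theta>_eq)
      qed
      then show "integrable \<nu> (\<lambda>z. f (fst (\<Theta> z)))" by (rule intg)
    qed
    have "w x \<le> w (fst (\<Theta> z))" if "z \<in> K" for z
    proof -
      obtain j y v \<tau> where z: "z = (real j, y, v, \<tau>)" "j < N" "(y, v, \<tau>) \<in> S j"
        using K_cases[OF \<open>z \<in> K\<close>] by blast
      then show ?thesis by (simp add: \<Theta>_eq S_def)
    qed
    then have "w x \<le> (\<integral>z. w (fst (\<Theta> z)) \<partial>\<nu>)"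
      using sp int(2)[OF cw] by (intro \<nu>.integral_ge_const AE_I2) auto
    also have "\<dots> = (\<integral>z. u1 (fst (\<Theta> z)) \<partial>\<nu>) - (\<integral>z. u2 (fst (\<Theta> z)) \<partial>\<nu>)"
      unfolding w_def by (rule Bochner_Integration.integral_diff[OF int(2)[OF cu(1)] int(2)[OF cu(2)]])
    finally show ?thesis by (simp add: w_def int(1)[OF cu(1)] int(1)[OF cu(2)])
  qed
  ultimately show ?thesis by (rule that)
qed

end

theorem corollary6:
  fixes A :: "('m::t2_space, 'e::euclidean_space) chart set"
    and g :: "'m \<Rightarrow> ('m, 'e) tvec \<Rightarrow> ('m, 'e) tvec \<Rightarrow> real"
    and G :: "'m \<times> ('m, 'e) covec \<Rightarrow> real"
    and u1 u2 :: "'m \<Rightarrow> real"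
  assumes "closed_connected_riemannian_manifold A g"
    and "continuous_map (cotangent_topology A) euclideanreal G"
    and "convex_in_p A G"
    and "superlinear_in_p A g G"
    and "viscosity_solution A G (critical_value A G) u1"
    and "viscosity_solution A G (critical_value A G) u2"
    and "\<And>\<mu>. projected_mather_measure A g G \<mu> \<Longrightarrow> (\<integral>y. u1 y \<partial>\<mu>) \<le> (\<integral>y. u2 y \<partial>\<mu>)"
  shows "\<forall>x. u1 x \<le> u2 x"
proof
  fix x
  interpret hamiltonian A g G
    using assms(1-4) by unfold_locales (auto simp: closed_connected_riemannian_manifold_def)
  obtain \<mu> where \<mu>: "mather_measure A g G \<mu>"
    "\<And>x. u1 x - u2 x \<le> (\<integral>y. u1 y \<partial>distr \<mu> borel fst) - (\<integral>y. u2 y \<partial>distr \<mu> borel fst)"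
    using mather_measure_on_maximizers[OF assms(5,6)] by blast
  have "(\<integral>y. u1 y \<partial>distr \<mu> borel fst) \<le> (\<integral>y. u2 y \<partial>distr \<mu> borel fst)"
    using \<mu>(1) by (intro assms(7)) (auto simp: projected_mather_measure_def)
  with \<mu>(2)[of x] show "u1 x \<le> u2 x" by simp
qed

end
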